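(* Let $q=p^r$ be a power of a prime $p$ with $r\ge1$, let $V=\mathbb F_q^n$ be the natural $GL_n(q)$-module, and let $I$ be a composition of $n$ with associated standard parabolic subgroup $P_I\subseteq GL_n(q)$. Then there is the following isomorphism of (bi-graded) $\mathbb F_q$-algebras: $$A^*(V;S^\bullet(V))^{P_I}=\Omega(V)\otimes_{\mathbb F_q}S^\bullet(V)^{P_I}.$$
   Context: A composition $I=(n_1,\dots,n_\ell)$ of $n$ is a sequence of positive integers with sum $n$; $P_I$ is the subgroup of $GL_n(q)$ of block upper triangular matrices with invertible diagonal blocks of sizes $n_1,\dots,n_\ell$, where matrices act on $V$ with basis $x_1,\dots,x_n$ by $g\cdot x_j=\sum_k g_{kj}x_k$. $S^\bullet(V)$ and $\wedge^\bullet(V)$ are the symmetric and exterior algebras of $V$ over $\mathbb F_q$, and a superscript $P_I$ denotes the subspace of $P_I$-invariants. $A^*(V;S^\bullet(V))=\bigoplus_{0\le m\le n}\mathrm{Hom}_{\mathbb F_q}(\wedge^m(V),S^\bullet(V))\cong S^\bullet(V)\otimes\wedge^\bullet(V)^*$, with the natural $GL_n(q)$-action $(g\cdot\alpha)(u)=g\cdot\alpha(g^{-1}u)$; elements of $\mathrm{Hom}(\wedge^m(V),S^i(V))$ have bidegree $(i,m)$. It is an $\mathbb F_q$-algebra under the product defined, for $\alpha\in\mathrm{Hom}(\wedge^m(V),S^\bullet(V))$ and $\beta\in\mathrm{Hom}(\wedge^e(V),S^\bullet(V))$, by $$(\alpha\wedge\beta)(v_1\wedge\cdots\wedge v_{m+e})=\sum_\sigma\mathrm{sgn}(\sigma)\,\alpha(v_{\sigma(1)}\wedge\cdots\wedge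 v_{\sigma(m)})\,\beta(v_{\sigma(m+1)}\wedge\cdots\wedge v_{\sigma(m+e)}),$$ the sum being over $\sigma\in S_{m+e}$ with $\sigma(1)<\cdots<\sigma(m)$ and $\sigma(m+1)<\cdots<\sigma(m+e)$. $S^\bullet(V)$ is identified with the subalgebra $\mathrm{Hom}(\wedge^0(V),S^\bullet(V))$. For $i\ge0$, $\omega_i(V)\in\mathrm{Hom}(V,S^\bullet(V))$ is the ($GL_n(q)$-invariant) linear map $v\mapsto v^{q^i}$. The elements $\omega_0(V),\dots,\omega_{n-1}(V)$ generate an exterior $\mathbb F_q$-subalgebra of $A^*(V;S^\bullet(V))$, denoted $\Omega(V)$. The product $\Omega(V)\otimes_{\mathbb F_q}S^\bullet(V)^{P_I}$ is regarded as a subalgebra of $A^*(V;S^\bullet(V))^{P_I}$ via multiplication.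
   Formalization: The case q = 2 is excluded: for q = 2 and every n ≥ 1 the claim is false, since the determinant of P_I is trivial and the invariants contain a nonzero element of bidegree (0,n), while the right-hand side is zero there because each ω_i has positive polynomial degree. *)

theory Defs
  imports
    "Jordan_Normal_Form.Matrix"
    "HOL-Algebra.QuotRing"
    "HOL-Library.Cardinality"
    "HOL-Library.Poly_Mapping"
    "HOL-Combinatorics.Permutations"
    "HOL-Computational_Algebra.Primes"
begin

text \<open>
  Conventions.  \<open>V = F\<^sub>q\<^sup>n\<close> is \<^term>\<open>carrier_vec n\<close> over a finite field type, with basis
  \<open>x\<^sub>j\<close> given by \<^term>\<open>unit_vec n j\<close>; all indices start at 0.  With this basis the action
  \<open>g \<cdot> x\<^sub>j = \<Sum>\<^sub>k g\<^sub>k\<^sub>j x\<^sub>k\<close> is the matrix-vector product \<^term>\<open>g *\<^sub>v v\<close>.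
  Algebras over the field are \<^typ>\<open>('a, 'b) module\<close> records; a subalgebra has the same
  operations and a smaller carrier.
\<close>

section \<open>Standard parabolic subgroups\<close>

definition composition :: "nat list \<Rightarrow> nat \<Rightarrow> bool" where
  "composition I n \<longleftrightarrow> (\<forall>k\<in>set I. 0 < k) \<and> sum_list I = n"

definition offset :: "nat list \<Rightarrow> nat \<Rightarrow> nat" where
  "offset I k = sum_list (take k I)"

definition block :: "nat list \<Rightarrow> 'a mat \<Rightarrow> nat \<Rightarrow> nat \<Rightarrow> 'a mat" where
  "block I g k l = mat (I ! k) (I ! l) (\<lambda>(a, b). g $$ (offset I k + a, offset I l + b))"

definition parabolic :: "nat list \<Rightarrow> 'a::field mat set" where
  "parabolic I = {g \<in> carrier_mat (sum_list I) (sum_list I).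
     (\<forall>k<length I. \<forall>l<k. block I g k l = 0\<^sub>m (I ! k) (I ! l)) \<and>
     (\<forall>k<length I. invertible_mat (block I g k k))}"

definition GL :: "nat \<Rightarrow> 'a::field mat monoid" where
  "GL n = units_of (ring_mat TYPE('a) n ())"

section \<open>The symmetric algebra\<close>

text \<open>
  Polynomials in the variables \<open>x\<^sub>0, x\<^sub>1, \<dots>\<close>: a monomial is its finitely supported exponent
  function, and a polynomial is a finitely supported function on monomials, with the
  convolution product of \<^typ>\<open>'b \<Rightarrow>\<^sub>0 'a\<close>.
\<close>
type_synonym 'a mpoly = "(nat \<Rightarrow>\<^sub>0 nat) \<Rightarrow>\<^sub>0 'a"

definition PConst :: "'a::field \<Rightarrow> 'a mpoly" where
  "PConst c = Poly_Mapping.single 0 c"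

definition PVar :: "nat \<Rightarrow> 'a::field mpoly" where
  "PVar j = Poly_Mapping.single (Poly_Mapping.single j 1) 1"

definition Sym :: "nat \<Rightarrow> 'a::field mpoly set" where
  "Sym n = {f. \<forall>t\<in>Poly_Mapping.keys f. Poly_Mapping.keys t \<subseteq> {..<n}}"

definition homogeneous :: "nat \<Rightarrow> 'a::field mpoly set" where
  "homogeneous i = {f. \<forall>t\<in>Poly_Mapping.keys f. (\<Sum>j\<in>Poly_Mapping.keys t. Poly_Mapping.lookup t j) = i}"

text \<open>The inclusion of \<open>V\<close> in its symmetric algebra.\<close>
definition lin :: "'a::field vec \<Rightarrow> 'a mpoly" where
  "lin v = (\<Sum>j<dim_vec v. PConst (v $ j) * PVar j)"

text \<open>
  The action on the symmetric algebra is by algebra automorphisms, so it substitutes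
  \<open>g \<cdot> x\<^sub>j\<close>, which is the \<open>j\<close>-th column of \<open>g\<close>, for \<open>x\<^sub>j\<close>.
\<close>
definition act_poly :: "'a::field mat \<Rightarrow> 'a mpoly \<Rightarrow> 'a mpoly" where
  "act_poly g f =
     (\<Sum>t\<in>Poly_Mapping.keys f. PConst (Poly_Mapping.lookup f t) * (\<Prod>j\<in>Poly_Mapping.keys t. lin (col g j) ^ Poly_Mapping.lookup t j))"

definition sym_alg :: "nat \<Rightarrow> ('a::field, 'a mpoly) module" where
  "sym_alg n = \<lparr>carrier = Sym n, monoid.mult = (*), one = 1, zero = 0, add = (+),
     smult = (\<lambda>k f. PConst k * f)\<rparr>"

definition sym_inv :: "nat \<Rightarrow> 'a::field mat set \<Rightarrow> ('a, 'a mpoly) module" where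
  "sym_inv n P = (sym_alg n)\<lparr>carrier := {f \<in> Sym n. \<forall>g\<in>P. act_poly g f = f}\<rparr>"

section \<open>The algebra of forms\<close>

text \<open>
  By the universal property of the exterior power, an element of \<open>Hom(\<And>\<^sup>m(V), S(V))\<close> is an
  alternating \<open>m\<close>-linear map on \<open>V\<close>: the value at \<open>v\<^sub>1 \<and> \<dots> \<and> v\<^sub>m\<close> is written as the value at
  the list \<open>[v\<^sub>1, \<dots>, v\<^sub>m]\<close>.  Alternating means vanishing on lists with a repeated entry, which
  is the correct condition in characteristic 2 as well.  Maps are extended by 0 outside their
  domain, so that the elements of the direct sum over \<open>m\<close> are functions on lists of vectors
  of arbitrary length.
\<close>
type_synonym 'a form = "'a vec list \<Rightarrow> 'a mpoly"

definition Hom_ext :: "nat \<Rightarrow> nat \<Rightarrow> 'a::field form set" where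
  "Hom_ext n m = {\<alpha>.
     (\<forall>vs. \<not> (length vs = m \<and> set vs \<subseteq> carrier_vec n) \<longrightarrow> \<alpha> vs = 0) \<and>
     (\<forall>vs. length vs = m \<and> set vs \<subseteq> carrier_vec n \<longrightarrow>
        \<alpha> vs \<in> Sym n \<and>
        (\<forall>i<m. \<forall>u\<in>carrier_vec n. \<forall>w\<in>carrier_vec n.
           \<alpha> (vs[i := u + w]) = \<alpha> (vs[i := u]) + \<alpha> (vs[i := w])) \<and>
        (\<forall>i<m. \<forall>u\<in>carrier_vec n. \<forall>k.
           \<alpha> (vs[i := k \<cdot>\<^sub>v u]) = PConst k * \<alpha> (vs[i := u])) \<and>
        (\<forall>i<m. \<forall>j<m. i \<noteq> j \<and> vs ! i = vs ! j \<longrightarrow> \<alpha> vs = 0))}"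

definition component :: "nat \<Rightarrow> 'a::field form \<Rightarrow> 'a form" where
  "component m \<alpha> = (\<lambda>vs. if length vs = m then \<alpha> vs else 0)"

definition Forms :: "nat \<Rightarrow> 'a::field form set" where
  "Forms n = {\<alpha>. (\<forall>m\<le>n. component m \<alpha> \<in> Hom_ext n m) \<and> (\<forall>m>n. component m \<alpha> = (\<lambda>_. 0))}"

definition bidegree :: "nat \<Rightarrow> nat \<Rightarrow> nat \<Rightarrow> 'a::field form set" where
  "bidegree n i m = {\<alpha> \<in> Forms n. component m \<alpha> = \<alpha> \<and> (\<forall>vs. \<alpha> vs \<in> homogeneous i)}"

definition shuffles_of :: "nat \<Rightarrow> nat \<Rightarrow> (nat \<Rightarrow> nat) set" where
  "shuffles_of m e = {\<sigma>. \<sigma> permutes {..<m + e} \<and>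
     strict_mono_on {..<m} \<sigma> \<and> strict_mono_on {m..<m + e} \<sigma>}"

text \<open>
  The sum over \<open>m\<close> extends the product of homogeneous elements bilinearly: the component of
  degree \<open>N\<close> of a product collects the products of components of degrees \<open>m\<close> and \<open>N - m\<close>.
\<close>
definition wedge :: "'a::field form \<Rightarrow> 'a form \<Rightarrow> 'a form" where
  "wedge \<alpha> \<beta> = (\<lambda>vs. \<Sum>m\<le>length vs. \<Sum>\<sigma>\<in>shuffles_of m (length vs - m).
     of_int (sign \<sigma>) * \<alpha> (map (\<lambda>i. vs ! \<sigma> i) [0..<m]) *
       \<beta> (map (\<lambda>i. vs ! \<sigma> i) [m..<length vs]))"

text \<open>The identification of \<open>S(V)\<close> with \<open>Hom(\<And>\<^sup>0(V), S(V))\<close>.\<close>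
definition scalar_form :: "'a::field mpoly \<Rightarrow> 'a form" where
  "scalar_form f = (\<lambda>vs. if vs = [] then f else 0)"

definition forms_alg :: "nat \<Rightarrow> ('a::field, 'a form) module" where
  "forms_alg n = \<lparr>carrier = Forms n, monoid.mult = wedge, one = scalar_form 1,
     zero = (\<lambda>_. 0), add = (\<lambda>\<alpha> \<beta> vs. \<alpha> vs + \<beta> vs),
     smult = (\<lambda>k \<alpha> vs. PConst k * \<alpha> vs)\<rparr>"

definition act_form :: "nat \<Rightarrow> 'a::field mat \<Rightarrow> 'a form \<Rightarrow> 'a form" where
  "act_form n g \<alpha> = (\<lambda>vs. if set vs \<subseteq> carrier_vec n
     then act_poly g (\<alpha> (map (\<lambda>v. (inv\<^bsub>GL n\<^esub> g) *\<^sub>v v) vs)) else 0)"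

definition forms_inv :: "nat \<Rightarrow> 'a::field mat set \<Rightarrow> ('a, 'a form) module" where
  "forms_inv n P = (forms_alg n)\<lparr>carrier := {\<alpha> \<in> Forms n. \<forall>g\<in>P. act_form n g \<alpha> = \<alpha>}\<rparr>"

section \<open>The subalgebra generated by the forms \<open>\<omega>\<^sub>i\<close>\<close>

definition omega :: "nat \<Rightarrow> nat \<Rightarrow> 'a::{finite,field} form" where
  "omega n i = (\<lambda>vs. case vs of
     [v] \<Rightarrow> if v \<in> carrier_vec n then lin v ^ (CARD('a) ^ i) else 0
   | _ \<Rightarrow> 0)"

inductive_set subalgebra_generated :: "('a, 'b) module \<Rightarrow> 'b set \<Rightarrow> 'b set"
  for A :: "('a, 'b) module" and X :: "'b set" where
  one: "\<one>\<^bsub>A\<^esub> \<in> subalgebra_generated A X"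
| gen: "x \<in> X \<Longrightarrow> x \<in> subalgebra_generated A X"
| add: "x \<in> subalgebra_generated A X \<Longrightarrow> y \<in> subalgebra_generated A X \<Longrightarrow>
        x \<oplus>\<^bsub>A\<^esub> y \<in> subalgebra_generated A X"
| mult: "x \<in> subalgebra_generated A X \<Longrightarrow> y \<in> subalgebra_generated A X \<Longrightarrow>
        x \<otimes>\<^bsub>A\<^esub> y \<in> subalgebra_generated A X"
| smult: "x \<in> subalgebra_generated A X \<Longrightarrow> k \<odot>\<^bsub>A\<^esub> x \<in> subalgebra_generated A X"

definition Omega :: "nat \<Rightarrow> ('a::{finite,field}, 'a form) module" where
  "Omega n = (forms_alg n)\<lparr>carrier :=
     subalgebra_generated (forms_alg n) (omega n ` {..<n})\<rparr>"

section \<open>Tensor products of algebras\<close>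

text \<open>
  The tensor product \<open>B \<otimes> C\<close> is the vector space with basis the set of pairs \<open>(b, c)\<close>, modulo
  the subspace spanned by the bilinearity relations, with the product induced by
  \<open>(b, c) (b', c') = (b b', c c')\<close>.  There is no Koszul sign: the definition is used only when
  all of \<open>C\<close> has exterior degree 0.
\<close>
definition free_pairs ::
  "('a::field, 'b) module \<Rightarrow> ('a, 'c) module \<Rightarrow> ('a, ('b \<times> 'c) \<Rightarrow>\<^sub>0 'a) module" where
  "free_pairs B C = \<lparr>
     carrier = {x. Poly_Mapping.keys x \<subseteq> carrier B \<times> carrier C},
     monoid.mult = (\<lambda>x y. \<Sum>(b, c)\<in>Poly_Mapping.keys x. \<Sum>(b', c')\<in>Poly_Mapping.keys y.
       Poly_Mapping.single (b \<otimes>\<^bsub>B\<^esub> b', c \<otimes>\<^bsub>C\<^esub> c') (Poly_Mapping.lookup x (b, c) * Poly_Mapping.lookup y (b', c'))),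
     one = Poly_Mapping.single (\<one>\<^bsub>B\<^esub>, \<one>\<^bsub>C\<^esub>) 1,
     zero = 0,
     add = (+),
     smult = (\<lambda>k. Poly_Mapping.map (\<lambda>a. k * a))\<rparr>"

inductive_set tensor_relations ::
  "('a::field, 'b) module \<Rightarrow> ('a, 'c) module \<Rightarrow> (('b \<times> 'c) \<Rightarrow>\<^sub>0 'a) set"
  for B :: "('a::field, 'b) module" and C :: "('a, 'c) module" where
  zero: "0 \<in> tensor_relations B C"
| add: "x \<in> tensor_relations B C \<Longrightarrow> y \<in> tensor_relations B C \<Longrightarrow> x + y \<in> tensor_relations B C"
| smult: "x \<in> tensor_relations B C \<Longrightarrow> k \<odot>\<^bsub>free_pairs B C\<^esub> x \<in> tensor_relations B C"
| add_left: "b \<in> carrier B \<Longrightarrow> b' \<in> carrier B \<Longrightarrow> c \<in> carrier C \<Longrightarrow>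
    Poly_Mapping.single (b \<oplus>\<^bsub>B\<^esub> b', c) 1 - Poly_Mapping.single (b, c) 1
      - Poly_Mapping.single (b', c) 1 \<in> tensor_relations B C"
| add_right: "b \<in> carrier B \<Longrightarrow> c \<in> carrier C \<Longrightarrow> c' \<in> carrier C \<Longrightarrow>
    Poly_Mapping.single (b, c \<oplus>\<^bsub>C\<^esub> c') 1 - Poly_Mapping.single (b, c) 1
      - Poly_Mapping.single (b, c') 1 \<in> tensor_relations B C"
| smult_left: "b \<in> carrier B \<Longrightarrow> c \<in> carrier C \<Longrightarrow>
    Poly_Mapping.single (k \<odot>\<^bsub>B\<^esub> b, c) 1 - Poly_Mapping.single (b, c) k
      \<in> tensor_relations B C"
| smult_right: "b \<in> carrier B \<Longrightarrow> c \<in> carrier C \<Longrightarrow>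
    Poly_Mapping.single (b, k \<odot>\<^bsub>C\<^esub> c) 1 - Poly_Mapping.single (b, c) k
      \<in> tensor_relations B C"

definition tensor_class ::
  "('a::field, 'b) module \<Rightarrow> ('a, 'c) module \<Rightarrow> (('b \<times> 'c) \<Rightarrow>\<^sub>0 'a) \<Rightarrow> (('b \<times> 'c) \<Rightarrow>\<^sub>0 'a) set" where
  "tensor_class B C x = tensor_relations B C +>\<^bsub>free_pairs B C\<^esub> x"

definition tensor ::
  "('a::field, 'b) module \<Rightarrow> ('a, 'c) module \<Rightarrow> ('a, (('b \<times> 'c) \<Rightarrow>\<^sub>0 'a) set) module" where
  "tensor B C = (let F = free_pairs B C; Q = F Quot (tensor_relations B C) in
     \<lparr>carrier = carrier Q, monoid.mult = monoid.mult Q, one = one Q, zero = zero Q, add = add Q,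
      smult = (\<lambda>k X. \<Union>x\<in>X. tensor_class B C (k \<odot>\<^bsub>F\<^esub> x))\<rparr>)"

definition tensor_bidegree ::
  "('a::field, 'b) module \<Rightarrow> (nat \<Rightarrow> nat \<Rightarrow> 'b set) \<Rightarrow>
   ('a, 'c) module \<Rightarrow> (nat \<Rightarrow> nat \<Rightarrow> 'c set) \<Rightarrow>
   nat \<Rightarrow> nat \<Rightarrow> (('b \<times> 'c) \<Rightarrow>\<^sub>0 'a) set set" where
  "tensor_bidegree B gB C gC i m = tensor_class B C `
     {x. Poly_Mapping.keys x \<subseteq> (\<Union>(j, j')\<in>{(j, j'). j + j' = i}. \<Union>(e, e')\<in>{(e, e'). e + e' = m}.
        gB j e \<times> gC j' e')}"

definition bigraded_algebra_iso ::
  "('b \<Rightarrow> 'c) \<Rightarrow> ('a, 'b) module \<Rightarrow> (nat \<Rightarrow> nat \<Rightarrow> 'b set) \<Rightarrow>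
   ('a, 'c) module \<Rightarrow> (nat \<Rightarrow> nat \<Rightarrow> 'c set) \<Rightarrow> bool" where
  "bigraded_algebra_iso h A gA B gB \<longleftrightarrow>
     h \<in> ring_iso A B \<and>
     (\<forall>k. \<forall>x\<in>carrier A. h (k \<odot>\<^bsub>A\<^esub> x) = k \<odot>\<^bsub>B\<^esub> h x) \<and>
     (\<forall>i m. h ` gA i m = gB i m)"

section \<open>The bigradings and the multiplication map\<close>

definition Omega_bidegree :: "nat \<Rightarrow> nat \<Rightarrow> nat \<Rightarrow> 'a::{finite,field} form set" where
  "Omega_bidegree n i m = carrier (Omega n) \<inter> bidegree n i m"

definition sym_inv_bidegree :: "nat \<Rightarrow> 'a::field mat set \<Rightarrow> nat \<Rightarrow> nat \<Rightarrow> 'a mpoly set" where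
  "sym_inv_bidegree n P i m = {f \<in> carrier (sym_inv n P). scalar_form f \<in> bidegree n i m}"

definition forms_inv_bidegree :: "nat \<Rightarrow> 'a::field mat set \<Rightarrow> nat \<Rightarrow> nat \<Rightarrow> 'a form set" where
  "forms_inv_bidegree n P i m = carrier (forms_inv n P) \<inter> bidegree n i m"

definition mult_pairs :: "(('a::field form \<times> 'a mpoly) \<Rightarrow>\<^sub>0 'a) \<Rightarrow> 'a form" where
  "mult_pairs x = (\<lambda>vs. \<Sum>(w, f)\<in>Poly_Mapping.keys x.
     PConst (Poly_Mapping.lookup x (w, f)) * wedge w (scalar_form f) vs)"

text \<open>
  The map induced on cosets by the linear extension of \<open>(w, f) \<mapsto> w \<and> f\<close>.

  For \<open>q = 2\<close> and \<open>n \<ge> 1\<close> this is not surjective onto the invariants: the determinant is then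
  trivial on the group, so the invariants contain a nonzero element of bidegree \<open>(0, n)\<close>,
  whereas the forms \<open>\<omega>\<^sub>i\<close> all have positive polynomial degree.
\<close>
definition mult_map :: "(('a::field form \<times> 'a mpoly) \<Rightarrow>\<^sub>0 'a) set \<Rightarrow> 'a form" where
  "mult_map X = the_elem (mult_pairs ` X)"

end

theory Submission
  imports Defs "Jordan_Normal_Form.Determinant"
begin

text \<open>
  Every form \<open>\<alpha>\<close> is a combination of the products \<open>\<omega>\<^sub>J\<close> over the field of fractions of \<open>S(V)\<close>, because
  the Moore determinant \<open>L = det(x\<^sub>j^(q^i))\<close> does not vanish. The coefficient of \<open>\<omega>\<^sub>J\<close> is, up to sign,
  \<open>h / L\<close>, where \<open>h\<close> is the value of \<open>\<alpha> \<and> \<omega>\<^sub>K\<close> at \<open>x\<^sub>1 \<and> \<dots> \<and> x\<^sub>n\<close> and \<open>K\<close> is the complement of \<open>J\<close>.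
  Now \<open>L\<close> is a product of linear forms, one for each line of \<open>V\<close>. If \<open>x\<^sub>k\<close> is the last basis vector
  occurring in \<open>v\<close>, then the reflection that multiplies \<open>v\<close> by a scalar \<open>c\<close> and fixes the other basis
  vectors is upper triangular, hence in \<open>P\<^sub>I\<close>. It acts trivially modulo \<open>v\<close>, while the invariance of
  \<open>\<alpha> \<and> \<omega>\<^sub>K\<close> turns \<open>h\<close> into \<open>c h\<close>; since \<open>q > 2\<close> one can take \<open>c \<noteq> 0, 1\<close>, so \<open>v\<close> divides \<open>h\<close>. These linear
  forms being pairwise coprime, \<open>L\<close> divides \<open>h\<close>. The coefficients are therefore polynomials, and they
  are invariant because the \<open>\<omega>\<^sub>J\<close> are invariant and linearly independent over \<open>S(V)\<close>.
\<close>

section \<open>Evaluation of polynomials\<close>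

text \<open>No field of fractions is built. Cramer's rule is used only after multiplication by L,
  and the statement about spanning takes the quotients h / L as given polynomials. What has to be
  shown instead is that the pairing sending \<alpha> to the value of \<alpha> \<and> \<omega>_K on
  the standard basis, for all K together, is nondegenerate; this rests on S(V) being a domain and L
  being nonzero.

  Products of one-forms are handled as determinants throughout: Laplace expansion turns
  \<open>wedge\<close> into concatenation of lists, so associativity of \<open>wedge\<close> never
  has to be proved.

  Two points go beyond the decomposition of invariants. The tensor product is a quotient of formal
  sums of pairs, so before independence of the \<omega>_J can give injectivity, a formal sum must be
  rewritten modulo the bilinearity relations with one term for each index set. And the bigrading
  requires that the quotients by L be homogeneous, of the degree complementary to that of
  \<omega>_J.\<close>

definition eval_mpoly :: "('a::field \<Rightarrow> 'b::comm_ring_1) \<Rightarrow> (nat \<Rightarrow> 'b) \<Rightarrow> 'a mpoly \<Rightarrow> 'b" where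
  "eval_mpoly c x f = (\<Sum>t\<in>Poly_Mapping.keys f. c (Poly_Mapping.lookup f t) *
     (\<Prod>j\<in>Poly_Mapping.keys t. x j ^ Poly_Mapping.lookup t j))"

lemma act_poly_eq_eval_mpoly: "act_poly g = eval_mpoly PConst (\<lambda>j. lin (col g j))"
  by (rule ext) (simp add: act_poly_def eval_mpoly_def)

lemma power_prod_superset:
  assumes "finite S" "Poly_Mapping.keys t \<subseteq> S"
  shows "(\<Prod>j\<in>Poly_Mapping.keys t. (x j :: 'b::comm_ring_1) ^ Poly_Mapping.lookup t j)
    = (\<Prod>j\<in>S. x j ^ Poly_Mapping.lookup t j)"
  by (rule prod.mono_neutral_left) (use assms in \<open>auto simp: in_keys_iff\<close>)

lemma power_prod_add:
  "(\<Prod>j\<in>Poly_Mapping.keys (s + t). (x j :: 'b::comm_ring_1) ^ Poly_Mapping.lookup (s + t) j)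
    = (\<Prod>j\<in>Poly_Mapping.keys s. x j ^ Poly_Mapping.lookup s j)
      * (\<Prod>j\<in>Poly_Mapping.keys t. x j ^ Poly_Mapping.lookup t j)"
proof -
  let ?S = "Poly_Mapping.keys s \<union> Poly_Mapping.keys t"
  have *: "finite ?S" "Poly_Mapping.keys (s + t) \<subseteq> ?S"
    using Poly_Mapping.keys_add[of s t] by auto
  show ?thesis
    unfolding power_prod_superset[OF *] power_prod_superset[of ?S s, OF *(1) Un_upper1]
      power_prod_superset[of ?S t, OF *(1) Un_upper2]
    by (simp add: lookup_add power_add prod.distrib)
qed

lemma poly_mapping_sum_singles:
  "(f :: 'k \<Rightarrow>\<^sub>0 'b::comm_monoid_add)
    = (\<Sum>t\<in>Poly_Mapping.keys f. Poly_Mapping.single t (Poly_Mapping.lookup f t))"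
  by (rule poly_mapping_eqI)
    (auto simp: lookup_sum lookup_single when_def in_keys_iff intro!: sum.neutral)

text \<open>The single-term case is restricted to exponents occurring in \<open>f\<close>, so that
  support conditions on \<open>f\<close> remain available there.\<close>

lemma poly_mapping_single_induct:
  fixes f :: "'k \<Rightarrow>\<^sub>0 'b::comm_monoid_add"
  assumes "P 0" and "\<And>t c. t \<in> Poly_Mapping.keys f \<Longrightarrow> P (Poly_Mapping.single t c)"
    and "\<And>g h. P g \<Longrightarrow> P h \<Longrightarrow> P (g + h)"
  shows "P f"
proof -
  have "P (\<Sum>t\<in>A. Poly_Mapping.single t (Poly_Mapping.lookup f t))"
    if "A \<subseteq> Poly_Mapping.keys f" for A
    using finite_subset[OF that finite_keys] that
    by (induct A rule: finite_induct) (auto intro: assms)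
  then show ?thesis using poly_mapping_sum_singles[of f] by force
qed

context
  fixes c :: "'a::field \<Rightarrow> 'b::comm_ring_1" and x :: "nat \<Rightarrow> 'b"
  assumes c: "comm_ring_hom c"
begin

interpretation c: comm_ring_hom c by (rule c)

lemma eval_mpoly_single [simp]:
  "eval_mpoly c x (Poly_Mapping.single t a)
    = c a * (\<Prod>j\<in>Poly_Mapping.keys t. x j ^ Poly_Mapping.lookup t j)"
  by (simp add: eval_mpoly_def)

lemma eval_mpoly_superset:
  assumes "finite S" "Poly_Mapping.keys f \<subseteq> S"
  shows "eval_mpoly c x f = (\<Sum>t\<in>S. c (Poly_Mapping.lookup f t) *
     (\<Prod>j\<in>Poly_Mapping.keys t. x j ^ Poly_Mapping.lookup t j))"
  unfolding eval_mpoly_def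
  by (rule sum.mono_neutral_left) (use assms in \<open>auto simp: in_keys_iff\<close>)

lemma eval_mpoly_add: "eval_mpoly c x (f + g) = eval_mpoly c x f + eval_mpoly c x g"
proof -
  let ?S = "Poly_Mapping.keys f \<union> Poly_Mapping.keys g"
  have *: "finite ?S" "Poly_Mapping.keys (f + g) \<subseteq> ?S"
    using Poly_Mapping.keys_add[of f g] by auto
  show ?thesis
    unfolding eval_mpoly_superset[OF *] eval_mpoly_superset[of ?S f, OF *(1) Un_upper1]
      eval_mpoly_superset[of ?S g, OF *(1) Un_upper2]
    by (simp add: lookup_add algebra_simps sum.distrib c.hom_add)
qed

lemma eval_mpoly_mult: "eval_mpoly c x (f * g) = eval_mpoly c x f * eval_mpoly c x g"
proof (induct f rule: poly_mapping_single_induct)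
  case (2 t a)
  show ?case
  proof (induct g rule: poly_mapping_single_induct)
    case (2 s b)
    show ?case by (simp add: mult_single power_prod_add c.hom_mult algebra_simps)
  qed (simp_all add: eval_mpoly_add algebra_simps, simp add: eval_mpoly_def)
qed (simp_all add: eval_mpoly_add algebra_simps, simp add: eval_mpoly_def)

lemma eval_mpoly_one: "eval_mpoly c x 1 = 1"
  using eval_mpoly_single[of 0 1] by simp

text \<open>The common source of the group action, the grading map and the reduction modulo a linear
  form: only the coefficient map and the images of the variables change.\<close>

lemma comm_ring_hom_eval_mpoly: "comm_ring_hom (eval_mpoly c x)"
proof
  show "eval_mpoly c x 0 = 0" by (simp add: eval_mpoly_def)
qed (simp_all add: eval_mpoly_add eval_mpoly_mult eval_mpoly_one)

lemma eval_mpoly_PConst [simp]: "eval_mpoly c x (PConst a) = c a"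
  by (simp add: PConst_def)

lemma eval_mpoly_PVar [simp]: "eval_mpoly c x (PVar j) = x j"
  by (simp add: PVar_def)

end

lemma PConst_hom: "comm_ring_hom (PConst :: 'a::field \<Rightarrow> 'a mpoly)"
  by unfold_locales (auto simp: PConst_def single_add mult_single)

interpretation PConst: comm_ring_hom "PConst :: 'a::field \<Rightarrow> 'a mpoly"
  by (rule PConst_hom)

interpretation act_poly: comm_ring_hom "act_poly g :: 'a::field mpoly \<Rightarrow> 'a mpoly" for g
  unfolding act_poly_eq_eval_mpoly by (rule comm_ring_hom_eval_mpoly[OF PConst_hom])

lemma PConst_eq_0_iff [simp]: "PConst c = 0 \<longleftrightarrow> c = 0"
proof
  assume "PConst c = 0"
  then have "Poly_Mapping.lookup (PConst c) 0 = 0" by simp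
  then show "c = 0" by (simp add: PConst_def)
qed simp

lemma act_poly_PConst [simp]: "act_poly g (PConst c) = PConst c"
  by (simp add: act_poly_eq_eval_mpoly PConst_hom)

lemma act_poly_PVar [simp]: "act_poly g (PVar j) = lin (col g j)"
  by (simp add: act_poly_eq_eval_mpoly PConst_hom)

lemma hom_eval_mpoly:
  assumes "comm_ring_hom h"
  shows "h (eval_mpoly c x f) = eval_mpoly (h \<circ> c) (h \<circ> x) f"
proof -
  interpret comm_ring_hom h by (rule assms)
  show ?thesis by (simp add: eval_mpoly_def hom_distribs)
qed

lemma PVar_power_prod:
  assumes "finite S"
  shows "(\<Prod>j\<in>S. (PVar j :: 'a::field mpoly) ^ k j)
    = Poly_Mapping.single (\<Sum>j\<in>S. Poly_Mapping.single j (k j)) 1"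
proof -
  have pw: "(PVar j :: 'a mpoly) ^ m = Poly_Mapping.single (Poly_Mapping.single j m) 1" for j m
    by (induct m) (simp_all add: PVar_def mult_single flip: single_add)
  show ?thesis using assms
    by (induct S rule: finite_induct) (simp_all add: pw mult_single)
qed

lemma single_conv_PVar:
  "Poly_Mapping.single t a
    = PConst a * (\<Prod>j\<in>Poly_Mapping.keys t. (PVar j :: 'a::field mpoly) ^ Poly_Mapping.lookup t j)"
  by (simp add: PVar_power_prod PConst_def mult_single flip: poly_mapping_sum_singles)

section \<open>The polynomial ring in the first n variables\<close>

lemma eval_mpoly_cong_Sym:
  "f \<in> Sym n \<Longrightarrow> (\<And>j. j < n \<Longrightarrow> x j = y j) \<Longrightarrow> eval_mpoly c x f = eval_mpoly c y f"
  unfolding eval_mpoly_def Sym_def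
  by (intro sum.cong prod.cong arg_cong2[where f = "(*)"] arg_cong2[where f = "(^)"]) auto

lemma Sym_0 [simp]: "0 \<in> Sym n"
  by (simp add: Sym_def)

lemma Sym_PConst [simp]: "PConst c \<in> Sym n"
  by (auto simp: Sym_def PConst_def split: if_splits)

lemma Sym_1 [simp]: "1 \<in> Sym n"
  using Sym_PConst[of 1 n] by simp

lemma Sym_PVar [simp]: "j < n \<Longrightarrow> PVar j \<in> Sym n"
  by (auto simp: Sym_def PVar_def)

lemma Sym_add: "f \<in> Sym n \<Longrightarrow> g \<in> Sym n \<Longrightarrow> f + g \<in> Sym n"
  using Poly_Mapping.keys_add[of f g] by (auto simp: Sym_def)

lemma Sym_mult: "f \<in> Sym n \<Longrightarrow> g \<in> Sym n \<Longrightarrow> f * g \<in> Sym n"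
proof -
  assume *: "f \<in> Sym n" "g \<in> Sym n"
  show ?thesis unfolding Sym_def
  proof (intro CollectI ballI)
    fix t assume "t \<in> Poly_Mapping.keys (f * g)"
    then obtain a b where "t = a + b" "a \<in> Poly_Mapping.keys f" "b \<in> Poly_Mapping.keys g"
      using Poly_Mapping.keys_mult[of f g] by auto
    then show "Poly_Mapping.keys t \<subseteq> {..<n}"
      using * Poly_Mapping.keys_add[of a b] unfolding Sym_def by blast
  qed
qed

lemma Sym_uminus: "f \<in> Sym n \<Longrightarrow> - f \<in> Sym n"
  using Sym_mult[OF Sym_PConst[of "-1"], of f] by (simp add: PConst.hom_uminus)

lemma Sym_diff: "f \<in> Sym n \<Longrightarrow> g \<in> Sym n \<Longrightarrow> f - g \<in> Sym n"
  using Sym_add[OF _ Sym_uminus, of f n g] by simp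

lemma Sym_sum: "(\<And>i. i \<in> A \<Longrightarrow> f i \<in> Sym n) \<Longrightarrow> sum f A \<in> Sym n"
  by (induct A rule: infinite_finite_induct) (auto intro: Sym_add)

lemma Sym_prod: "(\<And>i. i \<in> A \<Longrightarrow> f i \<in> Sym n) \<Longrightarrow> prod f A \<in> Sym n"
  by (induct A rule: infinite_finite_induct) (auto intro: Sym_mult)

lemma Sym_power: "f \<in> Sym n \<Longrightarrow> f ^ k \<in> Sym n"
  by (induct k) (auto intro: Sym_mult)

lemma Sym_of_int [simp]: "of_int k \<in> Sym n"
  using Sym_PConst[of "of_int k"] by (simp add: PConst.hom_of_int)

lemma Sym_lin [simp]: "v \<in> carrier_vec n \<Longrightarrow> lin v \<in> Sym n"
  by (auto simp: lin_def intro!: Sym_sum Sym_mult)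

text \<open>Each monomial of \<open>f\<close> is a product of admissible variables. Membership in
  \<open>Sym n\<close> is carried along with \<open>P\<close>, since the sum and product cases
  assume it of both operands.\<close>

lemma Sym_induct [consumes 1, case_names const var add mult]:
  fixes f :: "'a::field mpoly"
  assumes f: "f \<in> Sym n"
    and const: "\<And>c. P (PConst c)" and var: "\<And>j. j < n \<Longrightarrow> P (PVar j)"
    and add: "\<And>f g. f \<in> Sym n \<Longrightarrow> g \<in> Sym n \<Longrightarrow> P f \<Longrightarrow> P g \<Longrightarrow> P (f + g)"
    and mult: "\<And>f g. f \<in> Sym n \<Longrightarrow> g \<in> Sym n \<Longrightarrow> P f \<Longrightarrow> P g \<Longrightarrow> P (f * g)"
  shows "P f"
proof -
  have pw: "(PVar j :: 'a mpoly) ^ k \<in> Sym n \<and> P (PVar j ^ k)" if "j < n" for j k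
  proof (induct k)
    case 0
    show ?case using const[of 1] by simp
  qed (use that in \<open>auto intro!: mult Sym_mult var\<close>)
  have pr: "(\<Prod>j\<in>A. (PVar j :: 'a mpoly) ^ k j) \<in> Sym n \<and> P (\<Prod>j\<in>A. PVar j ^ k j)"
    if "A \<subseteq> {..<n}" for A k
    using finite_subset[OF that finite_lessThan] that
  proof (induct A rule: finite_induct)
    case empty
    show ?case using const[of 1] by simp
  next
    case (insert a B)
    then show ?case using pw[of a "k a"] by (auto intro!: mult Sym_mult)
  qed
  have "f \<in> Sym n \<and> P f"
  proof (induct f rule: poly_mapping_single_induct)
    case 1
    show ?case using const[of 0] by simp
  next
    case (2 t a)
    then have "Poly_Mapping.keys t \<subseteq> {..<n}" using f by (auto simp: Sym_def)
    then show ?case unfolding single_conv_PVar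
      using pr[of "Poly_Mapping.keys t" "Poly_Mapping.lookup t"]
      by (intro conjI mult Sym_mult const Sym_PConst) blast+
  next
    case (3 g h)
    then show ?case using Sym_add add by blast
  qed
  then show ?thesis by simp
qed

lemma lin_add: "u \<in> carrier_vec n \<Longrightarrow> v \<in> carrier_vec n \<Longrightarrow> lin (u + v) = lin u + lin v"
  by (auto simp: lin_def PConst.hom_add algebra_simps sum.distrib)

lemma lin_smult: "lin (k \<cdot>\<^sub>v v) = PConst k * lin v"
  by (auto simp: lin_def PConst.hom_mult algebra_simps sum_distrib_left)

lemma lin_unit [simp]: "k < n \<Longrightarrow> lin (unit_vec n k) = PVar k"
  by (simp add: lin_def unit_vec_def if_distrib[of PConst] if_distrib[of "\<lambda>x. x * _"] cong: if_cong)

lemma act_poly_lin: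
  assumes "g \<in> carrier_mat n n" "v \<in> carrier_vec n"
  shows "act_poly g (lin v) = lin (g *\<^sub>v v)"
proof -
  have "act_poly g (lin v) = (\<Sum>j<n. \<Sum>i<n. PConst (v $ j) * (PConst (g $$ (i, j)) * PVar i))"
    using assms by (simp add: lin_def[of v] act_poly.hom_sum act_poly.hom_mult)
      (simp add: lin_def sum_distrib_left)
  also have "\<dots> = (\<Sum>i<n. \<Sum>j<n. PConst (v $ j) * (PConst (g $$ (i, j)) * PVar i))"
    by (rule sum.swap)
  also have "\<dots> = lin (g *\<^sub>v v)"
    using assms by (auto simp: lin_def scalar_prod_def PConst.hom_sum PConst.hom_mult
        sum_distrib_right sum_distrib_left atLeast0LessThan algebra_simps intro!: sum.cong)
  finally show ?thesis .
qed

section \<open>Grading and divisibility by linear forms\<close>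

definition monom_degree :: "(nat \<Rightarrow>\<^sub>0 nat) \<Rightarrow> nat" where
  "monom_degree t = (\<Sum>j\<in>Poly_Mapping.keys t. Poly_Mapping.lookup t j)"

lemma homogeneous_iff: "f \<in> homogeneous i \<longleftrightarrow> (\<forall>t\<in>Poly_Mapping.keys f. monom_degree t = i)"
  by (simp add: homogeneous_def monom_degree_def)

text \<open>
  The substitution \<open>x\<^sub>j \<mapsto> x\<^sub>j T\<close> is a ring homomorphism whose coefficient of \<open>T\<^sup>i\<close> is the
  homogeneous component of degree \<open>i\<close>.
\<close>
definition grade :: "'a::field mpoly \<Rightarrow> 'a mpoly poly" where
  "grade = eval_mpoly (\<lambda>c. [:PConst c:]) (\<lambda>j. [:0, PVar j:])"

interpretation grade: comm_ring_hom "grade :: 'a::field mpoly \<Rightarrow> 'a mpoly poly"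
  unfolding grade_def
  by (rule comm_ring_hom_eval_mpoly, unfold_locales)
    (simp_all add: PConst.hom_add PConst.hom_mult one_pCons)

lemma grade_single:
  "grade (Poly_Mapping.single t a) = Polynomial.monom (Poly_Mapping.single t a) (monom_degree t)"
proof -
  have "comm_ring_hom (\<lambda>c. [:PConst c :: 'a mpoly:])"
    by unfold_locales (simp_all add: PConst.hom_add PConst.hom_mult one_pCons)
  moreover have *: "[:0, PVar j :: 'a mpoly:] ^ k = Polynomial.monom (PVar j ^ k) k" for j k
    by (induct k) (simp_all add: monom_0 monom_Suc mult_monom one_pCons smult_monom)
  moreover have "(\<Prod>j\<in>S. Polynomial.monom (x j) (k j)) = Polynomial.monom (\<Prod>j\<in>S. x j) (\<Sum>j\<in>S. k j)"
    if "finite S" for S :: "nat set" and k and x :: "nat \<Rightarrow> 'a mpoly"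
    using that by (induct S rule: finite_induct) (simp_all add: mult_monom monom_0 one_pCons)
  ultimately have "grade (Poly_Mapping.single t a) = Polynomial.monom
      (PConst a * (\<Prod>j\<in>Poly_Mapping.keys t. PVar j ^ Poly_Mapping.lookup t j)) (monom_degree t)"
    by (simp add: grade_def monom_degree_def smult_monom)
  then show ?thesis by (simp flip: single_conv_PVar)
qed

lemma coeff_grade:
  "coeff (grade f) i = (\<Sum>t\<in>Poly_Mapping.keys f. if monom_degree t = i
     then Poly_Mapping.single t (Poly_Mapping.lookup f t) else 0)"
proof -
  have "grade f = (\<Sum>t\<in>Poly_Mapping.keys f.
      Polynomial.monom (Poly_Mapping.single t (Poly_Mapping.lookup f t)) (monom_degree t))"
    by (subst poly_mapping_sum_singles) (simp add: grade.hom_sum grade_single)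
  then show ?thesis by (simp add: coeff_sum)
qed

text \<open>Homogeneity becomes an equation for a ring homomorphism, so products of homogeneous
  polynomials are computed as products of monomials in T.\<close>

lemma homogeneous_iff_grade: "f \<in> homogeneous i \<longleftrightarrow> grade f = Polynomial.monom f i"
proof
  assume f: "f \<in> homogeneous i"
  show "grade f = Polynomial.monom f i"
  proof (rule poly_eqI)
    fix k
    show "coeff (grade f) k = coeff (Polynomial.monom f i) k"
    proof (cases "k = i")
      case True
      then show ?thesis using f
        by (simp add: coeff_grade homogeneous_iff flip: poly_mapping_sum_singles)
    next
      case False
      then show ?thesis using f
        by (auto simp: coeff_grade homogeneous_iff intro!: sum.neutral)
    qed
  qed
next
  assume *: "grade f = Polynomial.monom f i"
  show "f \<in> homogeneous i"
    unfolding homogeneous_iff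
  proof (rule ccontr, clarsimp)
    fix t assume t: "t \<in> Poly_Mapping.keys f" "monom_degree t \<noteq> i"
    \<comment> \<open>The component of degree \<open>monom_degree t\<close>, read at
      \<open>t\<close>, returns the coefficient of \<open>t\<close> in \<open>f\<close>.\<close>
    have "Poly_Mapping.lookup (coeff (grade f) (monom_degree t)) t
        = (\<Sum>s\<in>Poly_Mapping.keys f. if s = t then Poly_Mapping.lookup f t else 0)"
      unfolding coeff_grade lookup_sum
      by (rule sum.cong) (auto simp: lookup_single when_def)
    with t * show False by (simp add: in_keys_iff)
  qed
qed

lemma homogeneous_0 [simp]: "0 \<in> homogeneous i"
  by (simp add: homogeneous_def)

lemma homogeneous_add: "f \<in> homogeneous i \<Longrightarrow> g \<in> homogeneous i \<Longrightarrow> f + g \<in> homogeneous i"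
  by (simp add: homogeneous_iff_grade grade.hom_add add_monom)

lemma homogeneous_sum: "(\<And>x. x \<in> A \<Longrightarrow> f x \<in> homogeneous i) \<Longrightarrow> sum f A \<in> homogeneous i"
  by (induct A rule: infinite_finite_induct) (auto intro: homogeneous_add)

lemma homogeneous_mult:
  "f \<in> homogeneous i \<Longrightarrow> g \<in> homogeneous j \<Longrightarrow> f * g \<in> homogeneous (i + j)"
  by (simp add: homogeneous_iff_grade grade.hom_mult mult_monom)

lemma homogeneous_PConst [simp]: "PConst c \<in> homogeneous 0"
  by (auto simp: homogeneous_def PConst_def split: if_splits)

lemma homogeneous_PVar [simp]: "PVar j \<in> homogeneous 1"
  by (auto simp: homogeneous_def PVar_def)

lemma homogeneous_prod:
  "(\<And>x. x \<in> A \<Longrightarrow> f x \<in> homogeneous (d x)) \<Longrightarrow> prod f A \<in> homogeneous (sum d A)"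
  using homogeneous_PConst[of 1]
  by (induct A rule: infinite_finite_induct) (auto intro: homogeneous_mult)

lemma homogeneous_power: "f \<in> homogeneous i \<Longrightarrow> f ^ k \<in> homogeneous (k * i)"
  using homogeneous_PConst[of 1] by (induct k) (auto intro: homogeneous_mult)

lemma homogeneous_of_int [simp]: "of_int k \<in> homogeneous 0"
  using homogeneous_PConst[of "of_int k"] by (simp add: PConst.hom_of_int)

lemma homogeneous_lin [simp]: "lin v \<in> homogeneous 1"
  unfolding lin_def
  using homogeneous_mult[OF homogeneous_PConst homogeneous_PVar]
  by (intro homogeneous_sum) simp

text \<open>Compare the coefficients of T^(k + e) in \<open>grade f\<close> times g T^e = f g T^d.
  In a domain, a nonzero component of \<open>f\<close> can only sit in a degree k with k + e = d.
  This gives homogeneity of the quotients by the Moore determinant.\<close>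

lemma homogeneous_quotient:
  assumes fg: "f * g \<in> homogeneous d" and g: "g \<in> homogeneous e" "g \<noteq> 0" and f: "f \<noteq> 0"
  shows "e \<le> d" "f \<in> homogeneous (d - e)"
proof -
  have eq: "grade f * Polynomial.monom g e = Polynomial.monom (f * g) d"
    using fg g(1) by (simp add: homogeneous_iff_grade grade.hom_mult)
  have co: "coeff (grade f) k * g = coeff (Polynomial.monom (f * g) d) (k + e)" for k
    by (simp flip: eq add: mult.commute[of "grade f"] coeff_monom_mult mult.commute[of g])
  have "grade f \<noteq> 0"
    using eq f g(2) by auto
  then obtain k where k: "coeff (grade f) k \<noteq> 0"
    using poly_eq_iff[of "grade f" 0] by auto
  with co[of k] g(2) have kd: "d = k + e"
    by (auto split: if_splits)
  then show "e \<le> d" by simp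
  have "grade f = Polynomial.monom f (d - e)"
  proof (rule poly_eqI)
    fix i
    show "coeff (grade f) i = coeff (Polynomial.monom f (d - e)) i"
      using co[of i] g(2) kd by (auto split: if_splits)
  qed
  then show "f \<in> homogeneous (d - e)"
    by (simp add: homogeneous_iff_grade)
qed

text \<open>
  For a vector \<open>v\<close> with \<open>k\<close>-th coordinate 1, eliminating the variable \<open>x\<^sub>k\<close> by means of the
  relation \<open>v = 0\<close> computes residues modulo \<open>v\<close>.
\<close>
definition elim_var :: "'a::field vec \<Rightarrow> nat \<Rightarrow> 'a mpoly \<Rightarrow> 'a mpoly" where
  "elim_var v k = eval_mpoly PConst (\<lambda>j. if j = k then PVar k - lin v else PVar j)"

interpretation elim_var: comm_ring_hom "elim_var v k :: 'a::field mpoly \<Rightarrow> 'a mpoly" for v k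
  unfolding elim_var_def by (rule comm_ring_hom_eval_mpoly[OF PConst_hom])

lemma elim_var_PConst [simp]: "elim_var v k (PConst c) = PConst c"
  by (simp add: elim_var_def PConst_hom)

lemma elim_var_PVar [simp]: "elim_var v k (PVar j) = (if j = k then PVar k - lin v else PVar j)"
  by (simp add: elim_var_def PConst_hom)

lemma elim_var_lin:
  assumes "u \<in> carrier_vec n" "k < n"
  shows "elim_var v k (lin u) = lin u - PConst (u $ k) * lin v"
proof -
  have "elim_var v k (lin u)
      = (\<Sum>j<n. PConst (u $ j) * PVar j - (if j = k then PConst (u $ k) * lin v else 0))"
    using assms by (auto simp: lin_def[of u] elim_var.hom_sum elim_var.hom_mult algebra_simps
      intro!: sum.cong)
  then show ?thesis
    using assms by (simp add: sum_subtractf lin_def[of u])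
qed

text \<open>Elimination moves each variable by a multiple of \<open>lin v\<close>, and congruence
  modulo \<open>lin v\<close> respects sums and products. Keeping the quotient in
  \<open>Sym n\<close> allows the division to be iterated.\<close>

lemma elim_var_residue:
  assumes f: "f \<in> Sym n" and v: "v \<in> carrier_vec n"
  shows "\<exists>g\<in>Sym n. f - elim_var v k f = lin v * g"
  using f
proof (induct f rule: Sym_induct)
  case (const c)
  show ?case by (auto intro!: bexI[of _ 0])
next
  case (var j)
  show ?case
  proof (cases "j = k")
    case True
    then show ?thesis by (auto intro!: bexI[of _ 1])
  next
    case False
    then show ?thesis by (auto intro!: bexI[of _ 0])
  qed
next
  case (add f g)
  then obtain a b where "a \<in> Sym n" "b \<in> Sym n" "f - elim_var v k f = lin v * a"
    "g - elim_var v k g = lin v * b" by blast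
  then show ?case
    by (intro bexI[of _ "a + b"]) (auto simp: elim_var.hom_add algebra_simps intro: Sym_add)
next
  case (mult f g)
  then obtain a b where ab: "a \<in> Sym n" "b \<in> Sym n" "f - elim_var v k f = lin v * a"
    "g - elim_var v k g = lin v * b" by blast
  have "f * g - elim_var v k (f * g)
      = f * (g - elim_var v k g) + g * (f - elim_var v k f)
        - (f - elim_var v k f) * (g - elim_var v k g)"
    by (simp add: elim_var.hom_mult algebra_simps)
  also have "\<dots> = lin v * (f * b + g * a - a * (lin v * b))"
    unfolding ab(3,4) by (simp add: algebra_simps)
  finally show ?case
    using ab mult v by (intro bexI[of _ "f * b + g * a - a * (lin v * b)"])
      (auto intro!: Sym_diff Sym_add Sym_mult)
qed

lemma lin_dvd_of_elim_var:
  assumes "f \<in> Sym n" "v \<in> carrier_vec n" "elim_var v k f = 0"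
  obtains g where "g \<in> Sym n" "f = lin v * g"
  using elim_var_residue[OF assms(1,2), of k] assms(3) by auto

lemma lin_eq_0_iff: "u \<in> carrier_vec n \<Longrightarrow> lin u = 0 \<longleftrightarrow> u = 0\<^sub>v n"
proof
  assume u: "u \<in> carrier_vec n" and *: "lin u = 0"
  show "u = 0\<^sub>v n"
  proof (rule eq_vecI)
    fix i assume "i < dim_vec (0\<^sub>v n :: 'a vec)"
    then have i: "i < n" by simp
    \<comment> \<open>Putting variable number \<open>i\<close> to 1 and the others to 0 reads off
      the coordinate.\<close>
    have "eval_mpoly (\<lambda>c. c) (\<lambda>j. if j = i then 1 else 0) (lin u) = u $ i"
    proof -
      have id: "comm_ring_hom (\<lambda>c::'a. c)" by unfold_locales auto
      interpret e: comm_ring_hom "eval_mpoly (\<lambda>c::'a. c) (\<lambda>j. if j = i then 1 else 0)"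
        by (rule comm_ring_hom_eval_mpoly[OF id])
      show ?thesis using u i by (simp add: lin_def e.hom_sum e.hom_mult id
          if_distrib[of "\<lambda>x. _ * x"] cong: if_cong)
    qed
    with * i show "u $ i = 0\<^sub>v n $ i" by (simp add: eval_mpoly_def)
  qed (use u in auto)
qed (simp add: lin_def)

text \<open>
  The linear forms \<open>v \<in> X\<close> are normalised by their last nonzero coordinate \<open>lc v\<close>, so that
  distinct ones are not associated.
\<close>
lemma prod_lin_dvd:
  fixes f :: "'a::field mpoly"
  assumes "finite X" "f \<in> Sym n"
    and "\<And>v. v \<in> X \<Longrightarrow> v \<in> carrier_vec n \<and> lc v < n \<and> v $ lc v = 1 \<and> (\<forall>j<n. lc v < j \<longrightarrow> v $ j = 0)"
    and "\<And>v. v \<in> X \<Longrightarrow> elim_var v (lc v) f = 0"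
  shows "\<exists>g\<in>Sym n. f = (\<Prod>v\<in>X. lin v) * g"
  using assms
proof (induct X rule: finite_induct)
  case empty
  then show ?case by auto
next
  case (insert v X)
  then obtain g where g: "g \<in> Sym n" "f = (\<Prod>v\<in>X. lin v) * g" by auto
  let ?k = "lc v"
  have v: "v \<in> carrier_vec n" "?k < n" "v $ ?k = 1" "\<And>j. j < n \<Longrightarrow> ?k < j \<Longrightarrow> v $ j = 0"
    using insert by auto
  \<comment> \<open>Coprimality in the form required: a linear form vanishing modulo
    \<open>v\<close> is a multiple of \<open>v\<close>, and the normalisation at the last nonzero
    coordinate would make it equal to \<open>v\<close>.\<close>
  have "elim_var v ?k (lin u) \<noteq> 0" if "u \<in> X" for u
  proof
    have u: "u \<in> carrier_vec n" "lc u < n" "u $ lc u = 1" "\<And>j. j < n \<Longrightarrow> lc u < j \<Longrightarrow> u $ j = 0"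
      using insert(5) that by auto
    assume "elim_var v ?k (lin u) = 0"
    then have "lin (u + (- (u $ ?k)) \<cdot>\<^sub>v v) = 0"
      using u v elim_var_lin[OF u(1) v(2)] by (simp add: lin_add lin_smult PConst.hom_uminus)
    then have "u + (- (u $ ?k)) \<cdot>\<^sub>v v = 0\<^sub>v n"
      using u v by (subst (asm) lin_eq_0_iff[of _ n]) auto
    then have eq: "u $ j = u $ ?k * v $ j" if "j < n" for j
    proof -
      have "(u + (- (u $ ?k)) \<cdot>\<^sub>v v) $ j = 0"
        unfolding \<open>u + (- (u $ ?k)) \<cdot>\<^sub>v v = 0\<^sub>v n\<close> using that by simp
      then show ?thesis using u(1) v(1) that by simp
    qed
    have "lc u = ?k"
    proof (rule linorder_cases[of "lc u" ?k])
      assume "lc u < ?k" then show ?thesis using eq[OF u(2)] u v by auto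
    next
      assume "?k < lc u" then show ?thesis using eq[OF u(2)] u v by auto
    qed
    then have "u $ j = v $ j" if "j < n" for j using eq[OF that] u(3) by simp
    then have "u = v" using u(1) v(1) by (intro eq_vecI) auto
    with insert that show False by auto
  qed
  moreover have "elim_var v ?k f = 0" using insert by auto
  \<comment> \<open>In a domain, the factors already split off survive the elimination of
    \<open>v\<close>, so it is the cofactor \<open>g\<close> that vanishes.\<close>
  ultimately have "elim_var v ?k g = 0"
    unfolding g(2) using insert(1) by (auto simp: elim_var.hom_mult elim_var.hom_prod)
  then obtain g' where "g' \<in> Sym n" "g = lin v * g'"
    using lin_dvd_of_elim_var g(1) v(1) by metis
  then show ?case using insert g by (auto simp: algebra_simps)
qed

section \<open>Determinants and the shuffle product\<close>

abbreviation fun_mat :: "nat \<Rightarrow> (nat \<Rightarrow> nat \<Rightarrow> 'b) \<Rightarrow> 'b mat" where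
  "fun_mat N F \<equiv> mat N N (\<lambda>(i, j). F i j)"

lemma det_fun_mat:
  "det (fun_mat N F) = (\<Sum>p | p permutes {..<N}. of_int (sign p) * (\<Prod>i<N. F i (p i)))"
  by (auto simp: det_def atLeast0LessThan permutes_in_image intro!: sum.cong prod.cong)

lemma det_fun_mat_transpose: "det (fun_mat N (\<lambda>i j. F j i)) = det (fun_mat N F)"
proof -
  have "fun_mat N (\<lambda>i j. F j i) = transpose_mat (fun_mat N F)" by auto
  then show ?thesis using det_transpose[of "fun_mat N F" N] by simp
qed

text \<open>Every product in the Leibniz formula has exactly one factor from row \<open>k\<close>.
  Additivity and homogeneity are the cases of an index set with two elements and with one.\<close>

lemma det_fun_mat_row_sum:
  assumes k: "k < N"
  shows "det (fun_mat N (\<lambda>i j. if i = k then \<Sum>s\<in>S. c s * G s j else F i j))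
    = (\<Sum>s\<in>S. c s * det (fun_mat N (\<lambda>i j. if i = k then G s j else F i j)))"
proof -
  have split: "(\<Prod>i<N. if i = k then a i else b i) = a k * (\<Prod>i\<in>{..<N} - {k}. b i)"
    for a b :: "nat \<Rightarrow> 'a"
    using k by (subst prod.remove[of _ k]) (auto intro!: arg_cong2[where f = "(*)"] prod.cong)
  show ?thesis
    unfolding det_fun_mat split sum_distrib_left sum_distrib_right
    by (subst sum.swap) (simp add: ac_simps)
qed

lemma det_fun_mat_col_sum:
  assumes k: "k < N"
  shows "det (fun_mat N (\<lambda>i j. if j = k then \<Sum>s\<in>S. c s * G s i else F i j))
    = (\<Sum>s\<in>S. c s * det (fun_mat N (\<lambda>i j. if j = k then G s i else F i j)))"
  using det_fun_mat_row_sum[OF k, where S = S and c = c and G = G and F = "\<lambda>i j. F j i"]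
  by (subst (1 2) det_fun_mat_transpose[symmetric]) simp

lemma det_fun_mat_row_add:
  assumes k: "k < N"
  shows "det (fun_mat N (\<lambda>i j. if i = k then G j + H j else F i j))
    = det (fun_mat N (\<lambda>i j. if i = k then G j else F i j))
      + det (fun_mat N (\<lambda>i j. if i = k then H j else F i j))"
  using det_fun_mat_row_sum[OF k, where S = "{True, False}" and c = "\<lambda>_. 1" and G = "\<lambda>b. if b then G else H" and F = F]
  by (simp cong: if_cong)

lemma det_fun_mat_row_mult:
  assumes k: "k < N"
  shows "det (fun_mat N (\<lambda>i j. if i = k then c * G j else F i j))
    = c * det (fun_mat N (\<lambda>i j. if i = k then G j else F i j))"
  using det_fun_mat_row_sum[OF k, where S = "{()}" and c = "\<lambda>_. c" and G = "\<lambda>_. G" and F = F] by (simp cong: if_cong)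

lemma det_fun_mat_col_add:
  assumes k: "k < N"
  shows "det (fun_mat N (\<lambda>i j. if j = k then G i + H i else F i j))
    = det (fun_mat N (\<lambda>i j. if j = k then G i else F i j))
      + det (fun_mat N (\<lambda>i j. if j = k then H i else F i j))"
  using det_fun_mat_row_add[OF k, where G = G and H = H and F = "\<lambda>i j. F j i"]
  by (subst (1 2 3) det_fun_mat_transpose[symmetric]) simp

lemma det_fun_mat_col_mult:
  assumes k: "k < N"
  shows "det (fun_mat N (\<lambda>i j. if j = k then c * G i else F i j))
    = c * det (fun_mat N (\<lambda>i j. if j = k then G i else F i j))"
  using det_fun_mat_row_mult[OF k, where c = c and G = G and F = "\<lambda>i j. F j i"]
  by (subst (1 2) det_fun_mat_transpose[symmetric]) simp

lemma det_fun_mat_eq_rows: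
  assumes "i < N" "j < N" "i \<noteq> j" "\<And>k. k < N \<Longrightarrow> F i k = F j k"
  shows "det (fun_mat N F) = 0"
  by (rule det_identical_rows[of _ N i j]) (use assms in auto)

lemma det_fun_mat_eq_cols:
  assumes "i < N" "j < N" "i \<noteq> j" "\<And>k. k < N \<Longrightarrow> F k i = F k j"
  shows "det (fun_mat N F) = 0"
  using assms by (subst det_fun_mat_transpose[symmetric]) (intro det_fun_mat_eq_rows[of i N j], auto)

lemma det_fun_mat_zero_row:
  assumes "i < N" "\<And>k. k < N \<Longrightarrow> F i k = 0"
  shows "det (fun_mat N F) = 0"
  unfolding det_fun_mat
proof (intro sum.neutral ballI)
  fix p assume "p \<in> {p. p permutes {..<N}}"
  then have "p i < N" using assms(1) permutes_in_image[of p "{..<N}" i] by simp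
  then have "(\<Prod>i<N. F i (p i)) = 0"
    using assms by (intro prod_zero) auto
  then show "of_int (sign p) * (\<Prod>i<N. F i (p i)) = 0" by simp
qed

lemma det_fun_mat_permute_rows:
  assumes "p permutes {..<N}"
  shows "det (fun_mat N (\<lambda>i j. F (p i) j)) = of_int (sign p) * det (fun_mat N F)"
proof -
  have "p permutes {0..<N}" using assms by (simp add: atLeast0LessThan)
  from det_permute_rows[OF _ this, of "fun_mat N F"]
  have "det (fun_mat N (\<lambda>i j. fun_mat N F $$ (p i, j))) = of_int (sign p) * det (fun_mat N F)" by simp
  moreover have "fun_mat N (\<lambda>i j. fun_mat N F $$ (p i, j)) = fun_mat N (\<lambda>i j. F (p i) j)"
    using permutes_in_image[OF assms] by (intro eq_matI) auto
  ultimately show ?thesis by simp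
qed

lemma det_fun_mat_permute_cols:
  assumes "p permutes {..<N}"
  shows "det (fun_mat N (\<lambda>i j. F i (p j))) = of_int (sign p) * det (fun_mat N F)"
  using det_fun_mat_permute_rows[OF assms, of "\<lambda>i j. F j i"]
  by (subst (1 2) det_fun_mat_transpose[symmetric]) simp

section \<open>Shuffles and Laplace expansion\<close>

lemma sorted_map_strict_mono_on:
  assumes "strict_mono_on {m..<k} (\<sigma> :: nat \<Rightarrow> nat)"
  shows "map \<sigma> [m..<k] = sorted_list_of_set (\<sigma> ` {m..<k})"
proof (rule sorted_distinct_set_unique)
  show "sorted (map \<sigma> [m..<k])"
    using assms unfolding sorted_iff_nth_mono
    by (auto intro!: strict_mono_on_leD[OF assms])
  show "distinct (map \<sigma> [m..<k])"
    using strict_mono_on_imp_inj_on[OF assms] by (simp add: distinct_map)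
qed auto

text \<open>The two increasing halves of a shuffle can only be the sorted enumerations of
  \<open>A\<close> and of its complement; the same enumerations construct it.\<close>

lemma ex1_shuffle:
  assumes A: "A \<subseteq> {..<m + e}" and card: "card A = m"
  shows "\<exists>!\<sigma>. \<sigma> \<in> shuffles_of m e \<and> \<sigma> ` {..<m} = A"
proof (rule ex_ex1I)
  have fin: "finite A" using A finite_subset by blast
  define xs where "xs = sorted_list_of_set A"
  define ys where "ys = sorted_list_of_set ({..<m + e} - A)"
  define \<sigma> where "\<sigma> = (\<lambda>i. if i < m + e then (xs @ ys) ! i else i)"
  have len: "length xs = m" "length ys = e"
    using card A fin by (auto simp: xs_def ys_def card_Diff_subset)
  have set: "set xs = A" "set ys = {..<m + e} - A"
    using fin by (auto simp: xs_def ys_def)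
  have dist: "distinct (xs @ ys)"
    using set by (auto simp: xs_def ys_def)
  have "bij_betw (\<lambda>i. (xs @ ys) ! i) {..<m + e} {..<m + e}"
    by (rule bij_betw_nth) (use dist len set A in auto)
  then have "bij_betw \<sigma> {..<m + e} {..<m + e}"
    by (rule bij_betw_cong[THEN iffD1, rotated]) (auto simp: \<sigma>_def)
  then have perm: "\<sigma> permutes {..<m + e}"
    by (rule bij_imp_permutes) (simp add: \<sigma>_def)
  have "strict_mono_on {..<m} \<sigma>"
    using strict_sorted_list_of_set[of A] len
    by (auto simp: strict_mono_on_def \<sigma>_def nth_append xs_def sorted_wrt_iff_nth_less)
  moreover have "strict_mono_on {m..<m + e} \<sigma>"
    using strict_sorted_list_of_set[of "{..<m + e} - A"] len
    by (auto simp: strict_mono_on_def \<sigma>_def nth_append ys_def sorted_wrt_iff_nth_less)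
  moreover have "\<sigma> ` {..<m} = A"
  proof -
    have "\<sigma> ` {..<m} = (\<lambda>i. xs ! i) ` {..<length xs}"
      using len by (intro image_cong) (auto simp: \<sigma>_def nth_append)
    then show ?thesis using set(1) by (auto simp: set_conv_nth)
  qed
  ultimately show "\<exists>\<sigma>. \<sigma> \<in> shuffles_of m e \<and> \<sigma> ` {..<m} = A"
    using perm by (auto simp: shuffles_of_def)
next
  fix \<sigma> \<tau>
  assume "\<sigma> \<in> shuffles_of m e \<and> \<sigma> ` {..<m} = A" "\<tau> \<in> shuffles_of m e \<and> \<tau> ` {..<m} = A"
  then have s: "\<sigma> permutes {..<m + e}" "strict_mono_on {0..<m} \<sigma>" "strict_mono_on {m..<m + e} \<sigma>"
      "\<sigma> ` {0..<m} = A"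
    and t: "\<tau> permutes {..<m + e}" "strict_mono_on {0..<m} \<tau>" "strict_mono_on {m..<m + e} \<tau>"
      "\<tau> ` {0..<m} = A"
    by (auto simp: shuffles_of_def atLeast0LessThan)
  have img: "\<rho> ` {m..<m + e} = {..<m + e} - A" if "\<rho> permutes {..<m + e}" "\<rho> ` {0..<m} = A" for \<rho>
  proof -
    have "{m..<m + e} = {..<m + e} - {0..<m}" by auto
    then have "\<rho> ` {m..<m + e} = \<rho> ` {..<m + e} - \<rho> ` {0..<m}"
      using permutes_inj[OF that(1)] by (simp add: image_set_diff)
    then show ?thesis using that permutes_image[OF that(1)] by simp
  qed
  have "map \<sigma> [0..<m] = map \<tau> [0..<m]"
    using sorted_map_strict_mono_on[OF s(2)] sorted_map_strict_mono_on[OF t(2)] s(4) t(4) by simp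
  moreover have "map \<sigma> [m..<m + e] = map \<tau> [m..<m + e]"
    using sorted_map_strict_mono_on[OF s(3)] sorted_map_strict_mono_on[OF t(3)]
      img[OF s(1,4)] img[OF t(1,4)] by simp
  ultimately have *: "\<sigma> i = \<tau> i" if "i < m + e" for i
    using that by (cases "i < m") auto
  show "\<sigma> = \<tau>"
  proof
    fix i show "\<sigma> i = \<tau> i"
      using * s(1) t(1) by (cases "i < m + e") (auto simp: permutes_def)
  qed
qed

text \<open>The product of a list of one-forms, defined by its determinant rather than by iterating
  \<open>wedge\<close>, so that no bracketing has to be chosen.\<close>

definition alt_prod :: "('a vec \<Rightarrow> 'a::field mpoly) list \<Rightarrow> 'a form" where
  "alt_prod \<phi>s = (\<lambda>vs. if length vs = length \<phi>s
     then det (fun_mat (length \<phi>s) (\<lambda>i j. (\<phi>s ! i) (vs ! j))) else 0)"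

lemma finite_shuffles_of [simp]: "finite (shuffles_of m e)"
  by (rule finite_subset[OF _ finite_permutations[of "{..<m + e}"]]) (auto simp: shuffles_of_def)

lemma shuffle_permutes: "\<sigma> \<in> shuffles_of m e \<Longrightarrow> \<sigma> permutes {..<m + e}"
  by (simp add: shuffles_of_def)

text \<open>
  The block diagonal determinant belonging to a shuffle collects the permutations that have the
  same image of \<open>{..<m}\<close> as the shuffle.
\<close>
lemma laplace_shuffles:
  fixes F :: "nat \<Rightarrow> nat \<Rightarrow> 'b::idom"
  shows "(\<Sum>\<sigma>\<in>shuffles_of m e. of_int (sign \<sigma>) * det (fun_mat m (\<lambda>i j. F i (\<sigma> j)))
      * det (fun_mat e (\<lambda>i j. F (m + i) (\<sigma> (m + j))))) = det (fun_mat (m + e) F)"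
proof -
  let ?N = "m + e"
  have blk: "of_int (sign \<sigma>) * det (fun_mat m (\<lambda>i j. F i (\<sigma> j))) * det (fun_mat e (\<lambda>i j. F (m + i) (\<sigma> (m + j))))
     = (\<Sum>p | p permutes {..<?N}. if p ` {..<m} = \<sigma> ` {..<m}
          then of_int (sign p) * (\<Prod>i<?N. F i (p i)) else 0)"
    if "\<sigma> \<in> shuffles_of m e" for \<sigma>
  proof -
    note \<sigma> = shuffle_permutes[OF that]
    have inj: "\<sigma> j \<in> \<sigma> ` {..<m} \<longleftrightarrow> j < m" for j
      using permutes_inj[OF \<sigma>] by (auto simp: inj_def)
    \<comment> \<open>The mask keeps the entries where a row of the first block meets a column in
      the image of \<open>{..<m}\<close>, or neither holds; permuting the columns by the shuffle
      makes the masked matrix block diagonal.\<close>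
    let ?E = "\<lambda>i j. if (i < m) = (j \<in> \<sigma> ` {..<m}) then F i j else 0"
    have "det (fun_mat m (\<lambda>i j. F i (\<sigma> j))) * det (fun_mat e (\<lambda>i j. F (m + i) (\<sigma> (m + j))))
      = det (four_block_mat (fun_mat m (\<lambda>i j. F i (\<sigma> j))) (0\<^sub>m m e) (0\<^sub>m e m)
          (fun_mat e (\<lambda>i j. F (m + i) (\<sigma> (m + j)))))"
      by (rule det_four_block_mat_upper_right_zero[symmetric]) auto
    also have "four_block_mat (fun_mat m (\<lambda>i j. F i (\<sigma> j))) (0\<^sub>m m e) (0\<^sub>m e m)
          (fun_mat e (\<lambda>i j. F (m + i) (\<sigma> (m + j)))) = fun_mat ?N (\<lambda>i j. ?E i (\<sigma> j))"
      by (rule eq_matI) (auto simp: inj)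
    also have "det \<dots> = of_int (sign \<sigma>) * det (fun_mat ?N ?E)"
      by (rule det_fun_mat_permute_cols[OF \<sigma>])
    finally have "of_int (sign \<sigma>) * (det (fun_mat m (\<lambda>i j. F i (\<sigma> j))) * det (fun_mat e (\<lambda>i j. F (m + i) (\<sigma> (m + j)))))
      = det (fun_mat ?N ?E)"
      by (simp add: sign_def)
    also have "\<dots> = (\<Sum>p | p permutes {..<?N}. if p ` {..<m} = \<sigma> ` {..<m}
          then of_int (sign p) * (\<Prod>i<?N. F i (p i)) else 0)"
      unfolding det_fun_mat
    proof (rule sum.cong[OF refl])
      fix p assume "p \<in> {p. p permutes {..<?N}}"
      then have p: "p permutes {..<?N}" by simp
      show "of_int (sign p) * (\<Prod>i<?N. ?E i (p i)) = (if p ` {..<m} = \<sigma> ` {..<m}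
          then of_int (sign p) * (\<Prod>i<?N. F i (p i)) else 0)"
      proof (cases "p ` {..<m} = \<sigma> ` {..<m}")
        case True
        have "p i \<in> \<sigma> ` {..<m} \<longleftrightarrow> i < m" for i
          unfolding True[symmetric] using permutes_inj[OF p] by (auto simp: inj_def)
        then show ?thesis using True by simp
      next
        case False
        \<comment> \<open>The two images have the same size, so if they differ then some row of the
          first block is sent to a masked column.\<close>
        have "\<exists>i<?N. (i < m) \<noteq> (p i \<in> \<sigma> ` {..<m})"
        proof (rule ccontr)
          assume *: "\<not> ?thesis"
          have "p i \<in> \<sigma> ` {..<m}" if "i < m" for i
            using * that by (metis trans_less_add1)
          then have "p ` {..<m} \<subseteq> \<sigma> ` {..<m}" by auto
          moreover have "card (p ` {..<m}) = card (\<sigma> ` {..<m})"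
            using permutes_inj[OF p] permutes_inj[OF \<sigma>]
            by (simp add: card_image inj_on_subset)
          ultimately show False using False card_subset_eq[of "\<sigma> ` {..<m}"] by auto
        qed
        then show ?thesis using False by (auto intro!: prod_zero)
      qed
    qed
    finally show ?thesis by (simp add: mult.assoc)
  qed
  have "(\<Sum>\<sigma>\<in>shuffles_of m e. of_int (sign \<sigma>) * det (fun_mat m (\<lambda>i j. F i (\<sigma> j)))
      * det (fun_mat e (\<lambda>i j. F (m + i) (\<sigma> (m + j)))))
    = (\<Sum>p | p permutes {..<?N}. \<Sum>\<sigma>\<in>shuffles_of m e. if p ` {..<m} = \<sigma> ` {..<m}
          then of_int (sign p) * (\<Prod>i<?N. F i (p i)) else 0)"
    by (subst sum.swap) (rule sum.cong[OF refl blk])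
  also have "\<dots> = (\<Sum>p | p permutes {..<?N}. of_int (sign p) * (\<Prod>i<?N. F i (p i)))"
  proof (rule sum.cong[OF refl])
    fix p assume "p \<in> {p. p permutes {..<?N}}"
    then have p: "p permutes {..<?N}" by simp
    have "p ` {..<m} \<subseteq> {..<?N}" using permutes_image[OF p] by (metis image_mono lessThan_subset_iff le_add1)
    moreover have "card (p ` {..<m}) = m"
      using permutes_inj[OF p] by (simp add: card_image inj_on_subset)
    \<comment> \<open>Each permutation belongs to exactly one shuffle, so one term of the inner sum
      survives.\<close>
    ultimately have "\<exists>!\<sigma>. \<sigma> \<in> shuffles_of m e \<and> \<sigma> ` {..<m} = p ` {..<m}"
      by (rule ex1_shuffle)
    then obtain \<sigma> where \<sigma>: "\<sigma> \<in> shuffles_of m e \<and> \<sigma> ` {..<m} = p ` {..<m}"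
        "\<forall>\<tau>. \<tau> \<in> shuffles_of m e \<and> \<tau> ` {..<m} = p ` {..<m} \<longrightarrow> \<tau> = \<sigma>"
      by (rule ex1E)
    then have *: "\<sigma> \<in> shuffles_of m e" "\<sigma> ` {..<m} = p ` {..<m}"
        "\<And>\<tau>. \<tau> \<in> shuffles_of m e \<Longrightarrow> \<tau> ` {..<m} = p ` {..<m} \<Longrightarrow> \<tau> = \<sigma>"
      by blast+
    have "(\<Sum>\<tau>\<in>shuffles_of m e. if p ` {..<m} = \<tau> ` {..<m} then of_int (sign p) * (\<Prod>i<?N. F i (p i)) else 0)
      = (\<Sum>\<tau>\<in>shuffles_of m e. if \<tau> = \<sigma> then of_int (sign p) * (\<Prod>i<?N. F i (p i)) else 0)"
      by (intro sum.cong refl if_cong) (metis *(2,3))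
    then show "(\<Sum>\<tau>\<in>shuffles_of m e. if p ` {..<m} = \<tau> ` {..<m} then of_int (sign p) * (\<Prod>i<?N. F i (p i)) else 0)
      = of_int (sign p) * (\<Prod>i<?N. F i (p i))"
      using *(1) by simp
  qed
  finally show ?thesis by (simp add: det_fun_mat)
qed

text \<open>The shuffle sum is the Laplace expansion of the joint determinant along its first rows;
  only the splitting of the arguments that matches both lengths contributes.\<close>

lemma wedge_alt_prod:
  fixes \<phi>s \<psi>s :: "('a::field vec \<Rightarrow> 'a mpoly) list"
  shows "wedge (alt_prod \<phi>s) (alt_prod \<psi>s) = alt_prod (\<phi>s @ \<psi>s)"
proof
  fix vs :: "'a vec list"
  let ?m = "length \<phi>s" and ?e = "length \<psi>s" and ?N = "length vs"
  show "wedge (alt_prod \<phi>s) (alt_prod \<psi>s) vs = alt_prod (\<phi>s @ \<psi>s) vs"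
  proof (cases "?N = ?m + ?e")
    case False
    then have "wedge (alt_prod \<phi>s) (alt_prod \<psi>s) vs = 0"
      unfolding wedge_def alt_prod_def by (intro sum.neutral ballI) auto
    then show ?thesis using False by (simp add: alt_prod_def)
  next
    case True
    have "wedge (alt_prod \<phi>s) (alt_prod \<psi>s) vs = (\<Sum>m\<le>?N. if m = ?m then
      \<Sum>\<sigma>\<in>shuffles_of ?m ?e. of_int (sign \<sigma>) * alt_prod \<phi>s (map (\<lambda>i. vs ! \<sigma> i) [0..<?m]) *
       alt_prod \<psi>s (map (\<lambda>i. vs ! \<sigma> i) [?m..<?N]) else 0)"
      unfolding wedge_def
      by (intro sum.cong refl) (auto simp: True alt_prod_def intro!: sum.neutral)
    also have "\<dots> = (\<Sum>\<sigma>\<in>shuffles_of ?m ?e. of_int (sign \<sigma>) * alt_prod \<phi>s (map (\<lambda>i. vs ! \<sigma> i) [0..<?m]) *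
       alt_prod \<psi>s (map (\<lambda>i. vs ! \<sigma> i) [?m..<?N]))"
      using True by simp
    also have "\<dots> = (\<Sum>\<sigma>\<in>shuffles_of ?m ?e. of_int (sign \<sigma>)
      * det (fun_mat ?m (\<lambda>i j. ((\<phi>s @ \<psi>s) ! i) (vs ! \<sigma> j)))
      * det (fun_mat ?e (\<lambda>i j. ((\<phi>s @ \<psi>s) ! (?m + i)) (vs ! \<sigma> (?m + j)))))"
      by (intro sum.cong refl arg_cong2[where f = "(*)"] arg_cong[where f = det])
        (auto simp: alt_prod_def True nth_append intro!: arg_cong[where f = det] eq_matI)
    also have "\<dots> = alt_prod (\<phi>s @ \<psi>s) vs"
      using laplace_shuffles[where m = ?m and e = ?e and F = "\<lambda>i j. ((\<phi>s @ \<psi>s) ! i) (vs ! j)"] True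
      by (simp add: alt_prod_def)
    finally show ?thesis .
  qed
qed

section \<open>Alternating forms\<close>

lemma Hom_ext_outside:
  "\<alpha> \<in> Hom_ext n m \<Longrightarrow> \<not> (length vs = m \<and> set vs \<subseteq> carrier_vec n) \<Longrightarrow> \<alpha> vs = 0"
  unfolding Hom_ext_def by blast

lemma Hom_ext_Sym: "\<alpha> \<in> Hom_ext n m \<Longrightarrow> \<alpha> vs \<in> Sym n"
  by (cases "length vs = m \<and> set vs \<subseteq> carrier_vec n") (auto simp: Hom_ext_def)

lemma Hom_ext_add_arg:
  assumes "\<alpha> \<in> Hom_ext n m" "length vs = m" "set vs \<subseteq> carrier_vec n" "i < m"
    "u \<in> carrier_vec n" "w \<in> carrier_vec n"
  shows "\<alpha> (vs[i := u + w]) = \<alpha> (vs[i := u]) + \<alpha> (vs[i := w])"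
  using assms unfolding Hom_ext_def by blast

lemma Hom_ext_smult_arg:
  assumes "\<alpha> \<in> Hom_ext n m" "length vs = m" "set vs \<subseteq> carrier_vec n" "i < m"
    "u \<in> carrier_vec n"
  shows "\<alpha> (vs[i := k \<cdot>\<^sub>v u]) = PConst k * \<alpha> (vs[i := u])"
  using assms unfolding Hom_ext_def by blast

lemma Hom_ext_alternating:
  assumes "\<alpha> \<in> Hom_ext n m" "length vs = m" "set vs \<subseteq> carrier_vec n" "i < m" "j < m"
    "i \<noteq> j" "vs ! i = vs ! j"
  shows "\<alpha> vs = 0"
  using assms unfolding Hom_ext_def by blast

lemma Hom_ext_add:
  "\<alpha> \<in> Hom_ext n m \<Longrightarrow> \<beta> \<in> Hom_ext n m \<Longrightarrow> (\<lambda>vs. \<alpha> vs + \<beta> vs) \<in> Hom_ext n m"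
  unfolding Hom_ext_def by (auto simp: algebra_simps intro: Sym_add)

lemma Hom_ext_smult:
  "\<alpha> \<in> Hom_ext n m \<Longrightarrow> f \<in> Sym n \<Longrightarrow> (\<lambda>vs. f * \<alpha> vs) \<in> Hom_ext n m"
  unfolding Hom_ext_def by (auto simp: algebra_simps intro: Sym_mult)

lemma Hom_ext_0: "(\<lambda>_. 0) \<in> Hom_ext n m"
  unfolding Hom_ext_def by auto

lemma Hom_ext_expand_arg:
  assumes \<alpha>: "\<alpha> \<in> Hom_ext n m" and vs: "length vs = m" "set vs \<subseteq> carrier_vec n" and t: "t < m"
    and v: "v \<in> carrier_vec n"
  shows "\<alpha> (vs[t := v]) = (\<Sum>j<n. PConst (v $ j) * \<alpha> (vs[t := unit_vec n j]))"
proof -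
  let ?v = "\<lambda>k. vec n (\<lambda>j. if j < k then v $ j else 0)"
  have "\<alpha> (vs[t := ?v k]) = (\<Sum>j<k. PConst (v $ j) * \<alpha> (vs[t := unit_vec n j]))" if "k \<le> n" for k
    using that
  proof (induct k)
    case 0
    have "?v 0 = 0 \<cdot>\<^sub>v ?v 0" by (rule eq_vecI) auto
    then show ?case
      using Hom_ext_smult_arg[OF \<alpha> vs t, of "?v 0" 0] by simp
  next
    case (Suc k)
    have "?v (Suc k) = ?v k + v $ k \<cdot>\<^sub>v unit_vec n k"
      using Suc(2) by (intro eq_vecI) (auto simp: less_Suc_eq)
    then show ?case
      using Suc Hom_ext_add_arg[OF \<alpha> vs t, of "?v k" "v $ k \<cdot>\<^sub>v unit_vec n k"]
        Hom_ext_smult_arg[OF \<alpha> vs t, of "unit_vec n k" "v $ k"] by simp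
  qed
  from this[of n] show ?thesis using v eq_vecI[of v "?v n"] by simp
qed

text \<open>Expand the value with \<open>?u + ?w\<close> in both slots: the two terms with equal
  arguments vanish, and the mixed ones must cancel. This is valid in every characteristic.\<close>

lemma Hom_ext_swap:
  assumes \<alpha>: "\<alpha> \<in> Hom_ext n m" and vs: "length vs = m" "set vs \<subseteq> carrier_vec n"
    and ij: "i < m" "j < m" "i \<noteq> j"
  shows "\<alpha> (vs[i := vs ! j, j := vs ! i]) = - \<alpha> vs"
proof -
  let ?u = "vs ! i" and ?w = "vs ! j"
  have uw: "?u \<in> carrier_vec n" "?w \<in> carrier_vec n" using vs ij by auto
  have sub: "set (vs[i := x]) \<subseteq> carrier_vec n" if "x \<in> carrier_vec n" for x
    using vs that set_update_subset_insert[of vs i x] by auto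
  have sub2: "set (vs[i := x, j := y]) \<subseteq> carrier_vec n"
    if "x \<in> carrier_vec n" "y \<in> carrier_vec n" for x y
    using sub[OF that(1)] that set_update_subset_insert[of "vs[i := x]" j y] by auto
  have alt: "\<alpha> (vs[i := x, j := x]) = 0" if "x \<in> carrier_vec n" for x
    by (rule Hom_ext_alternating[OF \<alpha> _ sub2[OF that that] ij]) (use vs ij in auto)
  have lin1: "\<alpha> (vs[i := ?u + ?w, j := x]) = \<alpha> (vs[i := ?u, j := x]) + \<alpha> (vs[i := ?w, j := x])"
    if "x \<in> carrier_vec n" for x
  proof -
    have "set (vs[j := x]) \<subseteq> carrier_vec n"
      using vs that set_update_subset_insert[of vs j x] by auto
    from Hom_ext_add_arg[OF \<alpha> _ this ij(1) uw] show ?thesis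
      unfolding list_update_swap[OF ij(3), of vs _ x] using vs(1) by simp
  qed
  have lin2: "\<alpha> (vs[i := x, j := ?u + ?w]) = \<alpha> (vs[i := x, j := ?u]) + \<alpha> (vs[i := x, j := ?w])"
    if "x \<in> carrier_vec n" for x
    using Hom_ext_add_arg[OF \<alpha> _ sub[OF that] ij(2) uw] vs by simp
  have "0 = \<alpha> (vs[i := ?u + ?w, j := ?u + ?w])" using alt uw by simp
  also have "\<dots> = \<alpha> (vs[i := ?u, j := ?w]) + \<alpha> (vs[i := ?w, j := ?u])"
    unfolding lin1[OF add_carrier_vec[OF uw]] lin2[OF uw(1)] lin2[OF uw(2)] alt[OF uw(1)]
      alt[OF uw(2)] by simp
  also have "vs[i := ?u, j := ?w] = vs" by simp
  finally show ?thesis by (simp add: eq_neg_iff_add_eq_0 add.commute)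
qed

text \<open>Only vanishing is carried along the transpositions, which keeps signs out of the
  induction.\<close>

lemma Hom_ext_permute_zero:
  assumes \<alpha>: "\<alpha> \<in> Hom_ext n m" and p: "p permutes {..<m}"
    and "length vs = m" "set vs \<subseteq> carrier_vec n" "\<alpha> vs = 0"
  shows "\<alpha> (permute_list p vs) = 0"
  using p finite_lessThan assms(3-)
proof (induct p arbitrary: vs rule: permutes_induct)
  case id
  then show ?case by simp
next
  case (swap a b p)
  have tr: "Transposition.transpose a b permutes {..<length vs}"
    using swap by (simp add: permutes_swap_id)
  have "permute_list (Transposition.transpose a b) vs = vs[a := vs ! b, b := vs ! a]"
    using swap by (intro nth_equalityI)
      (auto simp: permute_list_nth[OF tr] Transposition.transpose_def nth_list_update)
  then have "\<alpha> (permute_list (Transposition.transpose a b) vs) = 0"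
    using Hom_ext_swap[OF \<alpha>, of vs a b] swap by simp
  then have "\<alpha> (permute_list p (permute_list (Transposition.transpose a b) vs)) = 0"
    using swap set_permute_list[OF tr] by (intro swap) auto
  then show ?case
    using swap by (subst permute_list_compose) auto
qed

text \<open>Multilinearity reduces to lists of basis vectors; alternation removes those with
  repetitions and allows the others to be sorted.\<close>

lemma Hom_ext_eq_0I:
  assumes \<alpha>: "\<alpha> \<in> Hom_ext n m"
    and basis: "\<And>K. K \<subseteq> {..<n} \<Longrightarrow> card K = m \<Longrightarrow> \<alpha> (map (unit_vec n) (sorted_list_of_set K)) = 0"
  shows "\<alpha> = (\<lambda>_. 0)"
proof -
  have b: "\<alpha> (map (unit_vec n) js) = 0" if js: "set js \<subseteq> {..<n}" "length js = m" for js
  proof (cases "distinct js")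
    case True
    let ?K = "set js"
    have "mset js = mset (sorted_list_of_set ?K)"
      using True by (metis distinct_sorted_list_of_set finite_set set_eq_iff_mset_eq_distinct set_sorted_list_of_set)
    then obtain p where p: "p permutes {..<length (sorted_list_of_set ?K)}"
      "permute_list p (sorted_list_of_set ?K) = js"
      using mset_eq_permutation by metis
    have K: "card ?K = m" using True js by (simp add: distinct_card)
    with p have pm: "p permutes {..<m}" by simp
    have "\<alpha> (permute_list p (map (unit_vec n) (sorted_list_of_set ?K))) = 0"
      by (rule Hom_ext_permute_zero[OF \<alpha> pm _ _ basis[OF js(1) K]]) (use K in auto)
    then show ?thesis
      using p by (simp add: permute_list_map)
  next
    case False
    then obtain i j where "i < m" "j < m" "i \<noteq> j" "js ! i = js ! j"
      using js by (auto simp: distinct_conv_nth)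
    then show ?thesis using js by (intro Hom_ext_alternating[OF \<alpha>, of _ i j]) auto
  qed
  \<comment> \<open>The arguments in positions below \<open>t\<close> are arbitrary and the later
    ones are basis vectors; each induction step expands the argument in the last arbitrary
    position.\<close>
  have "\<alpha> vs = 0" if "length vs = m" "set vs \<subseteq> carrier_vec n" "t \<le> m"
    "\<forall>i<m. t \<le> i \<longrightarrow> vs ! i \<in> unit_vec n ` {..<n}" for t vs
    using that
  proof (induct t arbitrary: vs)
    case 0
    then have "\<forall>i<m. \<exists>j<n. vs ! i = unit_vec n j" by auto
    then obtain k where k: "\<And>i. i < m \<Longrightarrow> k i < n \<and> vs ! i = unit_vec n (k i)" by metis
    then have "vs = map (unit_vec n) (map k [0..<m])"
      using 0 by (intro nth_equalityI) auto
    moreover have "\<alpha> (map (unit_vec n) (map k [0..<m])) = 0"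
      using k by (intro b) auto
    ultimately show ?case by simp
  next
    case (Suc t)
    have v: "vs ! t \<in> carrier_vec n" using Suc by auto
    have "\<alpha> (vs[t := unit_vec n j]) = 0" if "j < n" for j
    proof (rule Suc(1))
      show "set (vs[t := unit_vec n j]) \<subseteq> carrier_vec n"
        using Suc set_update_subset_insert[of vs t "unit_vec n j"] by auto
      show "\<forall>i<m. t \<le> i \<longrightarrow> vs[t := unit_vec n j] ! i \<in> unit_vec n ` {..<n}"
        using Suc that by (auto simp: nth_list_update)
    qed (use Suc in auto)
    then have "\<alpha> (vs[t := vs ! t]) = 0"
      using Suc v by (subst Hom_ext_expand_arg[OF \<alpha>]) auto
    then show ?case by simp
  qed
  from this[of _ m] have "\<alpha> vs = 0" if "length vs = m" "set vs \<subseteq> carrier_vec n" for vs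
    using that by auto
  then show ?thesis using Hom_ext_outside[OF \<alpha>] by blast
qed

text \<open>This is Hom(V, S(V)), extended by 0 outside V so that determinants in such functionals
  follow the same convention as forms.\<close>

definition Vdual :: "nat \<Rightarrow> ('a::field vec \<Rightarrow> 'a mpoly) set" where
  "Vdual n = {\<phi>. (\<forall>v\<in>carrier_vec n. \<phi> v \<in> Sym n)
     \<and> (\<forall>u\<in>carrier_vec n. \<forall>w\<in>carrier_vec n. \<phi> (u + w) = \<phi> u + \<phi> w)
     \<and> (\<forall>u\<in>carrier_vec n. \<forall>k. \<phi> (k \<cdot>\<^sub>v u) = PConst k * \<phi> u)
     \<and> (\<forall>v. v \<notin> carrier_vec n \<longrightarrow> \<phi> v = 0)}"

lemma Vdual_Sym: "\<phi> \<in> Vdual n \<Longrightarrow> \<phi> v \<in> Sym n"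
  by (cases "v \<in> carrier_vec n") (auto simp: Vdual_def)

lemma Vdual_Hom_ext: "\<phi> \<in> Vdual n \<Longrightarrow> (\<lambda>vs. case vs of [v] \<Rightarrow> \<phi> v | _ \<Rightarrow> 0) \<in> Hom_ext n 1"
  unfolding Hom_ext_def Vdual_def by (auto simp: length_Suc_conv split: list.splits)

lemma Vdual_expand:
  assumes "\<phi> \<in> Vdual n" "v \<in> carrier_vec n"
  shows "\<phi> v = (\<Sum>j<n. PConst (v $ j) * \<phi> (unit_vec n j))"
  using Hom_ext_expand_arg[OF Vdual_Hom_ext[OF assms(1)], of "[v]" 0 v] assms by simp

lemma alt_prod_Hom_ext:
  assumes \<phi>: "set \<phi>s \<subseteq> Vdual n"
  shows "alt_prod \<phi>s \<in> Hom_ext n (length \<phi>s)"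
proof -
  let ?m = "length \<phi>s"
  have in_V: "\<phi>s ! i \<in> Vdual n" if "i < ?m" for i using \<phi> that by auto
  have zero: "alt_prod \<phi>s vs = 0" if "\<not> (length vs = ?m \<and> set vs \<subseteq> carrier_vec n)" for vs
  proof (cases "length vs = ?m")
    case True
    with that obtain j where j: "j < ?m" "vs ! j \<notin> carrier_vec n"
      by (metis in_set_conv_nth subsetI)
    have "det (fun_mat ?m (\<lambda>i j. (\<phi>s ! j) (vs ! i))) = 0"
      by (rule det_fun_mat_zero_row[OF j(1)]) (use in_V j in \<open>auto simp: Vdual_def\<close>)
    then have "det (fun_mat ?m (\<lambda>i j. (\<phi>s ! i) (vs ! j))) = 0"
      by (subst det_fun_mat_transpose[symmetric])
    then show ?thesis by (simp add: alt_prod_def)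
  qed (simp add: alt_prod_def)
  have Sym: "alt_prod \<phi>s vs \<in> Sym n" for vs
    unfolding alt_prod_def det_fun_mat using Vdual_Sym[OF in_V]
    by (auto intro!: Sym_sum Sym_mult Sym_prod)
  have upd: "alt_prod \<phi>s (vs[t := u]) = det (fun_mat ?m (\<lambda>i j. if j = t then (\<phi>s ! i) u else (\<phi>s ! i) (vs ! j)))"
    if "length vs = ?m" "t < ?m" for vs t u
    using that by (auto simp: alt_prod_def nth_list_update intro!: arg_cong[where f = det] eq_matI)
  show ?thesis
    unfolding Hom_ext_def
  proof (intro CollectI conjI allI impI ballI)
    fix vs :: "'a vec list" and t and u w :: "'a vec"
    assume vs: "length vs = ?m \<and> set vs \<subseteq> carrier_vec n" and t: "t < ?m"
      and uw: "u \<in> carrier_vec n" "w \<in> carrier_vec n"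
    have "alt_prod \<phi>s (vs[t := u + w])
      = det (fun_mat ?m (\<lambda>i j. if j = t then (\<phi>s ! i) u + (\<phi>s ! i) w else (\<phi>s ! i) (vs ! j)))"
      unfolding upd[OF conjunct1[OF vs] t] using in_V uw
      by (intro arg_cong[where f = det] eq_matI) (auto simp: Vdual_def)
    then show "alt_prod \<phi>s (vs[t := u + w]) = alt_prod \<phi>s (vs[t := u]) + alt_prod \<phi>s (vs[t := w])"
      using det_fun_mat_col_add[OF t] upd[OF conjunct1[OF vs] t] by simp
  next
    fix vs :: "'a vec list" and t and u :: "'a vec" and k
    assume vs: "length vs = ?m \<and> set vs \<subseteq> carrier_vec n" and t: "t < ?m"
      and u: "u \<in> carrier_vec n"
    have "alt_prod \<phi>s (vs[t := k \<cdot>\<^sub>v u])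
      = det (fun_mat ?m (\<lambda>i j. if j = t then PConst k * (\<phi>s ! i) u else (\<phi>s ! i) (vs ! j)))"
      unfolding upd[OF conjunct1[OF vs] t] using in_V u
      by (intro arg_cong[where f = det] eq_matI) (auto simp: Vdual_def)
    then show "alt_prod \<phi>s (vs[t := k \<cdot>\<^sub>v u]) = PConst k * alt_prod \<phi>s (vs[t := u])"
      using det_fun_mat_col_mult[OF t] upd[OF conjunct1[OF vs] t] by simp
  next
    fix vs :: "'a vec list" and i j
    assume "i < ?m" "j < ?m" "i \<noteq> j \<and> vs ! i = vs ! j"
    then show "alt_prod \<phi>s vs = 0"
      by (auto simp: alt_prod_def intro!: det_fun_mat_eq_cols[of i _ j])
  qed (use zero Sym in auto)
qed

lemma alt_prod_not_distinct:
  assumes "\<not> distinct \<phi>s"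
  shows "alt_prod \<phi>s = (\<lambda>_. 0)"
proof
  fix vs
  obtain i j where "i < length \<phi>s" "j < length \<phi>s" "i \<noteq> j" "\<phi>s ! i = \<phi>s ! j"
    using assms by (auto simp: distinct_conv_nth)
  then show "alt_prod \<phi>s vs = 0"
    by (auto simp: alt_prod_def intro!: det_fun_mat_eq_rows[of i _ j])
qed

text \<open>The sign depends on the two lists only and is fixed before the family \<open>w\<close>.
  It is recorded through \<open>s * s = 1\<close>, which is how it gets cancelled later.\<close>

lemma alt_prod_permute:
  assumes "mset js = mset ks"
  obtains s :: int where "s * s = 1"
    "\<And>w :: _ \<Rightarrow> 'a::field vec \<Rightarrow> 'a mpoly. alt_prod (map w js) = (\<lambda>vs. of_int s * alt_prod (map w ks) vs)"
proof -
  obtain p where p: "p permutes {..<length ks}" "permute_list p ks = js"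
    using mset_eq_permutation[OF assms] by metis
  have len: "length js = length ks" using assms by (metis size_mset)
  have "alt_prod (map w js) vs = of_int (sign p) * alt_prod (map w ks) vs" for w :: "_ \<Rightarrow> 'a vec \<Rightarrow> 'a mpoly" and vs
  proof (cases "length vs = length ks")
    case True
    have "fun_mat (length ks) (\<lambda>i j. (map w js ! i) (vs ! j))
      = fun_mat (length ks) (\<lambda>i j. (map w ks ! p i) (vs ! j))"
      using p len permutes_in_image[OF p(1)]
      by (intro eq_matI) (auto simp: permute_list_nth[OF p(1)] simp flip: p(2))
    then show ?thesis
      using det_fun_mat_permute_rows[OF p(1), of "\<lambda>i j. (map w ks ! i) (vs ! j)"] True len
      by (simp add: alt_prod_def)
  qed (use len in \<open>simp add: alt_prod_def\<close>)
  then show ?thesis by (intro that[of "sign p"]) (auto simp: sign_def)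
qed

text \<open>This inserts Cramer's identity for one functional into a product; the factor
  \<open>c\<close> takes the place of a denominator.\<close>

lemma alt_prod_row_subst:
  assumes k: "k < length \<phi>s" and eq: "\<And>v. c * (\<phi>s ! k) v = (\<Sum>s\<in>S. d s * \<psi> s v)"
  shows "c * alt_prod \<phi>s vs = (\<Sum>s\<in>S. d s * alt_prod (\<phi>s[k := \<psi> s]) vs)"
proof (cases "length vs = length \<phi>s")
  case True
  let ?m = "length \<phi>s"
  have "c * alt_prod \<phi>s vs = c * det (fun_mat ?m (\<lambda>i j. if i = k then (\<phi>s ! k) (vs ! j) else (\<phi>s ! i) (vs ! j)))"
    using True by (auto simp: alt_prod_def intro!: arg_cong[where f = det] arg_cong2[where f = "(*)"] eq_matI)
  also have "\<dots> = det (fun_mat ?m (\<lambda>i j. if i = k then \<Sum>s\<in>S. d s * \<psi> s (vs ! j) else (\<phi>s ! i) (vs ! j)))"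
    using det_fun_mat_row_mult[OF k, where c = c and G = "\<lambda>j. (\<phi>s ! k) (vs ! j)"] by (simp add: eq cong: if_cong)
  also have "\<dots> = (\<Sum>s\<in>S. d s * det (fun_mat ?m (\<lambda>i j. if i = k then \<psi> s (vs ! j) else (\<phi>s ! i) (vs ! j))))"
    by (rule det_fun_mat_row_sum[OF k])
  also have "\<dots> = (\<Sum>s\<in>S. d s * alt_prod (\<phi>s[k := \<psi> s]) vs)"
    using True by (auto simp: alt_prod_def nth_list_update intro!: sum.cong arg_cong[where f = det] arg_cong2[where f = "(*)"] eq_matI)
  finally show ?thesis .
qed (simp add: alt_prod_def)

section \<open>Bilinearity of the product over S(V), and closure properties of forms\<close>

lemma wedge_sum_left:
  "wedge (\<lambda>vs. \<Sum>s\<in>S. c s * A s vs) \<beta> = (\<lambda>vs. \<Sum>s\<in>S. c s * wedge (A s) \<beta> vs)"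
proof
  fix vs
  show "wedge (\<lambda>vs. \<Sum>s\<in>S. c s * A s vs) \<beta> vs = (\<Sum>s\<in>S. c s * wedge (A s) \<beta> vs)"
    unfolding wedge_def sum_distrib_left sum_distrib_right
    by (subst sum.swap[where A = S and B = "{..length vs}"], intro sum.cong refl,
        subst sum.swap[where A = S], intro sum.cong refl, simp add: algebra_simps)
qed

lemma wedge_sum_right:
  "wedge \<beta> (\<lambda>vs. \<Sum>s\<in>S. c s * A s vs) = (\<lambda>vs. \<Sum>s\<in>S. c s * wedge \<beta> (A s) vs)"
proof
  fix vs
  show "wedge \<beta> (\<lambda>vs. \<Sum>s\<in>S. c s * A s vs) vs = (\<Sum>s\<in>S. c s * wedge \<beta> (A s) vs)"
    unfolding wedge_def sum_distrib_left sum_distrib_right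
    by (subst sum.swap[where A = S and B = "{..length vs}"], intro sum.cong refl,
        subst sum.swap[where A = S], intro sum.cong refl, simp add: algebra_simps)
qed

lemma wedge_smult_left: "wedge (\<lambda>vs. c * A vs) \<beta> = (\<lambda>vs. c * wedge A \<beta> vs)"
  using wedge_sum_left[where S = "{()}" and c = "\<lambda>_. c" and A = "\<lambda>_. A"] by simp

lemma wedge_smult_right: "wedge \<beta> (\<lambda>vs. c * A vs) = (\<lambda>vs. c * wedge \<beta> A vs)"
  using wedge_sum_right[where S = "{()}" and c = "\<lambda>_. c" and A = "\<lambda>_. A"] by simp

lemma wedge_diff_left: "wedge (\<lambda>vs. A vs - B vs) \<beta> = (\<lambda>vs. wedge A \<beta> vs - wedge B \<beta> vs)"
  using wedge_sum_left[where S = "{True, False}" and c = "\<lambda>b. if b then 1 else -1" and A = "\<lambda>b. if b then A else B"] by simp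

lemma component_simps:
  "component m (\<lambda>vs. \<alpha> vs + \<beta> vs) = (\<lambda>vs. component m \<alpha> vs + component m \<beta> vs)"
  "component m (\<lambda>vs. f * \<alpha> vs) = (\<lambda>vs. f * component m \<alpha> vs)"
  "component m (\<lambda>_. 0) = (\<lambda>_. 0)"
  by (auto simp: component_def)

lemma Forms_add: "\<alpha> \<in> Forms n \<Longrightarrow> \<beta> \<in> Forms n \<Longrightarrow> (\<lambda>vs. \<alpha> vs + \<beta> vs) \<in> Forms n"
  by (auto simp: Forms_def component_simps intro: Hom_ext_add)

lemma Forms_smult: "\<alpha> \<in> Forms n \<Longrightarrow> f \<in> Sym n \<Longrightarrow> (\<lambda>vs. f * \<alpha> vs) \<in> Forms n"
  by (auto simp: Forms_def component_simps intro: Hom_ext_smult)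

lemma Forms_0: "(\<lambda>_. 0) \<in> Forms n"
  by (auto simp: Forms_def component_simps Hom_ext_0)

lemma Forms_diff: "\<alpha> \<in> Forms n \<Longrightarrow> \<beta> \<in> Forms n \<Longrightarrow> (\<lambda>vs. \<alpha> vs - \<beta> vs) \<in> Forms n"
  using Forms_add[OF _ Forms_smult[OF _ Sym_of_int[of "-1"]], of \<alpha> n \<beta>] by simp

lemma Forms_sum:
  "(\<And>s. s \<in> S \<Longrightarrow> A s \<in> Forms n) \<Longrightarrow> (\<lambda>vs. \<Sum>s\<in>S. A s vs) \<in> Forms n"
  by (induct S rule: infinite_finite_induct) (auto intro: Forms_0 Forms_add)

lemma Forms_Sym: "\<alpha> \<in> Forms n \<Longrightarrow> \<alpha> vs \<in> Sym n"
proof -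
  assume \<alpha>: "\<alpha> \<in> Forms n"
  have "\<alpha> vs = component (length vs) \<alpha> vs" by (simp add: component_def)
  also have "\<dots> \<in> Sym n"
    using \<alpha> by (cases "length vs \<le> n") (auto simp: Forms_def intro: Hom_ext_Sym)
  finally show ?thesis .
qed

lemma Forms_outside: "\<alpha> \<in> Forms n \<Longrightarrow> \<not> set vs \<subseteq> carrier_vec n \<or> n < length vs \<Longrightarrow> \<alpha> vs = 0"
proof -
  assume \<alpha>: "\<alpha> \<in> Forms n" and vs: "\<not> set vs \<subseteq> carrier_vec n \<or> n < length vs"
  have "\<alpha> vs = component (length vs) \<alpha> vs" by (simp add: component_def)
  also have "\<dots> = 0"
    using \<alpha> vs by (cases "length vs \<le> n") (auto simp: Forms_def dest!: spec[of _ "length vs"] Hom_ext_outside)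
  finally show ?thesis .
qed

lemma Forms_eq_0I:
  assumes \<alpha>: "\<alpha> \<in> Forms n"
    and basis: "\<And>K. K \<subseteq> {..<n} \<Longrightarrow> \<alpha> (map (unit_vec n) (sorted_list_of_set K)) = 0"
  shows "\<alpha> = (\<lambda>_. 0)"
proof
  fix vs
  show "\<alpha> vs = 0"
  proof (cases "length vs \<le> n")
    case True
    have "component (length vs) \<alpha> = (\<lambda>_. 0)"
      by (rule Hom_ext_eq_0I[of _ n "length vs"])
        (use \<alpha> True basis in \<open>auto simp: Forms_def component_def\<close>)
    then show ?thesis by (auto simp: component_def dest!: fun_cong[of _ _ vs])
  next
    case False
    then show ?thesis using Forms_outside[OF \<alpha>] by auto
  qed
qed

lemma alt_prod_Forms:
  assumes "set \<phi>s \<subseteq> Vdual n" "length \<phi>s \<le> n"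
  shows "alt_prod \<phi>s \<in> Forms n"
proof -
  have "component m (alt_prod \<phi>s) = (if m = length \<phi>s then alt_prod \<phi>s else (\<lambda>_. 0))" for m
    by (auto simp: component_def alt_prod_def)
  then show ?thesis using alt_prod_Hom_ext[OF assms(1)] assms(2) by (auto simp: Forms_def Hom_ext_0)
qed

section \<open>Duality of complementary exterior degrees\<close>

definition family_list :: "(nat \<Rightarrow> 'b) \<Rightarrow> nat set \<Rightarrow> 'b list" where
  "family_list w K = map w (sorted_list_of_set K)"

definition std_basis :: "nat \<Rightarrow> 'a::field vec list" where
  "std_basis n = map (unit_vec n) [0..<n]"

lemma length_std_basis [simp]: "length (std_basis n) = n"
  by (simp add: std_basis_def)

lemma length_family_list [simp]: "K \<subseteq> {..<n} \<Longrightarrow> length (family_list w K) = card K"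
  using finite_subset[of K "{..<n}"] by (simp add: family_list_def)

lemma set_family_list: "K \<subseteq> {..<n} \<Longrightarrow> set (family_list w K) = w ` K"
  using finite_subset[of K "{..<n}"] by (simp add: family_list_def)

lemma card_le_n: "K \<subseteq> {..<n} \<Longrightarrow> card K \<le> n"
  using card_mono[of "{..<n}" K] by simp

lemma alt_prod_family_list_Forms:
  assumes "K \<subseteq> {..<n}" "\<And>i. i < n \<Longrightarrow> w i \<in> Vdual n"
  shows "alt_prod (family_list w K) \<in> Forms n"
  using assms card_le_n[OF assms(1)] by (intro alt_prod_Forms) (auto simp: set_family_list[OF assms(1)])

lemma complement_sign_exists:
  "\<exists>s :: nat set \<Rightarrow> int. \<forall>J\<subseteq>{..<n}. s J * s J = 1 \<and>
    (\<forall>w :: nat \<Rightarrow> 'a::field vec \<Rightarrow> 'a mpoly. alt_prod (family_list w J @ family_list w ({..<n} - J))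
      = (\<lambda>vs. of_int (s J) * alt_prod (map w [0..<n]) vs))"
proof -
  have "\<exists>s :: int. s * s = 1 \<and>
    (\<forall>w :: nat \<Rightarrow> 'a vec \<Rightarrow> 'a mpoly. alt_prod (family_list w J @ family_list w ({..<n} - J))
      = (\<lambda>vs. of_int s * alt_prod (map w [0..<n]) vs))" if J: "J \<subseteq> {..<n}" for J
  proof -
    let ?js = "sorted_list_of_set J @ sorted_list_of_set ({..<n} - J)"
    have fin: "finite J" using J finite_subset by blast
    have "distinct ?js" "set ?js = set [0..<n]" using J fin by auto
    then have "mset ?js = mset [0..<n]"
      using set_eq_iff_mset_eq_distinct[of ?js "[0..<n]"] by simp
    then show ?thesis
      by (rule alt_prod_permute[of _ _ "?thesis", where 'a = 'a]) (auto simp: family_list_def)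
  qed
  then show ?thesis by metis
qed

text \<open>The sign of the permutation that sorts \<open>J\<close> followed by its complement. It
  is chosen by its two properties, and the type argument supplies the field, which neither
  \<open>n\<close> nor \<open>J\<close> mentions.\<close>

definition complement_sign :: "'a::field itself \<Rightarrow> nat \<Rightarrow> nat set \<Rightarrow> int" where
  "complement_sign _ n = (SOME s. \<forall>J\<subseteq>{..<n}. s J * s J = 1 \<and>
    (\<forall>w :: nat \<Rightarrow> 'a vec \<Rightarrow> 'a mpoly. alt_prod (family_list w J @ family_list w ({..<n} - J))
      = (\<lambda>vs. of_int (s J) * alt_prod (map w [0..<n]) vs)))"

lemma complement_sign:
  fixes w :: "nat \<Rightarrow> 'a::field vec \<Rightarrow> 'a mpoly"
  assumes "J \<subseteq> {..<n}"
  shows "complement_sign TYPE('a) n J * complement_sign TYPE('a) n J = 1"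
    and "alt_prod (family_list w J @ family_list w ({..<n} - J))
      = (\<lambda>vs. of_int (complement_sign TYPE('a) n J) * alt_prod (map w [0..<n]) vs)"
proof -
  have "\<forall>J\<subseteq>{..<n}. complement_sign TYPE('a) n J * complement_sign TYPE('a) n J = 1 \<and>
    (\<forall>w :: nat \<Rightarrow> 'a vec \<Rightarrow> 'a mpoly. alt_prod (family_list w J @ family_list w ({..<n} - J))
      = (\<lambda>vs. of_int (complement_sign TYPE('a) n J) * alt_prod (map w [0..<n]) vs))"
    unfolding complement_sign_def by (rule someI_ex[OF complement_sign_exists])
  from this[rule_format, OF assms] show
    "complement_sign TYPE('a) n J * complement_sign TYPE('a) n J = 1"
    "alt_prod (family_list w J @ family_list w ({..<n} - J))
      = (\<lambda>vs. of_int (complement_sign TYPE('a) n J) * alt_prod (map w [0..<n]) vs)"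
    by simp_all
qed

text \<open>If the index sets overlap, two rows coincide. If they are disjoint but do not cover
  \<open>{..<n}\<close>, there are fewer than n factors and the value on n vectors is 0 by the
  convention on lengths.\<close>

lemma alt_prod_family_list_eq_0:
  assumes "J \<subseteq> {..<n}" "K \<subseteq> {..<n}" "J \<noteq> {..<n} - K"
  shows "alt_prod (family_list w J @ family_list w K) (std_basis n) = 0"
proof (cases "J \<inter> K = {}")
  case True
  have "card (J \<union> K) = card J + card K"
    using True assms finite_subset[of _ "{..<n}"] by (intro card_Un_disjoint) auto
  moreover have "J \<union> K \<noteq> {..<n}" using True assms by blast
  then have "card (J \<union> K) \<noteq> n"
    using card_subset_eq[of "{..<n}" "J \<union> K"] assms by auto
  ultimately show ?thesis
    using assms by (simp add: alt_prod_def)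
next
  case False
  then have "\<not> distinct (family_list w J @ family_list w K)"
    using assms by (auto simp: set_family_list)
  then show ?thesis by (simp add: alt_prod_not_distinct)
qed

text \<open>The coefficient extraction behind independence, nondegeneracy, spanning and the
  computation of degrees: only the index set complementary to \<open>K\<close> survives.\<close>

lemma wedge_alt_prod_complement:
  fixes w :: "nat \<Rightarrow> 'a::field vec \<Rightarrow> 'a mpoly"
  assumes K: "K \<subseteq> {..<n}"
  shows "wedge (\<lambda>vs. \<Sum>J\<in>Pow {..<n}. f J * alt_prod (family_list w J) vs) (alt_prod (family_list w K)) (std_basis n)
    = f ({..<n} - K) * of_int (complement_sign TYPE('a) n ({..<n} - K))
      * alt_prod (map w [0..<n]) (std_basis n)"
proof -
  have "wedge (\<lambda>vs. \<Sum>J\<in>Pow {..<n}. f J * alt_prod (family_list w J) vs) (alt_prod (family_list w K)) (std_basis n)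
    = (\<Sum>J\<in>Pow {..<n}. f J * alt_prod (family_list w J @ family_list w K) (std_basis n))"
    by (simp add: wedge_sum_left wedge_alt_prod)
  also have "\<dots> = (\<Sum>J\<in>{{..<n} - K}. f J * alt_prod (family_list w J @ family_list w K) (std_basis n))"
    using K by (intro sum.mono_neutral_right) (auto simp: alt_prod_family_list_eq_0)
  finally show ?thesis
    using complement_sign(2)[of "{..<n} - K" n w] K by (simp add: double_diff)
qed

lemma alt_prod_family_list_independent:
  fixes w :: "nat \<Rightarrow> 'a::field vec \<Rightarrow> 'a mpoly"
  assumes L: "alt_prod (map w [0..<n]) (std_basis n) \<noteq> 0"
    and eq: "\<And>vs. (\<Sum>J\<in>Pow {..<n}. f J * alt_prod (family_list w J) vs) = 0" and J: "J \<subseteq> {..<n}"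
  shows "f J = 0"
proof -
  have "wedge (\<lambda>vs. \<Sum>J\<in>Pow {..<n}. f J * alt_prod (family_list w J) vs) (alt_prod (family_list w ({..<n} - J))) (std_basis n) = 0"
    unfolding eq by (simp add: wedge_def)
  moreover have "{..<n} - ({..<n} - J) = J" using J by auto
  ultimately have "f J * of_int (complement_sign TYPE('a) n J) = (0 :: 'a mpoly)"
    using L by (subst (asm) wedge_alt_prod_complement) auto
  then have "f J * of_int (complement_sign TYPE('a) n J * complement_sign TYPE('a) n J) = (0 :: 'a mpoly)"
    by (simp only: of_int_mult flip: mult.assoc) simp
  then show ?thesis using complement_sign(1)[OF J, where 'a = 'a] by simp
qed

text \<open>The dual basis. For this family the determinant on the standard basis is 1, so the
  complementary pairing recovers the coefficients of a form exactly.\<close>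

definition coord_functional :: "nat \<Rightarrow> nat \<Rightarrow> 'a::field vec \<Rightarrow> 'a mpoly" where
  "coord_functional n k v = (if v \<in> carrier_vec n then PConst (v $ k) else 0)"

lemma coord_functional_Vdual: "k < n \<Longrightarrow> coord_functional n k \<in> Vdual n"
  by (auto simp: Vdual_def coord_functional_def PConst.hom_add PConst.hom_mult)

text \<open>Equal index sets give the identity matrix. Distinct ones of equal size leave an index of
  \<open>K\<close> outside \<open>J\<close>, whose row is zero; unequal sizes fall under the
  convention on lengths.\<close>

lemma alt_prod_coord_functional_basis:
  assumes JK: "J \<subseteq> {..<n}" "K \<subseteq> {..<n}"
  shows "alt_prod (family_list (coord_functional n) K) (map (unit_vec n) (sorted_list_of_set J)) = (if J = K then 1 else 0)"
proof (cases "J = K")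
  case True
  have fin: "finite K" using JK finite_subset by blast
  let ?xs = "sorted_list_of_set K"
  have "distinct ?xs" "\<And>i. i < card K \<Longrightarrow> ?xs ! i < n"
    using JK fin by (auto dest!: nth_mem[of _ ?xs, simplified])
  then have "fun_mat (card K) (\<lambda>i j. coord_functional n (?xs ! i) (unit_vec n (?xs ! j))) = (1\<^sub>m (card K) :: 'a mpoly mat)"
    using fin by (intro eq_matI) (auto simp: coord_functional_def nth_eq_iff_index_eq)
  moreover have "alt_prod (family_list (coord_functional n) K) (map (unit_vec n) ?xs)
    = det (fun_mat (card K) (\<lambda>i j. coord_functional n (?xs ! i) (unit_vec n (?xs ! j))) :: 'a mpoly mat)"
    using JK fin by (auto simp: alt_prod_def family_list_def intro!: arg_cong[where f = det] eq_matI)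
  ultimately show ?thesis using True by simp
next
  case False
  have fin: "finite K" "finite J" using JK finite_subset by blast+
  let ?xs = "sorted_list_of_set K" and ?ys = "sorted_list_of_set J"
  show ?thesis
  proof (cases "card J = card K")
    case True
    then obtain k where k: "k \<in> K" "k \<notin> J"
      using False fin by (metis card_subset_eq subsetI)
    then obtain i where i: "i < card K" "?xs ! i = k"
      using fin by (metis in_set_conv_nth set_sorted_list_of_set length_sorted_list_of_set)
    have "?ys ! j \<in> J" if "j < card K" for j
      using that fin True nth_mem[of j ?ys] by simp
    then have "coord_functional n (?xs ! i) (unit_vec n (?ys ! j)) = 0" if "j < card K" for j
      using that k i JK by (auto simp: coord_functional_def subset_eq)
    then have "det (fun_mat (card K) (\<lambda>i j. coord_functional n (?xs ! i) (unit_vec n (?ys ! j))) :: 'a mpoly mat) = 0"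
      using i by (intro det_fun_mat_zero_row[of i])
    moreover have "alt_prod (family_list (coord_functional n) K) (map (unit_vec n) ?ys)
      = det (fun_mat (card K) (\<lambda>i j. coord_functional n (?xs ! i) (unit_vec n (?ys ! j))) :: 'a mpoly mat)"
      using JK fin True by (auto simp: alt_prod_def family_list_def intro!: arg_cong[where f = det] eq_matI)
    ultimately show ?thesis using False by simp
  next
    case 2: False
    then show ?thesis using JK fin False by (simp add: alt_prod_def)
  qed
qed

lemma alt_prod_coord_functional_top: "alt_prod (map (coord_functional n) [0..<n]) (std_basis n) = 1"
  using alt_prod_coord_functional_basis[of "{..<n}" n "{..<n}"]
  by (simp add: family_list_def std_basis_def sorted_list_of_set_range flip: atLeast0LessThan)

lemma Forms_expand:
  assumes \<alpha>: "\<alpha> \<in> Forms n"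
  shows "\<alpha> = (\<lambda>vs. \<Sum>K\<in>Pow {..<n}.
    \<alpha> (map (unit_vec n) (sorted_list_of_set K)) * alt_prod (family_list (coord_functional n) K) vs)" (is "_ = ?\<beta>")
proof -
  have "?\<beta> \<in> Forms n"
    using Forms_Sym[OF \<alpha>] coord_functional_Vdual by (intro Forms_sum Forms_smult alt_prod_family_list_Forms) auto
  then have "(\<lambda>vs. \<alpha> vs - ?\<beta> vs) \<in> Forms n" using \<alpha> by (intro Forms_diff)
  then have "(\<lambda>vs. \<alpha> vs - ?\<beta> vs) = (\<lambda>_. 0)"
  proof (rule Forms_eq_0I)
    fix K assume K: "K \<subseteq> {..<n}"
    have "?\<beta> (map (unit_vec n) (sorted_list_of_set K)) = (\<Sum>J\<in>Pow {..<n}.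
      if K = J then \<alpha> (map (unit_vec n) (sorted_list_of_set J)) else 0)"
      by (intro sum.cong refl) (use K in \<open>auto simp: alt_prod_coord_functional_basis\<close>)
    also have "\<dots> = \<alpha> (map (unit_vec n) (sorted_list_of_set K))"
      using K by simp
    finally show "\<alpha> (map (unit_vec n) (sorted_list_of_set K))
      - ?\<beta> (map (unit_vec n) (sorted_list_of_set K)) = 0" by simp
  qed
  then show ?thesis by (metis (no_types, lifting) eq_iff_diff_eq_0 ext)
qed

text \<open>Cramer's rule, in the form \<open>adj(M) M = det(M) 1\<close> for the matrix \<open>M\<close> of the family \<open>w\<close>.\<close>
lemma cramer_functional:
  fixes w :: "nat \<Rightarrow> 'a::field vec \<Rightarrow> 'a mpoly"
  assumes w: "\<And>i. i < n \<Longrightarrow> w i \<in> Vdual n" and \<phi>: "\<phi> \<in> Vdual n"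
  obtains c where "\<And>v. alt_prod (map w [0..<n]) (std_basis n) * \<phi> v = (\<Sum>j<n. c j * w j v)"
proof -
  let ?M = "fun_mat n (\<lambda>i j. w i (unit_vec n j))"
  let ?L = "alt_prod (map w [0..<n]) (std_basis n)"
  let ?A = "adj_mat ?M"
  have L: "?L = det ?M"
    by (auto simp: alt_prod_def std_basis_def intro!: arg_cong[where f = det] eq_matI)
  have M: "?M \<in> carrier_mat n n" by simp
  have adj: "(\<Sum>j<n. ?A $$ (k, j) * w j (unit_vec n i)) = (if i = k then ?L else 0)"
    if "i < n" "k < n" for i k
  proof -
    have "(\<Sum>j<n. ?A $$ (k, j) * w j (unit_vec n i)) = (?A * ?M) $$ (k, i)"
      using that adj_mat(1)[OF M] by (auto simp: scalar_prod_def atLeast0LessThan intro!: sum.cong)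
    then show ?thesis using that adj_mat(3)[OF M] L by simp
  qed
  \<comment> \<open>The row of values of \<phi> on the basis, multiplied by the adjugate.\<close>
  define c where "c j = (\<Sum>k<n. \<phi> (unit_vec n k) * ?A $$ (k, j))" for j
  have "?L * \<phi> v = (\<Sum>j<n. c j * w j v)" for v
  proof (cases "v \<in> carrier_vec n")
    case v: True
    have "(\<Sum>j<n. c j * w j v) = (\<Sum>j<n. \<Sum>i<n. \<Sum>k<n.
        PConst (v $ i) * \<phi> (unit_vec n k) * (?A $$ (k, j) * w j (unit_vec n i)))"
    proof (intro sum.cong refl)
      fix j assume "j \<in> {..<n}"
      then have "c j * w j v = (\<Sum>k<n. \<Sum>i<n.
          PConst (v $ i) * \<phi> (unit_vec n k) * (?A $$ (k, j) * w j (unit_vec n i)))"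
        using w v by (simp add: Vdual_expand[of "w j" n v] c_def sum_distrib_left sum_distrib_right
            algebra_simps)
      then show "c j * w j v = (\<Sum>i<n. \<Sum>k<n.
          PConst (v $ i) * \<phi> (unit_vec n k) * (?A $$ (k, j) * w j (unit_vec n i)))"
        by (subst sum.swap)
    qed
    also have "\<dots> = (\<Sum>i<n. \<Sum>k<n. \<Sum>j<n.
        PConst (v $ i) * \<phi> (unit_vec n k) * (?A $$ (k, j) * w j (unit_vec n i)))"
      by (rule trans[OF sum.swap], rule sum.cong[OF refl], rule sum.swap)
    also have "\<dots> = (\<Sum>i<n. \<Sum>k<n. PConst (v $ i) * \<phi> (unit_vec n k) * (if i = k then ?L else 0))"
      using adj by (intro sum.cong refl) (simp flip: sum_distrib_left)
    also have "\<dots> = ?L * \<phi> v"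
      using v \<phi> by (simp add: Vdual_expand[of \<phi> n v] sum_distrib_left algebra_simps if_distrib cong: if_cong)
    finally show ?thesis by simp
  next
    case False
    then show ?thesis using w \<phi> by (simp add: Vdual_def)
  qed
  then show ?thesis by (rule that)
qed

text \<open>Up to the nonzero factor L, Cramer's rule replaces arbitrary functionals one at a time
  by members of \<open>w\<close>. So \<alpha> is also orthogonal to all products of coordinate
  functionals, and these read off its coefficients. The lists \<open>js\<close> may be unsorted or
  repetitive because the replacement produces such lists.\<close>

lemma Forms_nondegenerate:
  fixes w :: "nat \<Rightarrow> 'a::field vec \<Rightarrow> 'a mpoly"
  assumes w: "\<And>i. i < n \<Longrightarrow> w i \<in> Vdual n"
    and L: "alt_prod (map w [0..<n]) (std_basis n) \<noteq> 0"
    and \<alpha>: "\<alpha> \<in> Forms n"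
    and zero: "\<And>js. set js \<subseteq> {..<n} \<Longrightarrow> wedge \<alpha> (alt_prod (map w js)) (std_basis n) = 0"
  shows "\<alpha> = (\<lambda>_. 0)"
proof (rule Forms_eq_0I[OF \<alpha>])
  let ?T = "\<lambda>\<phi>s. wedge \<alpha> (alt_prod \<phi>s) (std_basis n)"
  let ?L = "alt_prod (map w [0..<n]) (std_basis n)"
  have T: "?T \<phi>s = 0" if "set \<phi>s \<subseteq> Vdual n"
    "\<forall>i<length \<phi>s. t \<le> i \<longrightarrow> \<phi>s ! i \<in> w ` {..<n}" for \<phi>s t
    using that
  proof (induct t arbitrary: \<phi>s)
    case 0
    then have "\<forall>i<length \<phi>s. \<exists>j<n. \<phi>s ! i = w j" by auto
    then obtain k where k: "\<And>i. i < length \<phi>s \<Longrightarrow> k i < n \<and> \<phi>s ! i = w (k i)" by metis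
    then have "\<phi>s = map w (map k [0..<length \<phi>s])" by (intro nth_equalityI) auto
    moreover have "?T (map w (map k [0..<length \<phi>s])) = 0" using k by (intro zero) auto
    ultimately show ?case by simp
  next
    case (Suc t)
    show ?case
    proof (cases "t < length \<phi>s")
      case True
      then have "\<phi>s ! t \<in> Vdual n" using Suc by auto
      then obtain c where c: "\<And>v. ?L * (\<phi>s ! t) v = (\<Sum>j<n. c j * w j v)"
        by (rule cramer_functional[OF w, rotated]) auto
      have "(\<lambda>vs. ?L * alt_prod \<phi>s vs) = (\<lambda>vs. \<Sum>j<n. c j * alt_prod (\<phi>s[t := w j]) vs)"
        by (rule ext) (rule alt_prod_row_subst[OF True c])
      then have "wedge \<alpha> (\<lambda>vs. ?L * alt_prod \<phi>s vs)
          = wedge \<alpha> (\<lambda>vs. \<Sum>j<n. c j * alt_prod (\<phi>s[t := w j]) vs)"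
        by simp
      then have "?L * ?T \<phi>s = (\<Sum>j<n. c j * ?T (\<phi>s[t := w j]))"
        unfolding wedge_smult_right wedge_sum_right by (rule fun_cong)
      also have "\<dots> = 0"
      proof (intro sum.neutral ballI)
        fix j assume "j \<in> {..<n}"
        then have "?T (\<phi>s[t := w j]) = 0"
          using Suc w set_update_subset_insert[of \<phi>s t "w j"]
          by (intro Suc(1)) (auto simp: nth_list_update)
        then show "c j * ?T (\<phi>s[t := w j]) = 0" by simp
      qed
      finally show ?thesis using L by simp
    next
      case False
      then show ?thesis using Suc(2,3) by (intro Suc(1)) auto
    qed
  qed
  fix K assume K: "K \<subseteq> {..<n}"
  have "?T (family_list (coord_functional n) ({..<n} - K)) = 0"
    by (rule T[of _ n])
      (use card_le_n[of "{..<n} - K" n] coord_functional_Vdual in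
        \<open>auto simp: set_family_list[of _ n] length_family_list[of _ n]\<close>)
  moreover have KK: "{..<n} - ({..<n} - K) = K" using K by auto
  ultimately have "\<alpha> (map (unit_vec n) (sorted_list_of_set K)) * of_int (complement_sign TYPE('a) n K) = 0"
    by (subst (asm) Forms_expand[OF \<alpha>]) (simp add: wedge_alt_prod_complement alt_prod_coord_functional_top)
  then have "\<alpha> (map (unit_vec n) (sorted_list_of_set K))
      * of_int (complement_sign TYPE('a) n K * complement_sign TYPE('a) n K) = 0"
    by (simp only: of_int_mult flip: mult.assoc) simp
  then show "\<alpha> (map (unit_vec n) (sorted_list_of_set K)) = 0"
    using complement_sign(1)[OF K, where 'a = 'a] by simp
qed

text \<open>Division by L enters through the given polynomials \<open>f\<close>: the combination
  built from them has the same pairings as \<alpha>, so nondegeneracy identifies the two.\<close>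

lemma Forms_span:
  fixes w :: "nat \<Rightarrow> 'a::field vec \<Rightarrow> 'a mpoly"
  assumes w: "\<And>i. i < n \<Longrightarrow> w i \<in> Vdual n"
    and L: "alt_prod (map w [0..<n]) (std_basis n) \<noteq> 0"
    and \<alpha>: "\<alpha> \<in> Forms n"
    and f: "\<And>K. K \<subseteq> {..<n} \<Longrightarrow> f K \<in> Sym n"
      "\<And>K. K \<subseteq> {..<n} \<Longrightarrow> wedge \<alpha> (alt_prod (family_list w K)) (std_basis n)
        = alt_prod (map w [0..<n]) (std_basis n) * f K"
  obtains f' where "\<And>J. J \<subseteq> {..<n} \<Longrightarrow> f' J \<in> Sym n"
    "\<alpha> = (\<lambda>vs. \<Sum>J\<in>Pow {..<n}. f' J * alt_prod (family_list w J) vs)"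
proof -
  let ?L = "alt_prod (map w [0..<n]) (std_basis n)"
  let ?s = "complement_sign TYPE('a) n"
  \<comment> \<open>Pairing with \<omega>_K sees the coefficient at the complement of K up to a
    sign; the sign is its own inverse.\<close>
  define f' where "f' J = of_int (?s J) * f ({..<n} - J)" for J
  define \<beta> where "\<beta> = (\<lambda>vs. \<Sum>J\<in>Pow {..<n}. f' J * alt_prod (family_list w J) vs)"
  have Sym: "f' J \<in> Sym n" if "J \<subseteq> {..<n}" for J
    using that f unfolding f'_def by (intro Sym_mult) auto
  have \<beta>: "\<beta> \<in> Forms n"
    unfolding \<beta>_def using w Sym by (intro Forms_sum Forms_smult alt_prod_family_list_Forms) auto
  have "(\<lambda>vs. \<alpha> vs - \<beta> vs) = (\<lambda>_. 0)"
  proof (rule Forms_nondegenerate[OF w L Forms_diff[OF \<alpha> \<beta>]])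
    fix js assume js: "set js \<subseteq> {..<n}"
    show "wedge (\<lambda>vs. \<alpha> vs - \<beta> vs) (alt_prod (map w js)) (std_basis n) = 0"
    proof (cases "distinct js")
      case True
      let ?K = "set js"
      have K: "{..<n} - ({..<n} - ?K) = ?K" "{..<n} - ?K \<subseteq> {..<n}" using js by auto
      have "mset js = mset (sorted_list_of_set ?K)"
        using True by (metis distinct_sorted_list_of_set finite_set set_eq_iff_mset_eq_distinct set_sorted_list_of_set)
      then obtain s :: int where s: "alt_prod (map w js) = (\<lambda>vs. of_int s * alt_prod (family_list w ?K) vs)"
        by (rule alt_prod_permute[where 'a = 'a]) (auto simp: family_list_def)
      have "wedge \<beta> (alt_prod (family_list w ?K)) (std_basis n)
          = f ?K * of_int (?s ({..<n} - ?K) * ?s ({..<n} - ?K)) * ?L"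
        unfolding \<beta>_def wedge_alt_prod_complement[OF js] f'_def K(1) by (simp add: algebra_simps)
      also have "\<dots> = wedge \<alpha> (alt_prod (family_list w ?K)) (std_basis n)"
        using complement_sign(1)[OF K(2), where 'a = 'a] f(2)[OF js] by simp
      finally show ?thesis unfolding s wedge_smult_right by (simp add: wedge_diff_left)
    next
      case False
      then have "\<not> distinct (map w js)" by (simp add: distinct_map)
      then show ?thesis by (simp add: alt_prod_not_distinct wedge_def)
    qed
  qed
  then have "\<alpha> = \<beta>" by (metis (no_types, lifting) eq_iff_diff_eq_0 ext)
  then show ?thesis using that[of f'] Sym \<beta>_def by blast
qed

section \<open>The Moore determinant\<close>

text \<open>Multiplication by a nonzero x permutes the nonzero elements; comparing the products of
  all of them gives x^(q - 1) = 1.\<close>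

lemma field_power_card:
  fixes x :: "'a::{finite,field}"
  shows "x ^ (CARD('a) ^ i) = x"
proof -
  have "x ^ CARD('a) = x"
  proof (cases "x = 0")
    case False
    let ?U = "UNIV - {0 :: 'a}"
    have "(\<Prod>y\<in>?U. x * y) = \<Prod>?U"
      by (rule prod.reindex_bij_witness[of _ "\<lambda>y. y / x" "\<lambda>y. x * y"]) (use False in auto)
    moreover have "(\<Prod>y\<in>?U. x * y) = x ^ (CARD('a) - 1) * \<Prod>?U"
      by (simp add: prod.distrib)
    ultimately have "x ^ (CARD('a) - 1) = 1" by simp
    then show ?thesis
      using power_minus_mult[of "CARD('a)" x] finite_UNIV_card_ge_0[where 'a = 'a] by simp
  qed (use finite_UNIV_card_ge_0[where 'a = 'a] in auto)
  then show ?thesis by (induct i) (simp_all add: power_mult)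
qed

lemma CHAR_mpoly: "CHAR('a::field mpoly) = CHAR('a)"
proof (rule CHAR_eqI)
  have of_nat: "(of_nat k :: 'a mpoly) = PConst (of_nat k)" for k
    by (simp add: PConst.hom_of_nat)
  show "of_nat CHAR('a) = (0 :: 'a mpoly)" by (simp add: of_nat)
  show "CHAR('a) dvd k" if "of_nat k = (0 :: 'a mpoly)" for k
    using that by (simp add: of_nat of_nat_eq_0_iff_char_dvd)
qed

definition omega_functional :: "nat \<Rightarrow> nat \<Rightarrow> 'a::{finite,field} vec \<Rightarrow> 'a mpoly" where
  "omega_functional n i v = (if v \<in> carrier_vec n then lin v ^ (CARD('a) ^ i) else 0)"

definition moore :: "nat \<Rightarrow> 'a::{finite,field} mpoly" where
  "moore m = det (fun_mat m (\<lambda>i j. PVar j ^ (CARD('a) ^ i)))"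

text \<open>Representatives of the lines of \<open>F\<^sub>q\<^sup>n\<close>, by position \<open>k\<close> of the last nonzero coordinate.\<close>
definition line_reps :: "nat \<Rightarrow> nat \<Rightarrow> 'a::field vec set" where
  "line_reps n k = {v \<in> carrier_vec n. v $ k = 1 \<and> (\<forall>j<n. k < j \<longrightarrow> v $ j = 0)}"

context
  fixes p r :: nat
  assumes p: "prime p" and card: "CARD('a::{finite,field}) = p ^ r"
begin

lemma CHAR_eq: "CHAR('a) = p"
proof -
  \<comment> \<open>Translation by 1 permutes the field, so q times 1 is 0 and the characteristic
    divides q.\<close>
  have "(\<Sum>x\<in>UNIV. x + 1) = (\<Sum>x\<in>UNIV. x :: 'a)"
    by (rule sum.reindex_bij_witness[of _ "\<lambda>x. x - 1" "\<lambda>x. x + 1"]) auto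
  then have "of_nat CARD('a) = (0 :: 'a)"
    by (simp add: sum.distrib)
  then have "CHAR('a) dvd p ^ r" unfolding card of_nat_eq_0_iff_char_dvd .
  moreover have "prime CHAR('a)"
    using prime_CHAR_semidom[where 'a = 'a] finite_imp_CHAR_pos[where 'a = 'a] by auto
  ultimately show ?thesis
    using p by (metis prime_dvd_power primes_dvd_imp_eq)
qed

lemma frobenius_sum:
  "(\<Sum>i\<in>A. f i) ^ (CARD('a) ^ k) = (\<Sum>i\<in>A. f i ^ (CARD('a) ^ k) :: 'a mpoly)"
  by (rule freshmans_dream_sum'[of _ "r * k"]) (use p card in \<open>simp_all add: CHAR_mpoly CHAR_eq power_mult\<close>)

lemma frobenius_add:
  "(f + g) ^ (CARD('a) ^ k) = (f ^ (CARD('a) ^ k) + g ^ (CARD('a) ^ k) :: 'a mpoly)"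
  by (rule freshmans_dream'[of _ "r * k"]) (use p card in \<open>simp_all add: CHAR_mpoly CHAR_eq power_mult\<close>)

lemma PConst_power_card: "(PConst c :: 'a mpoly) ^ (CARD('a) ^ k) = PConst c"
  by (simp add: field_power_card flip: PConst.hom_power)

lemma omega_functional_Vdual: "omega_functional n i \<in> (Vdual n :: ('a vec \<Rightarrow> 'a mpoly) set)"
  by (auto simp: Vdual_def omega_functional_def lin_add lin_smult frobenius_add power_mult_distrib
      PConst_power_card intro!: Sym_power)

lemma alt_prod_omega_functional_top: "alt_prod (map (omega_functional n) [0..<n]) (std_basis n :: 'a vec list) = moore n"
  by (auto simp: alt_prod_def moore_def std_basis_def omega_functional_def intro!: arg_cong[where f = det] eq_matI)

text \<open>The coordinates before position \<open>k\<close> are free. The count has to match the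
  degree of the Moore determinant in its last variable.\<close>

lemma card_line_reps:
  assumes k: "k < n"
  shows "finite (line_reps n k :: 'a vec set)" "card (line_reps n k :: 'a vec set) = CARD('a) ^ k"
proof -
  let ?F = "{..<k} \<rightarrow>\<^sub>E (UNIV :: 'a set)"
  have bij: "bij_betw (\<lambda>f. vec n (\<lambda>j. if j < k then f j else if j = k then 1 else 0)) ?F (line_reps n k :: 'a vec set)"
    by (rule bij_betw_byWitness[where f' = "\<lambda>v. restrict (\<lambda>j. v $ j) {..<k}"])
      (use k in \<open>auto simp: line_reps_def PiE_def extensional_def fun_eq_iff intro!: eq_vecI\<close>)
  have fin: "finite ?F" by (intro finite_PiE) auto
  show "finite (line_reps n k :: 'a vec set)" using bij fin bij_betw_finite by blast
  show "card (line_reps n k :: 'a vec set) = CARD('a) ^ k"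
    using bij_betw_same_card[OF bij] by (simp add: card_PiE)
qed

text \<open>
  Viewed as a polynomial in its last variable, the Moore determinant of size \<open>m + 1\<close> has degree
  \<open>q\<^sup>m\<close> and vanishes on the \<open>q\<^sup>m\<close> linear combinations of the other variables.
\<close>
lemma moore_Suc:
  assumes m: "m < n"
  shows "moore (Suc m) = (moore m :: 'a mpoly) * (\<Prod>v\<in>line_reps n m. lin v)"
proof -
  let ?q = "CARD('a)"
  let ?x = "PVar :: nat \<Rightarrow> 'a mpoly"
  \<comment> \<open>The cofactors of the last column: \<open>P\<close> is then the determinant with
    the last variable replaced by an indeterminate.\<close>
  define d where "d s = det (fun_mat (Suc m) (\<lambda>i j. if j = m then (if i = s then 1 else 0)
      else ?x j ^ (?q ^ i)))" for s
  define P where "P = (\<Sum>s<Suc m. Polynomial.monom (d s) (?q ^ s))"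
  have q: "1 < ?q"
    using card_mono[of UNIV "{0, 1 :: 'a}"] by simp
  have poly_P: "poly P a = det (fun_mat (Suc m) (\<lambda>i j. if j = m then a ^ (?q ^ i) else ?x j ^ (?q ^ i)))" for a
  proof -
    have "poly P a = (\<Sum>s<Suc m. a ^ (?q ^ s) * d s)"
      by (simp add: P_def poly_sum poly_monom mult.commute)
    also have "\<dots> = det (fun_mat (Suc m) (\<lambda>i j. if j = m then \<Sum>s<Suc m. a ^ (?q ^ s) * (if i = s then 1 else 0)
        else ?x j ^ (?q ^ i)))"
      unfolding d_def by (rule det_fun_mat_col_sum[symmetric]) simp
    also have "\<dots> = det (fun_mat (Suc m) (\<lambda>i j. if j = m then a ^ (?q ^ i) else ?x j ^ (?q ^ i)))"
      by (intro arg_cong[where f = det] eq_matI) (auto simp: if_distrib cong: if_cong)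
    finally show ?thesis .
  qed
  have d_m: "d m = moore m"
  proof -
    have "fun_mat (Suc m) (\<lambda>i j. if j = m then (if i = m then 1 else 0) else ?x j ^ (?q ^ i))
      = four_block_mat (fun_mat m (\<lambda>i j. ?x j ^ (?q ^ i))) (0\<^sub>m m 1)
          (mat 1 m (\<lambda>(i, j). ?x j ^ (?q ^ m))) (1\<^sub>m 1)"
      by (rule eq_matI) (auto simp: less_Suc_eq)
    then show ?thesis unfolding d_def moore_def
      by (simp add: det_four_block_mat_upper_right_zero[of _ m _ 1])
  qed
  \<comment> \<open>The expected roots: solving v = 0 for the last variable expresses it through the
    earlier ones.\<close>
  let ?A = "(\<lambda>v. ?x m - lin v) ` (line_reps n m :: 'a vec set)"
  have inj: "inj_on (\<lambda>v. ?x m - lin v) (line_reps n m :: 'a vec set)"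
  proof (rule inj_onI)
    fix u v :: "'a vec"
    assume uv: "u \<in> line_reps n m" "v \<in> line_reps n m" "?x m - lin u = ?x m - lin v"
    then have c: "u \<in> carrier_vec n" "v \<in> carrier_vec n" by (auto simp: line_reps_def)
    have "lin (u + (-1) \<cdot>\<^sub>v v) = 0"
      using uv(3) c by (simp add: lin_add lin_smult PConst.hom_uminus)
    then have *: "u + (-1) \<cdot>\<^sub>v v = 0\<^sub>v n"
      using c by (subst (asm) lin_eq_0_iff[of _ n]) auto
    have "u $ j = v $ j" if "j < n" for j
    proof -
      have "(u + (-1) \<cdot>\<^sub>v v) $ j = 0" unfolding * using that by simp
      then show ?thesis using c that by simp
    qed
    then show "u = v" using c by (intro eq_vecI) auto
  qed
  have root: "poly P a = 0" if "a \<in> ?A" for a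
  proof -
    from that obtain v where v: "a = ?x m - lin v" "v \<in> line_reps n m" by (rule imageE)
    have "lin v = (\<Sum>j<n. if j < m then PConst (v $ j) * ?x j else if j = m then ?x m else 0)"
      using v unfolding lin_def by (intro sum.cong) (auto simp: line_reps_def)
    also have "\<dots> = (\<Sum>j<Suc m. if j < m then PConst (v $ j) * ?x j else if j = m then ?x m else 0)"
      using m by (intro sum.mono_neutral_right) auto
    also have "\<dots> = (\<Sum>j<m. PConst (v $ j) * ?x j) + ?x m" by simp
    finally have a: "a = (\<Sum>j<m. PConst (- (v $ j)) * ?x j)"
      using v by (simp add: PConst.hom_uminus sum_negf)
    \<comment> \<open>The Frobenius power is additive and fixes the scalars, so at a root the last
      column is a combination of the earlier columns.\<close>
    have "a ^ (?q ^ i) = (\<Sum>j<m. PConst (- (v $ j)) * ?x j ^ (?q ^ i))" for i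
      unfolding a frobenius_sum by (simp add: power_mult_distrib PConst_power_card)
    then have "poly P a = (\<Sum>s<m. PConst (- (v $ s)) *
        det (fun_mat (Suc m) (\<lambda>i j. if j = m then ?x s ^ (?q ^ i) else ?x j ^ (?q ^ i))))"
      unfolding poly_P by (simp only:) (rule det_fun_mat_col_sum, simp)
    also have "\<dots> = 0"
    proof (intro sum.neutral ballI)
      fix s assume "s \<in> {..<m}"
      then have "det (fun_mat (Suc m) (\<lambda>i j. if j = m then ?x s ^ (?q ^ i) else ?x j ^ (?q ^ i))) = 0"
        by (intro det_fun_mat_eq_cols[of s _ m]) auto
      then show "PConst (- (v $ s)) *
        det (fun_mat (Suc m) (\<lambda>i j. if j = m then ?x s ^ (?q ^ i) else ?x j ^ (?q ^ i))) = 0" by simp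
    qed
    finally show ?thesis .
  qed
  have card_A: "card ?A = ?q ^ m" "finite ?A"
    using card_line_reps[OF m] by (simp_all add: card_image[OF inj])
  define R where "R = smult (d m) (\<Prod>a\<in>?A. [:- a, 1:])"
  have degprod: "degree (\<Prod>a\<in>?A. [:- a, 1:]) = ?q ^ m"
    using card_A by (subst degree_prod_eq_sum_degree) auto
  \<comment> \<open>Both polynomials have degree at most q^m, the same coefficient there, and equal
    values at q^m points.\<close>
  have "P = R"
  proof (rule poly_eqI_degree_lead_coeff[of _ "?q ^ m" _ ?A])
    show "degree P \<le> ?q ^ m"
      unfolding P_def using q
      by (intro degree_sum_le) (auto intro!: order.trans[OF degree_monom_le] power_increasing)
    show "degree R \<le> ?q ^ m"
      unfolding R_def using degprod degree_smult_le[of "d m" "\<Prod>a\<in>?A. [:- a, 1:]"] by simp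
    have "coeff P (?q ^ m) = (\<Sum>s<Suc m. if s = m then d m else 0)"
      unfolding P_def coeff_sum coeff_monom using q
      by (intro sum.cong refl) (auto simp: power_inject_exp)
    moreover have "lead_coeff (\<Prod>a\<in>?A. [:- a, 1:]) = 1"
      unfolding lead_coeff_prod by simp
    then have "coeff R (?q ^ m) = d m"
      unfolding R_def using degprod by simp
    ultimately show "coeff P (?q ^ m) = coeff R (?q ^ m)" by simp
    show "poly P a = poly R a" if "a \<in> ?A" for a
    proof -
      have "poly R a = 0"
        using that card_A unfolding R_def by (auto simp: poly_prod intro!: prod_zero)
      then show ?thesis using root[OF that] by simp
    qed
  qed (use card_A in simp)
  moreover have "moore (Suc m) = poly P (?x m)"
    unfolding poly_P moore_def by (intro arg_cong[where f = det] eq_matI) auto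
  \<comment> \<open>At the last variable itself, the factor of the root \<open>?x m - lin v\<close>
    is \<open>lin v\<close>.\<close>
  moreover have "poly R (?x m) = moore m * (\<Prod>v\<in>line_reps n m. lin v)"
    unfolding R_def d_m by (simp add: poly_prod prod.reindex[OF inj])
  ultimately show ?thesis by simp
qed

lemma moore_eq_prod: "(moore n :: 'a mpoly) = (\<Prod>v\<in>(\<Union>k<n. line_reps n k). lin v)"
proof -
  have "(moore m :: 'a mpoly) = (\<Prod>k<m. \<Prod>v\<in>line_reps n k. lin v)" if "m \<le> n" for m
    using that
  proof (induct m)
    case 0
    show ?case by (simp add: moore_def)
  qed (simp add: moore_Suc[of _ n] mult.commute)
  moreover have "(\<Prod>v\<in>(\<Union>k<n. line_reps n k :: 'a vec set). lin v) = (\<Prod>k<n. \<Prod>v\<in>line_reps n k. lin v)"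
  proof (rule prod.UNION_disjoint)
    show "\<forall>i\<in>{..<n}. \<forall>j\<in>{..<n}. i \<noteq> j \<longrightarrow> line_reps n i \<inter> (line_reps n j :: 'a vec set) = {}"
      by (force simp: line_reps_def neq_iff)
  qed (use card_line_reps in auto)
  ultimately show ?thesis by simp
qed

lemma line_reps_nonzero: "(v :: 'a vec) \<in> line_reps n k \<Longrightarrow> k < n \<Longrightarrow> lin v \<noteq> 0"
  using lin_eq_0_iff[of v n] by (auto simp: line_reps_def)

lemma moore_nonzero: "moore n \<noteq> (0 :: 'a mpoly)"
  using card_line_reps line_reps_nonzero by (auto simp: moore_eq_prod)

lemma moore_dvd:
  fixes f :: "'a mpoly"
  assumes f: "f \<in> Sym n"
    and elim: "\<And>k v. k < n \<Longrightarrow> v \<in> line_reps n k \<Longrightarrow> elim_var v k f = 0"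
  shows "\<exists>g\<in>Sym n. f = moore n * g"
  unfolding moore_eq_prod
\<comment> \<open>The normalising position must be a function of \<open>v\<close> alone; on
  \<open>line_reps n k\<close> this maximum is \<open>k\<close>.\<close>
proof (rule prod_lin_dvd[where lc = "\<lambda>v. Max {j. j < n \<and> v $ j \<noteq> 0}"])
  have lc: "Max {j. j < n \<and> v $ j \<noteq> 0} = k"
    if "k < n" "v \<in> line_reps n k" for k and v :: "'a vec"
    using that by (intro Max_eqI) (auto simp: line_reps_def not_less[symmetric])
  show "finite (\<Union>k<n. line_reps n k :: 'a vec set)" using card_line_reps by auto
  fix v :: "'a vec" assume "v \<in> (\<Union>k<n. line_reps n k)"
  then obtain k where k: "k < n" "v \<in> line_reps n k" by auto
  show "elim_var v (Max {j. j < n \<and> v $ j \<noteq> 0}) f = 0"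
    unfolding lc[OF k] by (rule elim[OF k])
  show "v \<in> carrier_vec n \<and> Max {j. j < n \<and> v $ j \<noteq> 0} < n \<and> v $ Max {j. j < n \<and> v $ j \<noteq> 0} = 1
    \<and> (\<forall>j<n. Max {j. j < n \<and> v $ j \<noteq> 0} < j \<longrightarrow> v $ j = 0)"
    unfolding lc[OF k] using k by (auto simp: line_reps_def)
qed (rule f)

end

section \<open>Parabolic subgroups and reflections\<close>

lemma offset_Suc: "k < length I \<Longrightarrow> offset I (Suc k) = offset I k + I ! k"
  by (simp add: offset_def take_Suc_conv_app_nth)

lemma offset_mono: "k \<le> l \<Longrightarrow> offset I k \<le> offset I l"
  unfolding offset_def by (metis le_add1 le_add_diff_inverse sum_list_append take_add)

lemma offset_length: "offset I (length I) = sum_list I"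
  by (simp add: offset_def)

lemma offset_add_less:
  assumes "k < length I" "a < I ! k"
  shows "offset I k + a < sum_list I"
  using assms offset_Suc[of k I] offset_mono[of "Suc k" "length I" I] by (simp add: offset_length)

lemma invertible_mat_kernel:
  assumes "invertible_mat A" "A \<in> carrier_mat m m" "u \<in> carrier_vec m" "A *\<^sub>v u = 0\<^sub>v m"
  shows "u = 0\<^sub>v m"
proof -
  obtain B where B: "B * A = 1\<^sub>m (dim_row B)" "A * B = 1\<^sub>m m"
    using assms by (auto simp: invertible_mat_def inverts_mat_def)
  have "dim_row B = m"
    using arg_cong[OF B(1), of dim_col] assms(2) by simp
  moreover have "dim_col B = m"
    using arg_cong[OF B(2), of dim_col] by simp
  ultimately have Bc: "B \<in> carrier_mat m m" by auto
  have "u = (B * A) *\<^sub>v u" using B(1) Bc assms(3) by auto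
  also have "\<dots> = B *\<^sub>v (A *\<^sub>v u)" by (rule assoc_mult_mat_vec[OF Bc assms(2,3)])
  also have "\<dots> = 0\<^sub>v m" using assms(4) Bc by auto
  finally show ?thesis .
qed

text \<open>Back substitution by blocks: if g v = 0, the last diagonal block forces the last block
  of v to vanish, then the one before it, and so on.\<close>

lemma parabolic_det_nonzero:
  fixes g :: "'a::field mat"
  assumes g: "g \<in> parabolic I"
  shows "det g \<noteq> 0"
proof
  let ?n = "sum_list I"
  have gc: "g \<in> carrier_mat ?n ?n"
    and below: "\<And>k l. k < length I \<Longrightarrow> l < k \<Longrightarrow> block I g k l = 0\<^sub>m (I ! k) (I ! l)"
    and diag: "\<And>k. k < length I \<Longrightarrow> invertible_mat (block I g k k)"
    using g by (auto simp: parabolic_def)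
  assume "det g = 0"
  then obtain v where v: "v \<in> carrier_vec ?n" "v \<noteq> 0\<^sub>v ?n" "g *\<^sub>v v = 0\<^sub>v ?n"
    using det_0_iff_vec_prod_zero_field[OF gc] by auto
  \<comment> \<open>The zero blocks are turned into a condition on entries: every column index below
    \<open>offset I k\<close> lies in some earlier block.\<close>
  have lower: "g $$ (offset I k + a, j) = 0"
    if k: "k < length I" "a < I ! k" and j: "j < offset I k" for k a j
  proof -
    have "\<exists>l<m. \<exists>b<I ! l. j = offset I l + b" if "m \<le> length I" "j < offset I m" for m
      using that
    proof (induct m)
      case 0
      then show ?case by (simp add: offset_def)
    next
      case (Suc m)
      show ?case
      proof (cases "j < offset I m")
        case True
        then show ?thesis using Suc less_Suc_eq by auto
      next
        case False
        then show ?thesis using Suc offset_Suc[of m I]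
          by (intro exI[of _ m] conjI exI[of _ "j - offset I m"]) auto
      qed
    qed
    then obtain l b where l: "l < k" "b < I ! l" "j = offset I l + b"
      using k j by (metis less_imp_le)
    have "block I g k l $$ (a, b) = 0" using below[OF k(1) l(1)] k l by simp
    then show ?thesis using k l by (simp add: block_def)
  qed
  \<comment> \<open>Here \<open>k\<close> counts the trailing blocks of \<open>v\<close> already
    known to vanish; in the rows of the next block, only the diagonal block of g then contributes to
    g v.\<close>
  have "\<forall>i<?n. offset I (length I - k) \<le> i \<longrightarrow> v $ i = 0" if "k \<le> length I" for k
    using that
  proof (induct k)
    case 0
    then show ?case by (simp add: offset_length)
  next
    case (Suc k')
    define k where "k = length I - Suc k'"
    have k: "k < length I" "length I - k' = Suc k" using Suc by (auto simp: k_def)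
    let ?m = "I ! k" and ?o = "offset I k"
    have IH: "v $ i = 0" if "i < ?n" "?o + ?m \<le> i" for i
      using Suc that k offset_Suc[OF k(1)] by auto
    have on: "?o + ?m \<le> ?n"
      using offset_Suc[OF k(1)] offset_mono[of "Suc k" "length I" I] k by (simp add: offset_length)
    define u where "u = vec ?m (\<lambda>b. v $ (?o + b))"
    have "block I g k k *\<^sub>v u = 0\<^sub>v ?m"
    proof (rule eq_vecI)
      fix a assume "a < dim_vec (0\<^sub>v ?m :: 'a vec)"
      then have a: "a < ?m" by simp
      have "(block I g k k *\<^sub>v u) $ a = (\<Sum>b<?m. g $$ (?o + a, ?o + b) * v $ (?o + b))"
        using a by (auto simp: block_def u_def scalar_prod_def atLeast0LessThan intro!: sum.cong)
      also have "\<dots> = (\<Sum>j\<in>{?o..<?o + ?m}. g $$ (?o + a, j) * v $ j)"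
        by (rule sum.reindex_bij_witness[of _ "\<lambda>j. j - ?o" "\<lambda>b. ?o + b"]) auto
      also have "\<dots> = (\<Sum>j<?n. g $$ (?o + a, j) * v $ j)"
        using on IH lower[OF k(1) a] by (intro sum.mono_neutral_left) (auto simp: not_le not_less)
      also have "\<dots> = (g *\<^sub>v v) $ (?o + a)"
        using gc v(1) on a by (auto simp: scalar_prod_def atLeast0LessThan intro!: sum.cong)
      also have "\<dots> = 0" using v(3) on a by simp
      finally show "(block I g k k *\<^sub>v u) $ a = 0\<^sub>v ?m $ a" using a by simp
    qed (simp add: block_def)
    then have u: "u = 0\<^sub>v ?m"
      by (rule invertible_mat_kernel[OF diag[OF k(1)], rotated -1]) (auto simp: block_def u_def)
    show ?case
    proof (intro allI impI)
      fix i assume i: "i < ?n" "offset I (length I - Suc k') \<le> i"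
      show "v $ i = 0"
      proof (cases "?o + ?m \<le> i")
        case False
        with i have "i - ?o < ?m" "?o + (i - ?o) = i" by (auto simp: k_def)
        moreover have "u $ (i - ?o) = 0" using u \<open>i - ?o < ?m\<close> by simp
        ultimately show ?thesis by (simp add: u_def)
      qed (use IH i in simp)
    qed
  qed
  from this[of "length I"] have "v $ i = 0" if "i < ?n" for i
    using that by (auto simp: offset_def)
  then have "v = 0\<^sub>v ?n" using v(1) by (intro eq_vecI) auto
  with v(2) show False by simp
qed

lemma parabolic_GL: "g \<in> parabolic I \<Longrightarrow> g \<in> carrier (GL (sum_list I))"
  using parabolic_det_nonzero[of g I] det_non_zero_imp_unit[of g "sum_list I" "()"]
  by (auto simp: GL_def units_of_carrier parabolic_def)

lemma GL_inv:
  fixes g :: "'a::field mat"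
  assumes "g \<in> carrier (GL n)"
  shows "g \<in> carrier_mat n n" "inv\<^bsub>GL n\<^esub> g \<in> carrier_mat n n"
    "inv\<^bsub>GL n\<^esub> g * g = 1\<^sub>m n" "g * inv\<^bsub>GL n\<^esub> g = 1\<^sub>m n"
proof -
  interpret R: ring "ring_mat TYPE('a) n ()" by (rule ring_mat)
  have g: "g \<in> Units (ring_mat TYPE('a) n ())"
    using assms by (simp add: GL_def units_of_carrier)
  note eq = R.units_of_inv[OF g, folded GL_def]
  show "g \<in> carrier_mat n n" "inv\<^bsub>GL n\<^esub> g \<in> carrier_mat n n"
    "inv\<^bsub>GL n\<^esub> g * g = 1\<^sub>m n" "g * inv\<^bsub>GL n\<^esub> g = 1\<^sub>m n"
    unfolding eq using R.Units_closed[OF g] R.Units_inv_closed[OF g] R.Units_l_inv[OF g]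
      R.Units_r_inv[OF g] by (simp_all add: ring_mat_simps)
qed

lemma GL_inv_vec:
  assumes g: "g \<in> carrier (GL n)" and v: "v \<in> carrier_vec n"
  shows "inv\<^bsub>GL n\<^esub> g *\<^sub>v (g *\<^sub>v v) = v" "g *\<^sub>v (inv\<^bsub>GL n\<^esub> g *\<^sub>v v) = v"
    "inv\<^bsub>GL n\<^esub> g *\<^sub>v v \<in> carrier_vec n"
  using GL_inv[OF g] v by (simp_all flip: assoc_mult_mat_vec[of _ n n _ n])

section \<open>The group action on products of forms\<close>

lemma act_form_apply:
  "set vs \<subseteq> carrier_vec n \<Longrightarrow>
    act_form n g \<alpha> vs = act_poly g (\<alpha> (map (\<lambda>v. inv\<^bsub>GL n\<^esub> g *\<^sub>v v) vs))"
  by (simp add: act_form_def)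

text \<open>The inverse matrix acts on the arguments one by one and \<open>act_poly g\<close> is a
  ring homomorphism, so both pass through the shuffle sum once the shuffled indices are known to
  stay in range.\<close>

lemma act_form_wedge:
  assumes vs: "set vs \<subseteq> carrier_vec n"
  shows "act_form n g (wedge \<alpha> \<beta>) vs = wedge (act_form n g \<alpha>) (act_form n g \<beta>) vs"
proof -
  let ?h = "\<lambda>v. inv\<^bsub>GL n\<^esub> g *\<^sub>v v"
  have sub: "map (\<lambda>i. map ?h vs ! \<sigma> i) js = map ?h (map (\<lambda>i. vs ! \<sigma> i) js)"
      "set (map (\<lambda>i. vs ! \<sigma> i) js) \<subseteq> carrier_vec n"
    if "\<sigma> \<in> shuffles_of m (length vs - m)" "m \<le> length vs" "set js \<subseteq> {..<length vs}" for \<sigma> m js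
  proof -
    have \<sigma>: "\<sigma> i < length vs" if "i < length vs" for i
      using shuffle_permutes[OF \<open>\<sigma> \<in> _\<close>] permutes_in_image[of \<sigma> "{..<length vs}" i] \<open>m \<le> _\<close> that
      by simp
    then have "vs ! \<sigma> i \<in> carrier_vec n" if "i < length vs" for i
      using vs that by (meson nth_mem subsetD)
    with \<sigma> show "map (\<lambda>i. map ?h vs ! \<sigma> i) js = map ?h (map (\<lambda>i. vs ! \<sigma> i) js)"
      "set (map (\<lambda>i. vs ! \<sigma> i) js) \<subseteq> carrier_vec n"
      using that(3) by auto
  qed
  show ?thesis
    unfolding act_form_apply[OF vs] wedge_def act_poly.hom_sum length_map
  proof (intro sum.cong refl)
    fix m \<sigma> assume m: "m \<in> {..length vs}" and \<sigma>: "\<sigma> \<in> shuffles_of m (length vs - m)"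
    have 1: "set [0..<m] \<subseteq> {..<length vs}" "set [m..<length vs] \<subseteq> {..<length vs}" "m \<le> length vs"
      using m by auto
    note s1 = sub[OF \<sigma> 1(3) 1(1)] and s2 = sub[OF \<sigma> 1(3) 1(2)]
    show "act_poly g (of_int (sign \<sigma>) * \<alpha> (map (\<lambda>i. map ?h vs ! \<sigma> i) [0..<m])
        * \<beta> (map (\<lambda>i. map ?h vs ! \<sigma> i) [m..<length vs]))
      = of_int (sign \<sigma>) * act_form n g \<alpha> (map (\<lambda>i. vs ! \<sigma> i) [0..<m])
        * act_form n g \<beta> (map (\<lambda>i. vs ! \<sigma> i) [m..<length vs])"
      unfolding s1(1) s2(1) act_form_apply[OF s1(2)] act_form_apply[OF s2(2)]
      by (simp add: act_poly.hom_mult act_poly.hom_of_int)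
  qed
qed

lemma alt_prod_outside:
  assumes "set \<phi>s \<subseteq> Vdual n" "\<not> set vs \<subseteq> carrier_vec n"
  shows "alt_prod \<phi>s vs = 0"
  using Hom_ext_outside[OF alt_prod_Hom_ext[OF assms(1)]] assms(2) by blast

context
  fixes p r :: nat
  assumes p: "prime p" and card: "CARD('a::{finite,field}) = p ^ r"
begin

lemmas omega_functional_V = omega_functional_Vdual[OF p card]

lemma set_omega_functional: "set (map (omega_functional n) js) \<subseteq> (Vdual n :: ('a vec \<Rightarrow> 'a mpoly) set)"
  using omega_functional_V by auto

text \<open>A ring automorphism commutes with taking q^i-th powers, which makes each \<omega>_i
  equivariant; it also commutes with determinants.\<close>

lemma act_form_alt_prod_omega_functional:
  assumes g: "g \<in> carrier (GL n)"
  shows "act_form n g (alt_prod (map (omega_functional n) js)) = (alt_prod (map (omega_functional n) js) :: 'a form)"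
proof
  fix vs :: "'a vec list"
  show "act_form n g (alt_prod (map (omega_functional n) js)) vs = alt_prod (map (omega_functional n) js) vs"
  proof (cases "set vs \<subseteq> carrier_vec n")
    case True
    have "act_poly g (omega_functional n i (inv\<^bsub>GL n\<^esub> g *\<^sub>v v)) = omega_functional n i v" if "v \<in> carrier_vec n" for i and v :: "'a vec"
      using GL_inv_vec[OF g that] that
      by (simp add: omega_functional_def act_poly.hom_power act_poly_lin[OF GL_inv(1)[OF g]])
    moreover have "vs ! j \<in> carrier_vec n" if "j < length vs" for j
      using True that by auto
    ultimately have "map_mat (act_poly g) (fun_mat (length js) (\<lambda>i j. (map (omega_functional n) js ! i)
        (map (\<lambda>v. inv\<^bsub>GL n\<^esub> g *\<^sub>v v) vs ! j))) = fun_mat (length js) (\<lambda>i j. (map (omega_functional n) js ! i) (vs ! j))"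
      if "length vs = length js"
      using that by (intro eq_matI) auto
    then show ?thesis
      unfolding act_form_apply[OF True] alt_prod_def by (auto simp flip: act_poly.hom_det)
  next
    case False
    then show ?thesis using alt_prod_outside[OF set_omega_functional False] by (simp add: act_form_def)
  qed
qed

text \<open>The products of the \<omega>_i being fixed, g acts on the coefficients alone.\<close>

lemma act_form_omega_functional_comb:
  assumes g: "g \<in> carrier (GL n)"
  shows "act_form n g (\<lambda>vs. \<Sum>J\<in>Pow {..<n}. f J * alt_prod (family_list (omega_functional n) J) vs)
    = (\<lambda>vs. \<Sum>J\<in>Pow {..<n}. act_poly g (f J) * alt_prod (family_list (omega_functional n) J) vs :: 'a mpoly)"
proof
  fix vs :: "'a vec list"
  show "act_form n g (\<lambda>vs. \<Sum>J\<in>Pow {..<n}. f J * alt_prod (family_list (omega_functional n) J) vs) vs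
    = (\<Sum>J\<in>Pow {..<n}. act_poly g (f J) * alt_prod (family_list (omega_functional n) J) vs)"
  proof (cases "set vs \<subseteq> carrier_vec n")
    case True
    have "act_poly g (alt_prod (family_list (omega_functional n) J) (map (\<lambda>v. inv\<^bsub>GL n\<^esub> g *\<^sub>v v) vs)) = alt_prod (family_list (omega_functional n) J) vs" for J
      using fun_cong[OF act_form_alt_prod_omega_functional[OF g, of "sorted_list_of_set J"], of vs]
      unfolding act_form_apply[OF True] by (simp add: family_list_def)
    then show ?thesis
      unfolding act_form_apply[OF True] by (simp add: act_poly.hom_sum act_poly.hom_mult)
  next
    case False
    then have "alt_prod (family_list (omega_functional n) J) vs = 0" for J
      unfolding family_list_def by (rule alt_prod_outside[OF set_omega_functional])
    then show ?thesis using False by (simp add: act_form_def)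
  qed
qed

end

text \<open>
  The reflection multiplying \<open>v\<close> by \<open>c\<close> and fixing the basis vectors other than \<open>x\<^sub>k\<close>; it is upper
  triangular when \<open>k\<close> is the last nonzero coordinate of \<open>v\<close>.
\<close>
definition reflection :: "nat \<Rightarrow> nat \<Rightarrow> 'a::field \<Rightarrow> 'a vec \<Rightarrow> 'a mat" where
  "reflection n k c v = fun_mat n (\<lambda>i j. (if i = j then 1 else 0) + (if j = k then (c - 1) * v $ i else 0))"

text \<open>The diagonal entries are 1 except for \<open>c\<close> in position \<open>k\<close>,
  since \<open>v $ k = 1\<close>. So each diagonal block is triangular with nonzero determinant,
  whatever the composition.\<close>

lemma reflection_parabolic:
  assumes I: "sum_list I = n" and k: "k < n" and v: "v \<in> line_reps n k" and c: "c \<noteq> 0"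
  shows "reflection n k c v \<in> parabolic I"
proof -
  let ?g = "reflection n k c v"
  have low: "?g $$ (i, j) = 0" if "i < n" "j < i" for i j
    using that v by (auto simp: reflection_def line_reps_def)
  have dg: "?g $$ (i, i) \<noteq> 0" if "i < n" for i
    using that v c by (auto simp: reflection_def line_reps_def)
  have "block I ?g l m = 0\<^sub>m (I ! l) (I ! m)" if lm: "l < length I" "m < l" for l m
  proof (rule eq_matI)
    fix a b assume "a < dim_row (0\<^sub>m (I ! l) (I ! m) :: 'a mat)" "b < dim_col (0\<^sub>m (I ! l) (I ! m) :: 'a mat)"
    then have ab: "a < I ! l" "b < I ! m" by auto
    have "offset I m + b < offset I l"
      using lm ab offset_Suc[of m I] offset_mono[of "Suc m" l I] by simp
    then have "?g $$ (offset I l + a, offset I m + b) = 0"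
      using offset_add_less[OF lm(1) ab(1)] I by (intro low) auto
    then show "block I ?g l m $$ (a, b) = 0\<^sub>m (I ! l) (I ! m) $$ (a, b)"
      using ab by (simp add: block_def)
  qed (auto simp: block_def)
  moreover have "invertible_mat (block I ?g l l)" if l: "l < length I" for l
  proof -
    let ?B = "block I ?g l l" and ?m = "I ! l"
    have Bc: "?B \<in> carrier_mat ?m ?m" by (simp add: block_def)
    have off: "offset I l + a < n" if "a < ?m" for a
      using offset_add_less[OF l that] I by simp
    have "upper_triangular ?B"
      using off by (auto simp: upper_triangular_def block_def intro!: low)
    then have "det ?B = prod_list (diag_mat ?B)" by (rule det_upper_triangular[OF _ Bc])
    also have "\<dots> \<noteq> 0"
      using off dg by (auto simp: prod_list_zero_iff diag_mat_def block_def)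
    finally have "?B \<in> Units (ring_mat TYPE('a) ?m ())" by (rule det_non_zero_imp_unit[OF Bc])
    then show ?thesis
      using Bc by (auto simp: Units_def ring_mat_simps invertible_mat_def inverts_mat_def)
  qed
  ultimately show ?thesis
    using I by (auto simp: parabolic_def reflection_def)
qed

lemma reflection_unit:
  assumes "v \<in> carrier_vec n" "k < n" "j < n"
  shows "reflection n k c v *\<^sub>v unit_vec n j = (if j = k then unit_vec n k + (c - 1) \<cdot>\<^sub>v v else unit_vec n j)"
    "col (reflection n k c v) j = (if j = k then unit_vec n k + (c - 1) \<cdot>\<^sub>v v else unit_vec n j)"
  using assms by (auto simp: reflection_def intro!: eq_vecI)

lemma reflection_vec:
  assumes v: "v \<in> line_reps n k" and k: "k < n"
  shows "reflection n k c v *\<^sub>v v = c \<cdot>\<^sub>v v"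
proof (rule eq_vecI)
  have vc: "v \<in> carrier_vec n" "v $ k = 1" using v by (auto simp: line_reps_def)
  fix i assume "i < dim_vec (c \<cdot>\<^sub>v v)"
  then have i: "i < n" using vc by auto
  have "(reflection n k c v *\<^sub>v v) $ i
      = (\<Sum>j<n. (if j = i then v $ i else 0) + (if j = k then (c - 1) * v $ i else 0))"
    using vc i by (auto simp: reflection_def scalar_prod_def atLeast0LessThan algebra_simps intro!: sum.cong)
  also have "\<dots> = c * v $ i"
    using i k by (simp add: sum.distrib algebra_simps)
  finally show "(reflection n k c v *\<^sub>v v) $ i = (c \<cdot>\<^sub>v v) $ i" using i vc by simp
qed (use v in \<open>auto simp: reflection_def line_reps_def\<close>)

text \<open>Both sides are evaluations of \<open>f\<close>, and they agree on variables: only the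
  variable number \<open>k\<close> moves, by (c - 1) v, and \<open>v\<close> is eliminated to
  0.\<close>

lemma elim_var_reflection:
  assumes v: "v \<in> line_reps n k" and k: "k < n" and f: "f \<in> Sym n"
  shows "elim_var v k (act_poly (reflection n k c v) f) = elim_var v k f"
proof -
  have vc: "v \<in> carrier_vec n" "v $ k = 1" using v by (auto simp: line_reps_def)
  have "elim_var v k (act_poly (reflection n k c v) f)
    = eval_mpoly (elim_var v k \<circ> PConst) (elim_var v k \<circ> (\<lambda>j. lin (col (reflection n k c v) j))) f"
    unfolding act_poly_eq_eval_mpoly by (rule hom_eval_mpoly) (rule elim_var.comm_ring_hom_axioms)
  also have "\<dots> = eval_mpoly PConst (elim_var v k \<circ> (\<lambda>j. lin (col (reflection n k c v) j))) f"
    by (simp add: comp_def)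
  also have "\<dots> = eval_mpoly PConst (\<lambda>j. if j = k then PVar k - lin v else PVar j) f"
  proof (rule eval_mpoly_cong_Sym[OF f])
    fix j assume j: "j < n"
    show "(elim_var v k \<circ> (\<lambda>j. lin (col (reflection n k c v) j))) j
      = (if j = k then PVar k - lin v else PVar j)"
      using j vc k elim_var_lin[OF vc(1) k, of v]
      by (auto simp: reflection_unit lin_add[of _ n] lin_smult elim_var.hom_add elim_var.hom_mult)
  qed
  finally show ?thesis by (simp add: elim_var_def)
qed

text \<open>Invariance is evaluated on the basis with entry \<open>k\<close> replaced by
  \<open>v\<close>. This does not change the value h of \<theta>, and the inverse reflection merely
  scales that entry by 1/c. Hence (1/c) times the image of h equals h, and modulo \<open>v\<close>
  this reads (1/c - 1) h = 0.\<close>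

lemma Hom_ext_top_vanish:
  fixes \<theta> :: "'a::field form"
  assumes \<theta>: "\<theta> \<in> Hom_ext n n" and v: "v \<in> line_reps n k" and k: "k < n" and c: "c \<noteq> 0" "c \<noteq> 1"
    and g: "reflection n k c v \<in> carrier (GL n)"
    and inv: "\<And>vs. length vs = n \<Longrightarrow> set vs \<subseteq> carrier_vec n \<Longrightarrow>
      act_form n (reflection n k c v) \<theta> vs = \<theta> vs"
  shows "elim_var v k (\<theta> (std_basis n)) = 0"
proof -
  let ?g = "reflection n k c v" and ?e = "std_basis n :: 'a vec list" and ?h = "\<theta> (std_basis n)"
  let ?gi = "inv\<^bsub>GL n\<^esub> ?g"
  have vc: "v \<in> carrier_vec n" "v $ k = 1" using v by (auto simp: line_reps_def)
  have e: "length ?e = n" "set ?e \<subseteq> carrier_vec n" "\<And>j. j < n \<Longrightarrow> ?e ! j = unit_vec n j"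
    by (auto simp: std_basis_def)
  have ek: "?e[k := unit_vec n k] = ?e" using e k by (metis list_update_id)
  \<comment> \<open>When \<open>v\<close> is expanded, each basis vector other than number
    \<open>k\<close> already occurs elsewhere in the list.\<close>
  have ev: "\<theta> (?e[k := v]) = ?h"
  proof -
    have "\<theta> (?e[k := v]) = (\<Sum>j<n. PConst (v $ j) * \<theta> (?e[k := unit_vec n j]))"
      by (rule Hom_ext_expand_arg[OF \<theta> e(1,2) k vc(1)])
    also have "\<dots> = (\<Sum>j<n. if j = k then ?h else 0)"
    proof (intro sum.cong refl)
      fix j assume "j \<in> {..<n}"
      then have j: "j < n" by simp
      show "PConst (v $ j) * \<theta> (?e[k := unit_vec n j]) = (if j = k then ?h else 0)"
      proof (cases "j = k")
        case True
        then show ?thesis using vc ek by simp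
      next
        case False
        have "set (?e[k := unit_vec n j]) \<subseteq> carrier_vec n"
          using e(2) set_update_subset_insert[of ?e k "unit_vec n j"] by auto
        then have "\<theta> (?e[k := unit_vec n j]) = 0"
          using e j k False by (intro Hom_ext_alternating[OF \<theta>, of _ j k]) auto
        then show ?thesis using False by simp
      qed
    qed
    finally show ?thesis using k by simp
  qed
  have gi_e: "?gi *\<^sub>v unit_vec n j = unit_vec n j" if "j < n" "j \<noteq> k" for j
    using GL_inv_vec(1)[OF g, of "unit_vec n j"] reflection_unit(1)[OF vc(1) k that(1), of c] that by simp
  have gi_v: "?gi *\<^sub>v v = inverse c \<cdot>\<^sub>v v"
  proof -
    have "v = ?gi *\<^sub>v (c \<cdot>\<^sub>v v)"
      using GL_inv_vec(1)[OF g vc(1)] reflection_vec[OF v k, of c] by simp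
    also have "\<dots> = c \<cdot>\<^sub>v (?gi *\<^sub>v v)"
      by (rule mult_mat_vec[OF GL_inv(2)[OF g] vc(1)])
    finally have "inverse c \<cdot>\<^sub>v v = inverse c \<cdot>\<^sub>v (c \<cdot>\<^sub>v (?gi *\<^sub>v v))" by simp
    then show ?thesis using c GL_inv_vec(3)[OF g vc(1)] by (simp add: smult_smult_assoc)
  qed
  have sub: "set (?e[k := v]) \<subseteq> carrier_vec n"
    using e(2) vc set_update_subset_insert[of ?e k v] by auto
  have "map (\<lambda>u. ?gi *\<^sub>v u) (?e[k := v]) = ?e[k := inverse c \<cdot>\<^sub>v v]"
    using e k gi_e gi_v by (intro nth_equalityI) (auto simp: nth_list_update)
  then have "act_poly ?g (\<theta> (?e[k := inverse c \<cdot>\<^sub>v v])) = \<theta> (?e[k := v])"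
    using inv[OF _ sub] act_form_apply[OF sub, of ?g \<theta>] e by simp
  moreover have "\<theta> (?e[k := inverse c \<cdot>\<^sub>v v]) = PConst (inverse c) * ?h"
    using Hom_ext_smult_arg[OF \<theta> e(1,2) k vc(1)] ev by simp
  ultimately have "PConst (inverse c) * act_poly ?g ?h = ?h"
    using ev by (simp add: act_poly.hom_mult)
  then have "elim_var v k (PConst (inverse c) * act_poly ?g ?h) = elim_var v k ?h" by simp
  then have "PConst (inverse c) * elim_var v k ?h = elim_var v k ?h"
    using elim_var_reflection[OF v k Hom_ext_Sym[OF \<theta>]] by (simp add: elim_var.hom_mult)
  then have "PConst (inverse c - 1) * elim_var v k ?h = 0"
    by (simp add: PConst.hom_minus algebra_simps)
  then show ?thesis using c by (simp add: field_simps)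
qed

lemma component_alt_prod: "component m (alt_prod \<phi>s) = (if m = length \<phi>s then alt_prod \<phi>s else (\<lambda>_. 0))"
  by (auto simp: component_def alt_prod_def)

text \<open>Since \<alpha> may mix exterior degrees, the product is cut down to one of them. The
  coordinate expansion of \<alpha> makes it a combination of determinants, which are known to be
  alternating and multilinear.\<close>

lemma component_wedge_Hom_ext:
  assumes \<alpha>: "\<alpha> \<in> Forms n" and w: "\<And>i. i < n \<Longrightarrow> w i \<in> Vdual n" and K: "K \<subseteq> {..<n}"
  shows "component m (wedge \<alpha> (alt_prod (family_list w K))) \<in> Hom_ext n m"
proof -
  let ?c = "\<lambda>J. \<alpha> (map (unit_vec n) (sorted_list_of_set J))"
  have eq: "wedge \<alpha> (alt_prod (family_list w K)) = (\<lambda>vs. \<Sum>J\<in>Pow {..<n}. ?c J * alt_prod (family_list (coord_functional n) J @ family_list w K) vs)"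
    by (subst Forms_expand[OF \<alpha>]) (simp add: wedge_sum_left wedge_alt_prod)
  have H: "component m (alt_prod (family_list (coord_functional n) J @ family_list w K)) \<in> Hom_ext n m" if J: "J \<subseteq> {..<n}" for J
  proof -
    have "alt_prod (family_list (coord_functional n) J @ family_list w K) \<in> Hom_ext n (length (family_list (coord_functional n) J @ family_list w K))"
      using J K w by (intro alt_prod_Hom_ext) (auto simp: set_family_list subset_eq intro!: coord_functional_Vdual)
    then show ?thesis unfolding component_alt_prod by (auto simp: Hom_ext_0)
  qed
  have sum: "component m (\<lambda>vs. \<Sum>J\<in>S. ?c J * alt_prod (family_list (coord_functional n) J @ family_list w K) vs) \<in> Hom_ext n m"
    if "finite S" "S \<subseteq> Pow {..<n}" for S
    using that
    by (induct S rule: finite_induct)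
      (auto simp: component_simps Hom_ext_0 intro!: Hom_ext_add Hom_ext_smult H Forms_Sym[OF \<alpha>])
  show ?thesis unfolding eq by (rule sum) auto
qed

section \<open>Decomposition of invariant forms\<close>

text \<open>A right factor of degree 0 receives no arguments, which leaves the identity as the only
  shuffle.\<close>

lemma wedge_scalar_form: "wedge w (scalar_form f) = (\<lambda>vs. w vs * f)"
proof
  fix vs :: "'a vec list"
  let ?N = "length vs"
  have sh: "shuffles_of ?N 0 = {id}"
  proof -
    have "\<sigma> = id" if "\<sigma> \<in> shuffles_of ?N 0" for \<sigma>
    proof -
      have *: "\<exists>!\<tau>. \<tau> \<in> shuffles_of ?N 0 \<and> \<tau> ` {..<?N} = {..<?N}"
        by (rule ex1_shuffle) auto
      have \<sigma>: "\<sigma> ` {..<?N} = {..<?N}"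
        using permutes_image[OF shuffle_permutes[OF that]] by simp
      have id: "id \<in> shuffles_of ?N 0"
        by (auto simp: shuffles_of_def strict_mono_on_def)
      obtain \<tau> where \<tau>: "\<forall>\<rho>. \<rho> \<in> shuffles_of ?N 0 \<and> \<rho> ` {..<?N} = {..<?N} \<longrightarrow> \<rho> = \<tau>"
        using * by (rule ex1E)
      have "\<sigma> = \<tau>" using \<tau> that \<sigma> by blast
      moreover have "id = \<tau>"
        by (rule \<tau>[THEN spec, THEN mp]) (simp add: id)
      ultimately show ?thesis by simp
    qed
    then show ?thesis by (auto simp: shuffles_of_def strict_mono_on_def)
  qed
  have "wedge w (scalar_form f) vs = (\<Sum>m\<le>?N. if m = ?N then w vs * f else 0)"
    unfolding wedge_def
  proof (intro sum.cong refl)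
    fix m assume m: "m \<in> {..?N}"
    show "(\<Sum>\<sigma>\<in>shuffles_of m (?N - m). of_int (sign \<sigma>) * w (map (\<lambda>i. vs ! \<sigma> i) [0..<m])
        * scalar_form f (map (\<lambda>i. vs ! \<sigma> i) [m..<?N])) = (if m = ?N then w vs * f else 0)"
    proof (cases "m = ?N")
      case True
      then show ?thesis by (simp add: sh scalar_form_def map_nth sign_id)
    next
      case False
      then show ?thesis using m by (auto simp: scalar_form_def intro!: sum.neutral)
    qed
  qed
  then show "wedge w (scalar_form f) vs = w vs * f" by simp
qed

lemma alt_prod_length: "length vs \<noteq> length \<phi>s \<Longrightarrow> alt_prod \<phi>s vs = 0"
  by (simp add: alt_prod_def)

lemma alt_prod_Nil: "alt_prod [] = scalar_form 1"
  by (rule ext) (auto simp: alt_prod_def scalar_form_def)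

text \<open>The polynomial degree of \<omega>_J, each \<omega>_j having degree q^j.\<close>

definition omega_degree :: "'a::finite itself \<Rightarrow> nat set \<Rightarrow> nat" where
  "omega_degree _ J = (\<Sum>j\<in>J. CARD('a) ^ j)"

abbreviation omega_prod :: "nat \<Rightarrow> nat set \<Rightarrow> 'a::{finite,field} form" where
  "omega_prod n J \<equiv> alt_prod (family_list (omega_functional n) J)"

lemma omega_eq_alt_prod: "omega n i = alt_prod [omega_functional n i]"
proof
  fix vs :: "'a vec list"
  show "omega n i vs = alt_prod [omega_functional n i] vs"
  proof (cases "\<exists>v. vs = [v]")
    case True
    then show ?thesis by (auto simp: omega_def alt_prod_def omega_functional_def det_single)
  next
    case False
    then have "length vs \<noteq> 1" by (auto simp: length_Suc_conv)
    with False show ?thesis by (auto simp: omega_def alt_prod_def split: list.splits)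
  qed
qed

lemma alt_prod_omega_functional_homogeneous:
  fixes vs :: "'a::{finite,field} vec list"
  shows "alt_prod (map (omega_functional n) js) vs \<in> homogeneous (\<Sum>j\<leftarrow>js. CARD('a) ^ j)"
proof (cases "length vs = length js")
  case True
  have omega_functional: "omega_functional n i v \<in> homogeneous (CARD('a) ^ i)" for i and v :: "'a vec"
    using homogeneous_power[OF homogeneous_lin, of v "CARD('a) ^ i"] by (simp add: omega_functional_def)
  have eq: "alt_prod (map (omega_functional n) js) vs = (\<Sum>p | p permutes {..<length js}.
      of_int (sign p) * (\<Prod>i<length js. (map (omega_functional n) js ! i) (vs ! p i)))"
    using True by (simp add: alt_prod_def det_fun_mat)
  have "(\<Prod>i<length js. (map (omega_functional n) js ! i) (vs ! p i))
      \<in> homogeneous (\<Sum>i<length js. CARD('a) ^ (js ! i))" for p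
    by (rule homogeneous_prod) (simp add: omega_functional)
  moreover have "(\<Sum>i<length js. CARD('a) ^ (js ! i)) = (\<Sum>j\<leftarrow>js. CARD('a) ^ j)"
    by (simp add: sum_list_sum_nth atLeast0LessThan)
  ultimately show ?thesis unfolding eq
    using homogeneous_mult[OF homogeneous_of_int] by (intro homogeneous_sum) fastforce
qed (simp add: alt_prod_def)

lemma omega_prod_homogeneous:
  fixes vs :: "'a::{finite,field} vec list"
  shows "omega_prod n J vs \<in> homogeneous (omega_degree TYPE('a) J)"
proof (cases "finite J")
  case True
  then have "(\<Sum>j\<leftarrow>sorted_list_of_set J. CARD('a) ^ j) = omega_degree TYPE('a) J"
    by (simp add: omega_degree_def sum_list_distinct_conv_sum_set)
  then show ?thesis using alt_prod_omega_functional_homogeneous[of n "sorted_list_of_set J" vs] by (simp add: family_list_def)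
next
  case False
  then show ?thesis
    using alt_prod_omega_functional_homogeneous[of n "[]" vs] by (simp add: family_list_def omega_degree_def)
qed

lemma sym_inv_carrier:
  "f \<in> carrier (sym_inv n P) \<longleftrightarrow> f \<in> Sym n \<and> (\<forall>g\<in>P. act_poly g f = f)"
  by (simp add: sym_inv_def)

lemma forms_inv_carrier:
  "\<alpha> \<in> carrier (forms_inv n P) \<longleftrightarrow> \<alpha> \<in> Forms n \<and> (\<forall>g\<in>P. act_form n g \<alpha> = \<alpha>)"
  by (simp add: forms_inv_def)

context
  fixes p r :: nat
  assumes p: "prime p" and card: "CARD('a::{finite,field}) = p ^ r"
begin

lemma omega_prod_Forms: "J \<subseteq> {..<n} \<Longrightarrow> omega_prod n J \<in> (Forms n :: 'a form set)"
  by (rule alt_prod_family_list_Forms) (use omega_functional_Vdual[OF p card] in auto)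

lemma omega_prod_top_nonzero: "alt_prod (map (omega_functional n) [0..<n]) (std_basis n :: 'a vec list) \<noteq> 0"
  unfolding alt_prod_omega_functional_top[OF p card] by (rule moore_nonzero[OF p card])

lemma omega_prod_independent:
  fixes f :: "nat set \<Rightarrow> 'a mpoly"
  assumes "\<And>vs. (\<Sum>J\<in>Pow {..<n}. f J * omega_prod n J vs) = (\<Sum>J\<in>Pow {..<n}. f' J * omega_prod n J vs)"
    and "J \<subseteq> {..<n}"
  shows "f J = f' J"
proof -
  have "(\<lambda>J. f J - f' J) J = 0"
  proof (rule alt_prod_family_list_independent[OF omega_prod_top_nonzero _ assms(2)])
    fix vs :: "'a vec list"
    show "(\<Sum>J\<in>Pow {..<n}. (f J - f' J) * omega_prod n J vs) = 0"
      using assms(1)[of vs] by (simp add: algebra_simps sum_subtractf)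
  qed
  then show ?thesis by simp
qed

lemma forms_inv_decompose:
  fixes \<alpha> :: "'a form"
  assumes I: "sum_list I = n" and q: "CARD('a) \<noteq> 2"
    and \<alpha>: "\<alpha> \<in> carrier (forms_inv n (parabolic I))"
  obtains f where "\<And>J. J \<subseteq> {..<n} \<Longrightarrow> f J \<in> carrier (sym_inv n (parabolic I))"
    "\<alpha> = (\<lambda>vs. \<Sum>J\<in>Pow {..<n}. f J * omega_prod n J vs)"
proof -
  have GL: "g \<in> carrier (GL n)" if "g \<in> parabolic I" for g :: "'a mat"
    using parabolic_GL[OF that] I by simp
  have \<alpha>F: "\<alpha> \<in> Forms n" and inv: "\<And>g. g \<in> parabolic I \<Longrightarrow> act_form n g \<alpha> = \<alpha>"
    using \<alpha> by (auto simp: forms_inv_carrier)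
  \<comment> \<open>Here q \<noteq> 2 enters: a field with more than two elements has a scalar
    besides 0 and 1.\<close>
  obtain c :: 'a where c: "c \<noteq> 0" "c \<noteq> 1"
  proof (rule ccontr)
    assume "\<not> thesis"
    with that have "(UNIV :: 'a set) = {0, 1}" by auto
    then have "CARD('a) = card {0, 1 :: 'a}" by simp
    with q show False by simp
  qed
  have "\<exists>g\<in>Sym n. wedge \<alpha> (omega_prod n K) (std_basis n) = moore n * g" if K: "K \<subseteq> {..<n}" for K
  proof -
    define \<theta> where "\<theta> = component n (wedge \<alpha> (omega_prod n K))"
    have \<theta>: "\<theta> \<in> Hom_ext n n"
      unfolding \<theta>_def using omega_functional_Vdual[OF p card] by (intro component_wedge_Hom_ext \<alpha>F K) auto
    have top: "\<theta> (std_basis n) = wedge \<alpha> (omega_prod n K) (std_basis n)"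
      by (simp add: \<theta>_def component_def)
    have "elim_var v k (\<theta> (std_basis n)) = 0" if k: "k < n" and v: "v \<in> line_reps n k" for k v
    proof (rule Hom_ext_top_vanish[OF \<theta> v k c])
      let ?g = "reflection n k c v"
      have g: "?g \<in> parabolic I" by (rule reflection_parabolic[OF I k v c(1)])
      then show "?g \<in> carrier (GL n)" by (rule GL)
      fix vs :: "'a vec list" assume vs: "length vs = n" "set vs \<subseteq> carrier_vec n"
      have "act_form n ?g \<theta> vs = act_form n ?g (wedge \<alpha> (omega_prod n K)) vs"
        using vs by (simp add: act_form_apply \<theta>_def component_def)
      also have "\<dots> = wedge (act_form n ?g \<alpha>) (act_form n ?g (omega_prod n K)) vs"
        by (rule act_form_wedge[OF vs(2)])
      also have "\<dots> = wedge \<alpha> (omega_prod n K) vs"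
        using inv[OF g] act_form_alt_prod_omega_functional[OF p card GL[OF g], of "sorted_list_of_set K"]
        by (simp add: family_list_def)
      finally show "act_form n ?g \<theta> vs = \<theta> vs" using vs by (simp add: \<theta>_def component_def)
    qed
    then have "\<exists>g\<in>Sym n. \<theta> (std_basis n) = moore n * g"
      by (rule moore_dvd[OF p card Hom_ext_Sym[OF \<theta>]])
    then show ?thesis unfolding top .
  qed
  then obtain h where h: "\<And>K. K \<subseteq> {..<n} \<Longrightarrow> h K \<in> Sym n"
      "\<And>K. K \<subseteq> {..<n} \<Longrightarrow> wedge \<alpha> (omega_prod n K) (std_basis n) = moore n * h K"
    by metis
  obtain f where f: "\<And>J. J \<subseteq> {..<n} \<Longrightarrow> f J \<in> Sym n"
      "\<alpha> = (\<lambda>vs. \<Sum>J\<in>Pow {..<n}. f J * omega_prod n J vs)"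
    by (rule Forms_span[OF omega_functional_Vdual[OF p card] omega_prod_top_nonzero \<alpha>F h(1), unfolded alt_prod_omega_functional_top[OF p card], OF _ h(2)])
      auto
  have "act_poly g (f J) = f J" if g: "g \<in> parabolic I" and J: "J \<subseteq> {..<n}" for g J
  proof (rule omega_prod_independent[OF _ J])
    fix vs :: "'a vec list"
    have "(\<lambda>vs. \<Sum>J\<in>Pow {..<n}. act_poly g (f J) * omega_prod n J vs) = act_form n g \<alpha>"
      unfolding f(2) by (rule act_form_omega_functional_comb[OF p card GL[OF g], symmetric])
    also have "\<dots> = (\<lambda>vs. \<Sum>J\<in>Pow {..<n}. f J * omega_prod n J vs)"
      using inv[OF g] f(2) by simp
    finally show "(\<Sum>J\<in>Pow {..<n}. act_poly g (f J) * omega_prod n J vs)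
        = (\<Sum>J\<in>Pow {..<n}. f J * omega_prod n J vs)"
      by (rule fun_cong)
  qed
  then show ?thesis using f by (intro that[of f]) (auto simp: sym_inv_carrier)
qed

lemma omega_functional_comb_forms_inv:
  fixes f :: "nat set \<Rightarrow> 'a mpoly"
  assumes I: "sum_list I = n"
    and f: "\<And>J. J \<subseteq> {..<n} \<Longrightarrow> f J \<in> carrier (sym_inv n (parabolic I))"
  shows "(\<lambda>vs. \<Sum>J\<in>Pow {..<n}. f J * omega_prod n J vs) \<in> carrier (forms_inv n (parabolic I))"
proof -
  have "(\<lambda>vs. \<Sum>J\<in>Pow {..<n}. f J * omega_prod n J vs) \<in> Forms n"
    using f by (intro Forms_sum Forms_smult omega_prod_Forms) (auto simp: sym_inv_carrier)
  moreover have "act_form n g (\<lambda>vs. \<Sum>J\<in>Pow {..<n}. f J * omega_prod n J vs)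
      = (\<lambda>vs. \<Sum>J\<in>Pow {..<n}. f J * omega_prod n J vs)" if "g \<in> parabolic I" for g
  proof -
    have "(\<lambda>vs. \<Sum>J\<in>Pow {..<n}. act_poly g (f J) * omega_prod n J vs)
      = (\<lambda>vs. \<Sum>J\<in>Pow {..<n}. f J * omega_prod n J vs)"
      using f that by (intro ext sum.cong refl) (auto simp: sym_inv_carrier)
    then show ?thesis
      using act_form_omega_functional_comb[OF p card, of g n f] parabolic_GL[OF that] I by simp
  qed
  ultimately show ?thesis by (auto simp: forms_inv_carrier)
qed

text \<open>Multiplication by \<omega>_K, with K complementary to \<open>J\<close>, leaves
  \<open>f J\<close> times the Moore determinant up to sign. A wrong exterior degree would make this
  product 0, and division by the determinant gives the polynomial degree, because the degrees of
  \<omega>_J and \<omega>_K add up to that of the determinant.\<close>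

lemma omega_functional_comb_bidegree:
  fixes f :: "nat set \<Rightarrow> 'a mpoly"
  assumes \<alpha>: "(\<lambda>vs. \<Sum>J\<in>Pow {..<n}. f J * omega_prod n J vs) \<in> bidegree n i m" (is "?\<alpha> \<in> _")
    and J: "J \<subseteq> {..<n}" and nz: "f J \<noteq> 0"
  shows "card J = m" "omega_degree TYPE('a) J \<le> i" "f J \<in> homogeneous (i - omega_degree TYPE('a) J)"
proof -
  let ?K = "{..<n} - J"
  let ?s = "of_int (complement_sign TYPE('a) n J) :: 'a mpoly"
  have K: "?K \<subseteq> {..<n}" "{..<n} - ?K = J" using J by auto
  have s: "?s * ?s = 1"
    using complement_sign(1)[OF J, where 'a = 'a] by (metis of_int_1 of_int_mult)
  then have s0: "?s \<noteq> 0" by auto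
  have fs: "f J * ?s \<noteq> 0" using nz s0 by simp
  have top: "wedge ?\<alpha> (omega_prod n ?K) (std_basis n) = f J * ?s * moore n"
    unfolding wedge_alt_prod_complement[OF K(1)] K(2) alt_prod_omega_functional_top[OF p card] ..
  have \<alpha>0: "?\<alpha> vs = 0" if "length vs \<noteq> m" for vs
  proof -
    have "component m ?\<alpha> = ?\<alpha>" using \<alpha> by (simp add: bidegree_def)
    then show ?thesis using that by (metis (no_types, lifting) component_def)
  qed
  have cK: "card ?K = n - card J" "card J \<le> n"
    using J card_le_n[OF J] finite_subset[OF J] by (simp_all add: card_Diff_subset)
  show cJ: "card J = m"
  proof (rule ccontr)
    assume ne: "card J \<noteq> m"
    have "wedge ?\<alpha> (omega_prod n ?K) (std_basis n) = 0"
      unfolding wedge_def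
    proof (intro sum.neutral ballI)
      fix k \<sigma> assume k: "k \<in> {..length (std_basis n :: 'a vec list)}"
      let ?u = "map (\<lambda>i. (std_basis n :: 'a vec list) ! \<sigma> i) [0..<k]"
        and ?v = "map (\<lambda>i. (std_basis n :: 'a vec list) ! \<sigma> i) [k..<length (std_basis n :: 'a vec list)]"
      \<comment> \<open>The form \<alpha> accepts exactly m arguments, which leaves n - m, while
        \<omega>_K accepts n - card J.\<close>
      have "?\<alpha> ?u = 0 \<or> omega_prod n ?K ?v = 0"
      proof (cases "k = m")
        case True
        then have "length ?v \<noteq> card ?K" using ne cK k by simp
        then show ?thesis by (intro disjI2 alt_prod_length) (simp add: length_family_list[OF K(1)])
      next
        case False
        then show ?thesis using \<alpha>0[of ?u] by simp
      qed
      then show "of_int (sign \<sigma>) * ?\<alpha> ?u * omega_prod n ?K ?v = 0" by auto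
    qed
    then show False using top fs moore_nonzero[OF p card, of n] by simp
  qed
  have "wedge ?\<alpha> (omega_prod n ?K) (std_basis n) \<in> homogeneous (i + omega_degree TYPE('a) ?K)"
    unfolding wedge_def
  proof (intro homogeneous_sum)
    fix k \<sigma>
    let ?u = "map (\<lambda>i. (std_basis n :: 'a vec list) ! \<sigma> i) [0..<k]"
      and ?v = "map (\<lambda>i. (std_basis n :: 'a vec list) ! \<sigma> i) [k..<length (std_basis n :: 'a vec list)]"
    have "?\<alpha> ?u \<in> homogeneous i" using \<alpha> unfolding bidegree_def by blast
    from homogeneous_mult[OF homogeneous_mult[OF homogeneous_of_int this] omega_prod_homogeneous]
    show "of_int (sign \<sigma>) * ?\<alpha> ?u * omega_prod n ?K ?v \<in> homogeneous (i + omega_degree TYPE('a) ?K)"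
      by simp
  qed
  then have hom: "f J * ?s * moore n \<in> homogeneous (i + omega_degree TYPE('a) ?K)"
    unfolding top .
  have "(moore n :: 'a mpoly) = omega_prod n {..<n} (std_basis n)"
    unfolding alt_prod_omega_functional_top[OF p card, symmetric] family_list_def
    by (simp add: sorted_list_of_set_range flip: atLeast0LessThan)
  then have mh: "(moore n :: 'a mpoly) \<in> homogeneous (omega_degree TYPE('a) {..<n})"
    by (simp add: omega_prod_homogeneous)
  have split: "omega_degree TYPE('a) {..<n} = omega_degree TYPE('a) J + omega_degree TYPE('a) ?K"
    unfolding omega_degree_def using J by (metis add.commute finite_lessThan sum.subset_diff)
  note quot = homogeneous_quotient[OF hom mh moore_nonzero[OF p card] fs]
  show "omega_degree TYPE('a) J \<le> i" using quot(1) split by simp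
  have "i + omega_degree TYPE('a) ?K - omega_degree TYPE('a) {..<n} = i - omega_degree TYPE('a) J" using split by simp
  then have "f J * ?s * ?s \<in> homogeneous (i - omega_degree TYPE('a) J)"
    using homogeneous_mult[OF quot(2) homogeneous_of_int] by simp
  then show "f J \<in> homogeneous (i - omega_degree TYPE('a) J)" using s by (simp add: mult.assoc)
qed

text \<open>Sorting the indices costs a sign and a repeated index gives 0, so the coefficients are
  scalars.\<close>

lemma omega_functional_span_alt_prod:
  assumes js: "set js \<subseteq> {..<n}"
  shows "\<exists>c :: nat set \<Rightarrow> 'a. alt_prod (map (omega_functional n) js) = (\<lambda>vs. \<Sum>J\<in>Pow {..<n}. PConst (c J) * omega_prod n J vs)"
proof (cases "distinct js")
  case True
  let ?K = "set js"
  have "mset js = mset (sorted_list_of_set ?K)"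
    using True by (metis distinct_sorted_list_of_set finite_set set_eq_iff_mset_eq_distinct set_sorted_list_of_set)
  then obtain s :: int where s: "alt_prod (map (omega_functional n) js) = (\<lambda>vs. of_int s * omega_prod n ?K vs :: 'a mpoly)"
    by (rule alt_prod_permute[where 'a = 'a]) (auto simp: family_list_def)
  have "(\<Sum>J\<in>Pow {..<n}. PConst (if J = ?K then of_int s else 0) * omega_prod n J vs) = of_int s * omega_prod n ?K vs"
    for vs :: "'a vec list"
  proof -
    have "(\<Sum>J\<in>Pow {..<n}. PConst (if J = ?K then of_int s else 0) * omega_prod n J vs)
        = (\<Sum>J\<in>Pow {..<n}. if J = ?K then of_int s * omega_prod n ?K vs else 0)"
      by (intro sum.cong refl) (simp add: PConst.hom_of_int)
    then show ?thesis using js by simp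
  qed
  then show ?thesis unfolding s by (intro exI[of _ "\<lambda>J. if J = ?K then of_int s else 0"]) auto
next
  case False
  then have "\<not> distinct (map (omega_functional n) js :: ('a vec \<Rightarrow> 'a mpoly) list)" by (simp add: distinct_map)
  then show ?thesis by (intro exI[of _ "\<lambda>_. 0"]) (simp add: alt_prod_not_distinct)
qed

text \<open>Among the closure rules only the product takes work: two increasing lists are
  concatenated and sorted again.\<close>

lemma Omega_span:
  assumes "\<alpha> \<in> carrier (Omega n :: ('a, 'a form) module)"
  shows "\<exists>c :: nat set \<Rightarrow> 'a. \<alpha> = (\<lambda>vs. \<Sum>J\<in>Pow {..<n}. PConst (c J) * omega_prod n J vs)"
proof -
  let ?comb = "\<lambda>c vs. \<Sum>J\<in>Pow {..<n}. PConst (c J) * omega_prod n J vs :: 'a mpoly"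
  have "\<alpha> \<in> subalgebra_generated (forms_alg n) (omega n ` {..<n})"
    using assms by (simp add: Omega_def)
  then show ?thesis
  proof (induct rule: subalgebra_generated.induct)
    case one
    then show ?case using omega_functional_span_alt_prod[of "[]" n] by (simp add: forms_alg_def alt_prod_Nil)
  next
    case (gen x)
    then obtain i where "i < n" "x = omega n i" by auto
    then show ?case using omega_functional_span_alt_prod[of "[i]" n] by (simp add: omega_eq_alt_prod)
  next
    case (add x y)
    then obtain c d where "x = ?comb c" "y = ?comb d" by auto
    then have "x \<oplus>\<^bsub>forms_alg n\<^esub> y = ?comb (\<lambda>J. c J + d J)"
      by (simp add: forms_alg_def PConst.hom_add algebra_simps sum.distrib)
    then show ?case by (intro exI[of _ "\<lambda>J. c J + d J"])
  next
    case (smult x k)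
    then obtain c where "x = ?comb c" by auto
    then have "k \<odot>\<^bsub>forms_alg n\<^esub> x = ?comb (\<lambda>J. k * c J)"
      by (simp add: forms_alg_def PConst.hom_mult algebra_simps sum_distrib_left)
    then show ?case by (intro exI[of _ "\<lambda>J. k * c J"])
  next
    case (mult x y)
    then obtain c d where xy: "x = ?comb c" "y = ?comb d" by auto
    \<comment> \<open>Structure constants of the exterior algebra, picked for all pairs at once so
      that the triple sum can be rearranged.\<close>
    define e where "e J K = (SOME e :: nat set \<Rightarrow> 'a. alt_prod (family_list (omega_functional n) J @ family_list (omega_functional n) K) = ?comb e)" for J K
    have e: "alt_prod (family_list (omega_functional n) J @ family_list (omega_functional n) K) = ?comb (e J K)"
      if "J \<in> Pow {..<n}" "K \<in> Pow {..<n}" for J K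
    proof -
      have "set (sorted_list_of_set J @ sorted_list_of_set K) \<subseteq> {..<n}"
        using that finite_subset[of _ "{..<n}"] by auto
      then have "\<exists>e :: nat set \<Rightarrow> 'a. alt_prod (family_list (omega_functional n) J @ family_list (omega_functional n) K) = ?comb e"
        unfolding family_list_def map_append[symmetric] by (rule omega_functional_span_alt_prod[unfolded family_list_def])
      then show ?thesis unfolding e_def by (rule someI_ex)
    qed
    have "wedge x y = (\<lambda>vs. \<Sum>J\<in>Pow {..<n}. \<Sum>K\<in>Pow {..<n}.
        PConst (c J) * (PConst (d K) * alt_prod (family_list (omega_functional n) J @ family_list (omega_functional n) K) vs))"
      unfolding xy wedge_sum_left wedge_sum_right wedge_alt_prod sum_distrib_left ..
    also have "\<dots> = (\<lambda>vs. \<Sum>J\<in>Pow {..<n}. \<Sum>K\<in>Pow {..<n}. \<Sum>L\<in>Pow {..<n}.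
        PConst (c J * d K * e J K L) * omega_prod n L vs)"
      by (intro ext sum.cong[OF refl]) (simp only: e sum_distrib_left PConst.hom_mult mult.assoc)
    also have "\<dots> = (\<lambda>vs. \<Sum>L\<in>Pow {..<n}. \<Sum>J\<in>Pow {..<n}. \<Sum>K\<in>Pow {..<n}.
        PConst (c J * d K * e J K L) * omega_prod n L vs)"
    proof
      fix vs :: "'a vec list"
      have "(\<Sum>J\<in>Pow {..<n}. \<Sum>K\<in>Pow {..<n}. \<Sum>L\<in>Pow {..<n}. PConst (c J * d K * e J K L) * omega_prod n L vs)
        = (\<Sum>J\<in>Pow {..<n}. \<Sum>L\<in>Pow {..<n}. \<Sum>K\<in>Pow {..<n}. PConst (c J * d K * e J K L) * omega_prod n L vs)"
        by (rule sum.cong[OF refl]) (rule sum.swap)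
      then show "(\<Sum>J\<in>Pow {..<n}. \<Sum>K\<in>Pow {..<n}. \<Sum>L\<in>Pow {..<n}. PConst (c J * d K * e J K L) * omega_prod n L vs)
        = (\<Sum>L\<in>Pow {..<n}. \<Sum>J\<in>Pow {..<n}. \<Sum>K\<in>Pow {..<n}. PConst (c J * d K * e J K L) * omega_prod n L vs)"
        by (rule trans) (rule sum.swap)
    qed
    also have "\<dots> = ?comb (\<lambda>L. \<Sum>J\<in>Pow {..<n}. \<Sum>K\<in>Pow {..<n}. c J * d K * e J K L)"
      by (intro ext sum.cong refl) (simp add: PConst.hom_sum sum_distrib_right)
    finally have "x \<otimes>\<^bsub>forms_alg n\<^esub> y
        = ?comb (\<lambda>L. \<Sum>J\<in>Pow {..<n}. \<Sum>K\<in>Pow {..<n}. c J * d K * e J K L)"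
      by (simp add: forms_alg_def)
    then show ?case
      by (intro exI[of _ "\<lambda>L. \<Sum>J\<in>Pow {..<n}. \<Sum>K\<in>Pow {..<n}. c J * d K * e J K L"])
  qed
qed

end

lemma alt_prod_omega_functional_Omega:
  "set js \<subseteq> {..<n} \<Longrightarrow> alt_prod (map (omega_functional n) js) \<in> carrier (Omega n :: ('a::{finite,field}, 'a form) module)"
proof (induct js)
  case Nil
  show ?case using subalgebra_generated.one[of "forms_alg n" "omega n ` {..<n}"]
    by (simp add: Omega_def alt_prod_Nil forms_alg_def)
next
  case (Cons i js)
  have "omega n i \<otimes>\<^bsub>forms_alg n\<^esub> alt_prod (map (omega_functional n) js)
      \<in> subalgebra_generated (forms_alg n :: ('a, 'a form) module) (omega n ` {..<n})"
    using Cons by (intro subalgebra_generated.mult[OF subalgebra_generated.gen]) (auto simp: Omega_def)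
  then show ?case
    by (simp add: Omega_def forms_alg_def omega_eq_alt_prod wedge_alt_prod)
qed

lemma omega_prod_Omega: "J \<subseteq> {..<n} \<Longrightarrow> omega_prod n J \<in> carrier (Omega n :: ('a::{finite,field}, 'a form) module)"
  unfolding family_list_def using finite_subset[of J "{..<n}"] by (intro alt_prod_omega_functional_Omega) auto

section \<open>The comparison map from the tensor product\<close>

lemma lookup_map_mult:
  "Poly_Mapping.lookup (Poly_Mapping.map ((*) k) x) t = k * Poly_Mapping.lookup x t"
  for k :: "'a::field"
  by (simp add: Poly_Mapping.map.rep_eq when_def)

lemma mult_pairs_eq:
  "mult_pairs x vs = (\<Sum>k\<in>Poly_Mapping.keys x. PConst (Poly_Mapping.lookup x k) * (fst k vs * snd k))"
  by (simp add: mult_pairs_def wedge_scalar_form split_def)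

lemma mult_pairs_superset:
  assumes "finite S" "Poly_Mapping.keys x \<subseteq> S"
  shows "mult_pairs x vs = (\<Sum>k\<in>S. PConst (Poly_Mapping.lookup x k) * (fst k vs * snd k))"
  unfolding mult_pairs_eq
  by (rule sum.mono_neutral_left) (use assms in \<open>auto simp: in_keys_iff\<close>)

lemma mult_pairs_add: "mult_pairs (x + y) vs = mult_pairs x vs + mult_pairs y vs"
proof -
  let ?S = "Poly_Mapping.keys x \<union> Poly_Mapping.keys y"
  have *: "finite ?S" "Poly_Mapping.keys (x + y) \<subseteq> ?S"
    using Poly_Mapping.keys_add[of x y] by auto
  show ?thesis
    unfolding mult_pairs_superset[OF *] mult_pairs_superset[of ?S x, OF *(1) Un_upper1]
      mult_pairs_superset[of ?S y, OF *(1) Un_upper2]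
    by (simp add: lookup_add algebra_simps sum.distrib PConst.hom_add)
qed

lemma mult_pairs_0 [simp]: "mult_pairs 0 vs = 0"
  by (simp add: mult_pairs_eq)

lemma mult_pairs_diff: "mult_pairs (x - y) vs = mult_pairs x vs - mult_pairs y vs"
  using mult_pairs_add[of "x - y" y vs] by simp

lemma mult_pairs_sum: "mult_pairs (sum f A) vs = (\<Sum>a\<in>A. mult_pairs (f a) vs)"
  by (induct A rule: infinite_finite_induct) (simp_all add: mult_pairs_add)

lemma mult_pairs_single [simp]:
  "mult_pairs (Poly_Mapping.single (w, f) a) vs = PConst a * (w vs * f)"
  by (simp add: mult_pairs_eq)

lemma mult_pairs_smult:
  "mult_pairs (Poly_Mapping.map ((*) k) x) vs = PConst k * mult_pairs x vs"
proof -
  have "Poly_Mapping.keys (Poly_Mapping.map ((*) k) x) \<subseteq> Poly_Mapping.keys x"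
    by (auto simp: in_keys_iff lookup_map_mult)
  from mult_pairs_superset[OF finite_keys this] show ?thesis
    by (simp add: mult_pairs_eq[of x] lookup_map_mult sum_distrib_left PConst.hom_mult mult.assoc)
qed

section \<open>Calculation modulo the bilinearity relations, for arbitrary factors\<close>

locale tensor_span =
  fixes B :: "('a::field, 'b) module" and C :: "('a, 'c) module"
begin

abbreviation "T \<equiv> tensor_relations B C"

lemma smult_eq: "k \<odot>\<^bsub>free_pairs B C\<^esub> x = Poly_Mapping.map ((*) k) x"
  by (simp add: free_pairs_def)

lemma T_uminus: "x \<in> T \<Longrightarrow> - x \<in> T"
proof -
  assume "x \<in> T"
  then have "Poly_Mapping.map ((*) (-1)) x \<in> T"
    using tensor_relations.smult[of x B C "-1"] by (simp add: smult_eq)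
  moreover have "Poly_Mapping.map ((*) (-1)) x = - x"
    by (rule poly_mapping_eqI) (simp only: lookup_map_mult lookup_uminus, simp)
  ultimately show ?thesis by simp
qed

lemma T_sum: "(\<And>a. a \<in> A \<Longrightarrow> f a \<in> T) \<Longrightarrow> sum f A \<in> T"
  by (induct A rule: infinite_finite_induct) (auto intro: tensor_relations.zero tensor_relations.add)

lemma T_trans: "x - y \<in> T \<Longrightarrow> y - z \<in> T \<Longrightarrow> x - z \<in> T"
  using tensor_relations.add[of "x - y" B C "y - z"] by simp

lemma T_add_cong: "x - y \<in> T \<Longrightarrow> x' - y' \<in> T \<Longrightarrow> (x + x') - (y + y') \<in> T"
  using tensor_relations.add[of "x - y" B C "x' - y'"] by (simp add: algebra_simps)

lemma tensor_class_eq: "tensor_class B C x = (\<lambda>t. t + x) ` T"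
  by (auto simp: tensor_class_def a_r_coset_def' free_pairs_def)

lemma tensor_class_eqI: "x - y \<in> T \<Longrightarrow> tensor_class B C x = tensor_class B C y"
proof -
  have "(\<lambda>t. t + x) ` T \<subseteq> (\<lambda>t. t + y) ` T" if "x - y \<in> T" for x y
  proof
    fix z assume "z \<in> (\<lambda>t. t + x) ` T"
    then obtain t where "t \<in> T" "z = t + x" by auto
    then have "t + (x - y) \<in> T" "z = (t + (x - y)) + y"
      using that by (auto intro: tensor_relations.add)
    then show "z \<in> (\<lambda>t. t + y) ` T" by (intro image_eqI[of _ _ "t + (x - y)"])
  qed
  moreover assume "x - y \<in> T"
  moreover from this have "y - x \<in> T" using T_uminus by fastforce
  ultimately show ?thesis unfolding tensor_class_eq by blast
qed

lemma carrier_tensor: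
  "carrier (tensor B C) = tensor_class B C ` {x. Poly_Mapping.keys x \<subseteq> carrier B \<times> carrier C}"
  by (auto simp: tensor_def Let_def FactRing_def A_RCOSETS_def' tensor_class_def free_pairs_def)

lemma tensor_ops:
  "X \<otimes>\<^bsub>tensor B C\<^esub> Y
    = (\<Union>a\<in>X. \<Union>b\<in>Y. tensor_class B C (a \<otimes>\<^bsub>free_pairs B C\<^esub> b))"
  "\<one>\<^bsub>tensor B C\<^esub> = tensor_class B C (Poly_Mapping.single (\<one>\<^bsub>B\<^esub>, \<one>\<^bsub>C\<^esub>) 1)"
  "X \<oplus>\<^bsub>tensor B C\<^esub> Y = {a + b | a b. a \<in> X \<and> b \<in> Y}"
  "k \<odot>\<^bsub>tensor B C\<^esub> X = (\<Union>x\<in>X. tensor_class B C (Poly_Mapping.map ((*) k) x))"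
  by (auto simp: tensor_def Let_def FactRing_def rcoset_mult_def tensor_class_def free_pairs_def
      set_add_def set_mult_def)

end

text \<open>The form in which well-definedness is checked: \<open>mult_map\<close> collects the
  values on all representatives, so these have to coincide.\<close>

lemma the_elem_constant:
  assumes "A \<noteq> {}" "\<And>x. x \<in> A \<Longrightarrow> f x = c"
  shows "the_elem (f ` A) = c"
proof -
  have "f ` A = {c}" using assms by auto
  then show ?thesis by simp
qed

locale graded_comparison =
  fixes p r n :: nat and I :: "nat list" and B :: "('a::{finite,field}, 'a form) module"
    and C :: "('a, 'a mpoly) module"
  assumes p: "prime p" and card: "CARD('a) = p ^ r" and I: "sum_list I = n"
    and q: "CARD('a) \<noteq> 2"
    and B: "B = Omega n" and C: "C = sym_inv n (parabolic I)"
begin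

sublocale tensor_span B C .

lemma B_ops: "\<alpha> \<otimes>\<^bsub>B\<^esub> \<beta> = wedge \<alpha> \<beta>" "\<one>\<^bsub>B\<^esub> = scalar_form 1"
  "\<alpha> \<oplus>\<^bsub>B\<^esub> \<beta> = (\<lambda>vs. \<alpha> vs + \<beta> vs)" "k \<odot>\<^bsub>B\<^esub> \<alpha> = (\<lambda>vs. PConst k * \<alpha> vs)"
  by (simp_all add: B Omega_def forms_alg_def)

lemma C_ops: "f \<otimes>\<^bsub>C\<^esub> g = f * g" "\<one>\<^bsub>C\<^esub> = 1" "f \<oplus>\<^bsub>C\<^esub> g = f + g"
  "k \<odot>\<^bsub>C\<^esub> f = PConst k * f"
  by (simp_all add: C sym_inv_def sym_alg_def)

lemma C_closed:
  "0 \<in> carrier C" "f \<in> carrier C \<Longrightarrow> g \<in> carrier C \<Longrightarrow> f + g \<in> carrier C"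
  "f \<in> carrier C \<Longrightarrow> PConst k * f \<in> carrier C"
  by (auto simp: C sym_inv_carrier act_poly.hom_add act_poly.hom_mult Sym_add Sym_mult)

lemma B_closed:
  "\<alpha> \<in> carrier B \<Longrightarrow> \<beta> \<in> carrier B \<Longrightarrow> (\<lambda>vs. \<alpha> vs + \<beta> vs) \<in> carrier B"
  "\<alpha> \<in> carrier B \<Longrightarrow> (\<lambda>vs. PConst k * \<alpha> vs) \<in> carrier B"
  using subalgebra_generated.add[of \<alpha> "forms_alg n" "omega n ` {..<n}" \<beta>]
    subalgebra_generated.smult[of \<alpha> "forms_alg n" "omega n ` {..<n}" k]
  by (auto simp: B Omega_def forms_alg_def)

lemma omega_prod_B: "J \<subseteq> {..<n} \<Longrightarrow> omega_prod n J \<in> carrier B"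
  unfolding B by (rule omega_prod_Omega)

lemma mult_pairs_T: "t \<in> T \<Longrightarrow> mult_pairs t = (\<lambda>_. 0)"
proof (induct rule: tensor_relations.induct)
  case (smult x k)
  then show ?case by (intro ext) (simp add: smult_eq mult_pairs_smult)
qed (intro ext, simp add: mult_pairs_add mult_pairs_diff B_ops C_ops algebra_simps)+

lemma zero_T: "0 \<in> T"
  by (rule tensor_relations.zero)

lemma mult_map_class [simp]: "mult_map (tensor_class B C x) = mult_pairs x"
  unfolding mult_map_def tensor_class_eq
  by (rule the_elem_constant) (use zero_T in \<open>auto simp: fun_eq_iff mult_pairs_add mult_pairs_T\<close>)

text \<open>Polynomials have exterior degree 0 and pass through \<open>wedge\<close> without a sign,
  in agreement with the componentwise product of pairs.\<close>

lemma mult_pairs_mult: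
  "mult_pairs (x \<otimes>\<^bsub>free_pairs B C\<^esub> y) = wedge (mult_pairs x) (mult_pairs y)"
proof
  fix vs :: "'a vec list"
  let ?l = "Poly_Mapping.lookup" and ?K = "Poly_Mapping.keys"
  have eq: "mult_pairs z = (\<lambda>vs. \<Sum>k\<in>?K z. PConst (?l z k) * (\<lambda>vs. snd k * fst k vs) vs)" for z :: "('a form \<times> 'a mpoly) \<Rightarrow>\<^sub>0 'a"
    by (rule ext) (simp add: mult_pairs_eq mult.commute)
  have "mult_pairs (x \<otimes>\<^bsub>free_pairs B C\<^esub> y) vs = (\<Sum>k\<in>?K x. \<Sum>l\<in>?K y.
      PConst (?l x k * ?l y l) * (wedge (fst k) (fst l) vs * (snd k * snd l)))"
    by (simp add: free_pairs_def split_def mult_pairs_sum B_ops C_ops)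
  also have "\<dots> = wedge (mult_pairs x) (mult_pairs y) vs"
    unfolding eq[of x] eq[of y] wedge_sum_left wedge_sum_right wedge_smult_left wedge_smult_right
    by (simp add: sum_distrib_left PConst.hom_mult mult_ac)
  finally show "mult_pairs (x \<otimes>\<^bsub>free_pairs B C\<^esub> y) vs = wedge (mult_pairs x) (mult_pairs y) vs" .
qed

text \<open>The normal form of an element of the tensor product: the sum of the tensors of
  \<omega>_J with \<open>f J\<close>.\<close>

definition omega_functional_tensor :: "(nat set \<Rightarrow> 'a mpoly) \<Rightarrow> ('a form \<times> 'a mpoly) \<Rightarrow>\<^sub>0 'a" where
  "omega_functional_tensor f = (\<Sum>J\<in>Pow {..<n}. Poly_Mapping.single (omega_prod n J, f J) 1)"

lemma mult_pairs_omega_functional_tensor: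
  "mult_pairs (omega_functional_tensor f) = (\<lambda>vs. \<Sum>J\<in>Pow {..<n}. f J * omega_prod n J vs)"
  by (rule ext) (simp add: omega_functional_tensor_def mult_pairs_sum mult.commute)

lemma omega_functional_tensor_keys:
  assumes "\<And>J. J \<subseteq> {..<n} \<Longrightarrow> f J \<in> carrier C"
  shows "Poly_Mapping.keys (omega_functional_tensor f) \<subseteq> carrier B \<times> carrier C"
proof -
  have "Poly_Mapping.keys (omega_functional_tensor f)
      \<subseteq> (\<Union>J\<in>Pow {..<n}. Poly_Mapping.keys (Poly_Mapping.single (omega_prod n J, f J) (1 :: 'a)))"
    unfolding omega_functional_tensor_def by (rule Poly_Mapping.keys_sum)
  then show ?thesis using assms omega_prod_B by auto
qed

text \<open>The zero form is 0 times any \<open>b\<close>, and moving that scalar out leaves a term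
  with coefficient 0.\<close>

lemma single_zero_left_T: "c \<in> carrier C \<Longrightarrow> b \<in> carrier B \<Longrightarrow> Poly_Mapping.single (\<lambda>_. 0, c) 1 \<in> T"
  using tensor_relations.smult_left[of b B c C 0] by (simp add: B_ops)

lemma single_zero_right_T: "b \<in> carrier B \<Longrightarrow> Poly_Mapping.single (b, 0) 1 \<in> T"
  using tensor_relations.smult_right[of b B 0 C 0] C_closed by (simp add: C_ops)

lemma move_scalar_T:
  "b \<in> carrier B \<Longrightarrow> c \<in> carrier C \<Longrightarrow>
    Poly_Mapping.single (b, c) k - Poly_Mapping.single (b, PConst k * c) 1 \<in> T"
  using T_uminus[OF tensor_relations.smult_right[of b B c C k]] by (simp add: C_ops)

lemma omega_functional_tensor_add:
  assumes "\<And>J. J \<subseteq> {..<n} \<Longrightarrow> f J \<in> carrier C" "\<And>J. J \<subseteq> {..<n} \<Longrightarrow> g J \<in> carrier C"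
  shows "(omega_functional_tensor f + omega_functional_tensor g) - omega_functional_tensor (\<lambda>J. f J + g J) \<in> T"
proof -
  have "- (Poly_Mapping.single (omega_prod n J, f J + g J) 1 - Poly_Mapping.single (omega_prod n J, f J) 1
      - Poly_Mapping.single (omega_prod n J, g J) 1) \<in> T" if "J \<in> Pow {..<n}" for J
    using tensor_relations.add_right[of "omega_prod n J" B "f J" C "g J"] assms omega_prod_B that
    by (intro T_uminus) (simp add: C_ops)
  from T_sum[OF this, of "Pow {..<n}"] show ?thesis
    by (simp add: omega_functional_tensor_def sum_subtractf sum.distrib algebra_simps)
qed

text \<open>Expand \<open>w\<close> in the products \<omega>_J with scalar coefficients and carry
  these scalars over to the polynomial factor.\<close>

lemma omega_functional_tensor_single:
  assumes w: "w \<in> carrier B" and f: "f \<in> carrier C"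
  shows "\<exists>h. (\<forall>J\<subseteq>{..<n}. h J \<in> carrier C) \<and> Poly_Mapping.single (w, f) a - omega_functional_tensor h \<in> T"
proof -
  obtain c :: "nat set \<Rightarrow> 'a" where c: "w = (\<lambda>vs. \<Sum>J\<in>Pow {..<n}. PConst (c J) * omega_prod n J vs)"
    using Omega_span[OF p card] w unfolding B by blast
  let ?f = "PConst a * f"
  have f': "?f \<in> carrier C" by (rule C_closed(3)[OF f])
  \<comment> \<open>Membership of the partial sums in the left factor is proved alongside, because
    the additivity relation demands it of both summands.\<close>
  have "(\<lambda>vs. \<Sum>J\<in>S. PConst (c J) * omega_prod n J vs) \<in> carrier B
      \<and> Poly_Mapping.single (\<lambda>vs. \<Sum>J\<in>S. PConst (c J) * omega_prod n J vs, ?f) 1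
        - (\<Sum>J\<in>S. Poly_Mapping.single (omega_prod n J, PConst (c J) * ?f) 1) \<in> T"
    if "finite S" "S \<subseteq> Pow {..<n}" for S
    using that
  proof (induct S rule: finite_induct)
    case empty
    have "(\<lambda>_. 0) \<in> carrier B" using B_closed(2)[OF w, of 0] by simp
    then show ?case using single_zero_left_T[OF f' w] by simp
  next
    case (insert K S)
    let ?s = "\<lambda>vs. \<Sum>J\<in>S. PConst (c J) * omega_prod n J vs" and ?k = "\<lambda>vs. PConst (c K) * omega_prod n K vs"
    have K: "omega_prod n K \<in> carrier B" using insert omega_prod_B by simp
    have IH: "?s \<in> carrier B" "Poly_Mapping.single (?s, ?f) 1
        - (\<Sum>J\<in>S. Poly_Mapping.single (omega_prod n J, PConst (c J) * ?f) 1) \<in> T"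
      using insert by auto
    have sumeq: "(\<lambda>vs. \<Sum>J\<in>insert K S. PConst (c J) * omega_prod n J vs) = (\<lambda>vs. ?k vs + ?s vs)"
      using insert by simp
    have k: "?k \<in> carrier B" by (rule B_closed(2)[OF K])
    have 1: "Poly_Mapping.single (\<lambda>vs. ?k vs + ?s vs, ?f) 1
        - (Poly_Mapping.single (?k, ?f) 1 + Poly_Mapping.single (?s, ?f) 1) \<in> T"
      using tensor_relations.add_left[OF k IH(1) f'] by (simp add: B_ops algebra_simps)
    have "Poly_Mapping.single (?k, ?f) 1 - Poly_Mapping.single (omega_prod n K, ?f) (c K) \<in> T"
      using tensor_relations.smult_left[OF K f', of "c K"] by (simp add: B_ops)
    from T_trans[OF this move_scalar_T[OF K f']]
    have "Poly_Mapping.single (?k, ?f) 1 - Poly_Mapping.single (omega_prod n K, PConst (c K) * ?f) 1 \<in> T" .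
    from T_trans[OF 1 T_add_cong[OF this IH(2)]]
    show ?case unfolding sumeq using insert k IH(1) B_closed(1) by simp
  qed
  from this[of "Pow {..<n}"] have "Poly_Mapping.single (w, ?f) 1 - omega_functional_tensor (\<lambda>J. PConst (c J) * ?f) \<in> T"
    unfolding omega_functional_tensor_def c by simp
  from T_trans[OF move_scalar_T[OF w f] this]
  show ?thesis using C_closed(3)[OF f'] by (intro exI[of _ "\<lambda>J. PConst (c J) * ?f"]) auto
qed

lemma tensor_normal_form:
  assumes "Poly_Mapping.keys x \<subseteq> carrier B \<times> carrier C"
  shows "\<exists>h. (\<forall>J\<subseteq>{..<n}. h J \<in> carrier C) \<and> x - omega_functional_tensor h \<in> T"
proof (induct x rule: poly_mapping_single_induct)
  case 1
  have "omega_functional_tensor (\<lambda>_. 0) \<in> T"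
    unfolding omega_functional_tensor_def by (intro T_sum single_zero_right_T omega_prod_B) auto
  then show ?case using T_uminus C_closed(1) by (intro exI[of _ "\<lambda>_. 0"]) auto
next
  case (2 t a)
  then show ?case using assms omega_functional_tensor_single[of "fst t" "snd t" a] by auto
next
  case (3 x y)
  then obtain f g where fg: "\<And>J. J \<subseteq> {..<n} \<Longrightarrow> f J \<in> carrier C" "x - omega_functional_tensor f \<in> T"
    "\<And>J. J \<subseteq> {..<n} \<Longrightarrow> g J \<in> carrier C" "y - omega_functional_tensor g \<in> T" by blast
  from T_trans[OF T_add_cong[OF fg(2,4)] omega_functional_tensor_add[of f g, OF fg(1,3)]]
  show ?case using fg C_closed(2) by (intro exI[of _ "\<lambda>J. f J + g J"]) auto
qed

lemma mult_pairs_cong: "x - y \<in> T \<Longrightarrow> mult_pairs x = mult_pairs y"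
  using mult_pairs_T[of "x - y"] by (auto simp: fun_eq_iff mult_pairs_diff)

lemma mult_pairs_forms_inv:
  assumes "Poly_Mapping.keys x \<subseteq> carrier B \<times> carrier C"
  shows "mult_pairs x \<in> carrier (forms_inv n (parabolic I))"
proof -
  obtain h where "\<And>J. J \<subseteq> {..<n} \<Longrightarrow> h J \<in> carrier C" "x - omega_functional_tensor h \<in> T"
    using tensor_normal_form[OF assms] by blast
  then show ?thesis
    using mult_pairs_cong mult_pairs_omega_functional_tensor omega_functional_comb_forms_inv[OF p card I, of h] by (simp add: C)
qed

text \<open>In normal form, vanishing of the image is a linear relation among the \<omega>_J over
  S(V). All its coefficients are 0, and a tensor with a zero factor is itself a relation.\<close>

lemma mult_pairs_injective:
  assumes "Poly_Mapping.keys x \<subseteq> carrier B \<times> carrier C" "mult_pairs x = (\<lambda>_. 0)"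
  shows "x \<in> T"
proof -
  obtain h where h: "x - omega_functional_tensor h \<in> T" using tensor_normal_form[OF assms(1)] by blast
  have "(\<Sum>J\<in>Pow {..<n}. h J * omega_prod n J vs) = (\<Sum>J\<in>Pow {..<n}. (\<lambda>_. 0) J * omega_prod n J vs)" for vs
    using mult_pairs_cong[OF h] assms(2) by (simp add: mult_pairs_omega_functional_tensor fun_eq_iff)
  then have "h J = 0" if "J \<subseteq> {..<n}" for J
    using omega_prod_independent[OF p card _ that, of h "\<lambda>_. 0"] by simp
  then have "omega_functional_tensor h \<in> T"
    unfolding omega_functional_tensor_def by (intro T_sum) (auto intro!: single_zero_right_T omega_prod_B)
  with h show ?thesis using tensor_relations.add by fastforce
qed

lemma bidegree_pairs:
  assumes "w \<in> Omega_bidegree n j e" "f \<in> sym_inv_bidegree n (parabolic I) j' e'"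
  shows "w vs * f \<in> homogeneous (j + j')" "length vs \<noteq> e + e' \<Longrightarrow> w vs * f = 0"
    "w \<in> carrier B" "f \<in> carrier C"
proof -
  have w: "component e w = w" "w vs \<in> homogeneous j"
    using assms(1) by (auto simp: Omega_bidegree_def bidegree_def)
  have f: "component e' (scalar_form f) = scalar_form f" "scalar_form f [] \<in> homogeneous j'"
    using assms(2) unfolding sym_inv_bidegree_def bidegree_def by blast+
  show "w vs * f \<in> homogeneous (j + j')"
    using homogeneous_mult[OF w(2) f(2)] by (simp add: scalar_form_def)
  assume len: "length vs \<noteq> e + e'"
  show "w vs * f = 0"
  proof (cases "e' = 0")
    case True
    then show ?thesis using fun_cong[OF w(1), of vs] len by (simp add: component_def)
  next
    \<comment> \<open>A scalar form placed in positive exterior degree is zero.\<close>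
    case False
    then show ?thesis using fun_cong[OF f(1), of "[]"] by (simp add: component_def scalar_form_def)
  qed
qed (use assms in \<open>auto simp: B C Omega_bidegree_def sym_inv_bidegree_def\<close>)

lemma omega_prod_bidegree:
  assumes "J \<subseteq> {..<n}"
  shows "(omega_prod n J :: 'a form) \<in> Omega_bidegree n (omega_degree TYPE('a) J) (card J)"
  using omega_prod_B[OF assms] omega_prod_Forms[OF p card assms] component_alt_prod[of "card J" "family_list (omega_functional n) J"] assms
  by (simp add: Omega_bidegree_def bidegree_def omega_prod_homogeneous B)

lemma scalar_form_bidegree:
  assumes "f \<in> carrier C" "f \<in> homogeneous j"
  shows "f \<in> sym_inv_bidegree n (parabolic I) j 0"
proof -
  have "scalar_form f \<in> Forms n"
  proof -
    have "scalar_form f = (\<lambda>vs. f * alt_prod [] vs)"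
      by (auto simp: alt_prod_Nil scalar_form_def)
    then show ?thesis
      using assms(1) by (auto intro!: Forms_smult alt_prod_Forms simp: C sym_inv_carrier)
  qed
  then show ?thesis
    using assms by (auto simp: sym_inv_bidegree_def bidegree_def component_def scalar_form_def C)
qed

lemma decompose:
  assumes "\<alpha> \<in> carrier (forms_inv n (parabolic I))"
  shows "\<exists>f. (\<forall>J\<subseteq>{..<n}. f J \<in> carrier C) \<and> \<alpha> = (\<lambda>vs. \<Sum>J\<in>Pow {..<n}. f J * omega_prod n J vs :: 'a mpoly)"
  by (rule forms_inv_decompose[OF p card I q assms]) (auto simp: C)

lemma mult_map_bigraded:
  "mult_map ` tensor_bidegree B (Omega_bidegree n) C (sym_inv_bidegree n (parabolic I)) i m
    = forms_inv_bidegree n (parabolic I) i m" (is "_ ` ?G = ?H")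
proof (intro equalityI subsetI)
  fix \<alpha> assume "\<alpha> \<in> mult_map ` ?G"
  then obtain x where x: "\<alpha> = mult_pairs x" "Poly_Mapping.keys x \<subseteq> (\<Union>(j, j')\<in>{(j, j'). j + j' = i}.
      \<Union>(e, e')\<in>{(e, e'). e + e' = m}. Omega_bidegree n j e \<times> sym_inv_bidegree n (parabolic I) j' e')"
    by (auto simp: tensor_bidegree_def)
  have k: "fst k vs * snd k \<in> homogeneous i" "length vs \<noteq> m \<Longrightarrow> fst k vs * snd k = 0"
    "k \<in> carrier B \<times> carrier C" if "k \<in> Poly_Mapping.keys x" for k vs
  proof -
    from that x(2) obtain j j' e e' where je: "j + j' = i" "e + e' = m"
      "fst k \<in> Omega_bidegree n j e" "snd k \<in> sym_inv_bidegree n (parabolic I) j' e'" by fastforce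
    show "fst k vs * snd k \<in> homogeneous i" "length vs \<noteq> m \<Longrightarrow> fst k vs * snd k = 0"
      "k \<in> carrier B \<times> carrier C"
      using bidegree_pairs[OF je(3,4)] je(1,2) by (auto simp: mem_Times_iff)
  qed
  have inv: "\<alpha> \<in> carrier (forms_inv n (parabolic I))"
    unfolding x(1) by (rule mult_pairs_forms_inv) (use k in blast)
  have "\<alpha> vs \<in> homogeneous i" for vs
    unfolding x(1) mult_pairs_eq using homogeneous_mult[OF homogeneous_PConst k(1)]
    by (intro homogeneous_sum) simp
  moreover have "component m \<alpha> = \<alpha>"
    unfolding x(1) by (rule ext) (simp add: component_def mult_pairs_eq k(2))
  ultimately show "\<alpha> \<in> ?H"
    using inv by (simp add: forms_inv_bidegree_def bidegree_def forms_inv_carrier)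
next
  fix \<alpha> :: "'a form" assume \<alpha>: "\<alpha> \<in> ?H"
  then obtain f where f: "\<And>J. J \<subseteq> {..<n} \<Longrightarrow> f J \<in> carrier C"
      "\<alpha> = (\<lambda>vs. \<Sum>J\<in>Pow {..<n}. f J * omega_prod n J vs)"
    using decompose[of \<alpha>] unfolding forms_inv_bidegree_def by blast
  \<comment> \<open>Terms with \<open>f J = 0\<close> are left out: nothing ties the bidegree of
    their \<omega>_J to (i, m), so their pairs might not be admissible.\<close>
  define x where "x = (\<Sum>J\<in>{J \<in> Pow {..<n}. f J \<noteq> 0}. Poly_Mapping.single (omega_prod n J :: 'a form, f J) (1 :: 'a))"
  have "mult_pairs x = \<alpha>"
  proof
    fix vs
    have "mult_pairs x vs = (\<Sum>J\<in>{J \<in> Pow {..<n}. f J \<noteq> 0}. f J * omega_prod n J vs)"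
      by (simp add: x_def mult_pairs_sum mult.commute)
    also have "\<dots> = \<alpha> vs"
      unfolding f(2) by (rule sum.mono_neutral_left) auto
    finally show "mult_pairs x vs = \<alpha> vs" .
  qed
  moreover have "Poly_Mapping.keys x \<subseteq> (\<Union>(j, j')\<in>{(j, j'). j + j' = i}.
      \<Union>(e, e')\<in>{(e, e'). e + e' = m}. Omega_bidegree n j e \<times> sym_inv_bidegree n (parabolic I) j' e')"
  proof
    fix k assume k: "k \<in> Poly_Mapping.keys x"
    have "Poly_Mapping.keys x \<subseteq> (\<Union>J\<in>{J \<in> Pow {..<n}. f J \<noteq> 0}.
        Poly_Mapping.keys (Poly_Mapping.single (omega_prod n J, f J) (1 :: 'a)))"
      unfolding x_def by (rule Poly_Mapping.keys_sum)
    with k obtain J where J: "J \<subseteq> {..<n}" "f J \<noteq> 0" "k = (omega_prod n J, f J)" by auto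
    have \<alpha>': "(\<lambda>vs. \<Sum>J\<in>Pow {..<n}. f J * omega_prod n J vs) \<in> bidegree n i m"
      using \<alpha> f(2) by (simp add: forms_inv_bidegree_def)
    note deg = omega_functional_comb_bidegree[OF p card \<alpha>' J(1,2)]
    have "k \<in> Omega_bidegree n (omega_degree TYPE('a) J) m
        \<times> sym_inv_bidegree n (parabolic I) (i - omega_degree TYPE('a) J) 0"
      using omega_prod_bidegree[OF J(1)] scalar_form_bidegree[OF f(1)[OF J(1)] deg(3)] deg(1) J(3) by simp
    moreover have "omega_degree TYPE('a) J + (i - omega_degree TYPE('a) J) = i" "m + 0 = m" using deg(2) by auto
    ultimately show "k \<in> (\<Union>(j, j')\<in>{(j, j'). j + j' = i}.
        \<Union>(e, e')\<in>{(e, e'). e + e' = m}. Omega_bidegree n j e \<times> sym_inv_bidegree n (parabolic I) j' e')"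
      by blast
  qed
  ultimately show "\<alpha> \<in> mult_map ` ?G"
    unfolding tensor_bidegree_def by (intro image_eqI[of _ _ "tensor_class B C x"]) auto
qed

lemma class_mem: "a \<in> tensor_class B C x \<Longrightarrow> mult_pairs a = mult_pairs x"
  unfolding tensor_class_eq by (auto simp: fun_eq_iff mult_pairs_add mult_pairs_T)

lemma class_self: "x \<in> tensor_class B C x"
  unfolding tensor_class_eq using zero_T by (intro image_eqI[of _ _ 0]) auto

lemma mult_map_ring_iso: "mult_map \<in> ring_iso (tensor B C) (forms_inv n (parabolic I))"
proof -
  let ?A = "tensor B C" and ?D = "forms_inv n (parabolic I)"
  have "mult_map \<in> ring_hom ?A ?D"
  proof (rule ring_hom_memI)
    fix X assume "X \<in> carrier ?A"
    then show "mult_map X \<in> carrier ?D"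
      by (auto simp: carrier_tensor mult_pairs_forms_inv)
  next
    fix X Y assume "X \<in> carrier ?A" "Y \<in> carrier ?A"
    then obtain x y where xy: "X = tensor_class B C x" "Y = tensor_class B C y"
      by (auto simp: carrier_tensor)
    have "mult_map (X \<otimes>\<^bsub>?A\<^esub> Y) = wedge (mult_pairs x) (mult_pairs y)"
      unfolding mult_map_def tensor_ops xy
    proof (rule the_elem_constant)
      show "(\<Union>a\<in>tensor_class B C x. \<Union>b\<in>tensor_class B C y. tensor_class B C (a \<otimes>\<^bsub>free_pairs B C\<^esub> b)) \<noteq> {}"
        using class_self by blast
    qed (auto dest!: class_mem simp: mult_pairs_mult)
    then show "mult_map (X \<otimes>\<^bsub>?A\<^esub> Y) = mult_map X \<otimes>\<^bsub>?D\<^esub> mult_map Y"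
      by (simp add: xy forms_inv_def forms_alg_def)
    have "mult_map (X \<oplus>\<^bsub>?A\<^esub> Y) = (\<lambda>vs. mult_pairs x vs + mult_pairs y vs)"
      unfolding mult_map_def tensor_ops xy
    proof (rule the_elem_constant)
      show "{a + b |a b. a \<in> tensor_class B C x \<and> b \<in> tensor_class B C y} \<noteq> {}"
        using class_self by blast
    qed (auto dest!: class_mem simp: mult_pairs_add fun_eq_iff)
    then show "mult_map (X \<oplus>\<^bsub>?A\<^esub> Y) = mult_map X \<oplus>\<^bsub>?D\<^esub> mult_map Y"
      by (simp add: xy forms_inv_def forms_alg_def)
  next
    show "mult_map \<one>\<^bsub>?A\<^esub> = \<one>\<^bsub>?D\<^esub>"
      by (rule ext) (simp add: tensor_ops B_ops C_ops forms_inv_def forms_alg_def)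
  qed
  moreover have "inj_on mult_map (carrier ?A)"
  proof (rule inj_onI)
    fix X Y assume "X \<in> carrier ?A" "Y \<in> carrier ?A" and eq: "mult_map X = mult_map Y"
    then obtain x y where xy: "X = tensor_class B C x" "Y = tensor_class B C y"
      "Poly_Mapping.keys x \<subseteq> carrier B \<times> carrier C" "Poly_Mapping.keys y \<subseteq> carrier B \<times> carrier C"
      by (auto simp: carrier_tensor)
    have "Poly_Mapping.keys (x - y) \<subseteq> carrier B \<times> carrier C"
      using xy(3,4) Poly_Mapping.keys_add[of x "- y"] by (auto simp: in_keys_iff lookup_minus)
    moreover have "mult_pairs (x - y) = (\<lambda>_. 0)"
      using eq by (auto simp: xy fun_eq_iff mult_pairs_diff)
    ultimately show "X = Y" unfolding xy by (intro tensor_class_eqI mult_pairs_injective)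
  qed
  moreover have "carrier ?D \<subseteq> mult_map ` carrier ?A"
  proof
    fix \<alpha> :: "'a form" assume "\<alpha> \<in> carrier ?D"
    then obtain f where f: "\<And>J. J \<subseteq> {..<n} \<Longrightarrow> f J \<in> carrier C"
        "\<alpha> = (\<lambda>vs. \<Sum>J\<in>Pow {..<n}. f J * omega_prod n J vs)"
      using decompose[of \<alpha>] by blast
    have "mult_map (tensor_class B C (omega_functional_tensor f)) = \<alpha>" using f(2) by (simp add: mult_pairs_omega_functional_tensor)
    moreover have "tensor_class B C (omega_functional_tensor f) \<in> carrier ?A"
      unfolding carrier_tensor by (intro imageI CollectI omega_functional_tensor_keys f(1))
    ultimately show "\<alpha> \<in> mult_map ` carrier ?A" by force
  qed
  ultimately show ?thesis
    by (auto simp: ring_iso_def bij_betw_def ring_hom_closed)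
qed

lemma mult_map_smult:
  assumes "X \<in> carrier (tensor B C)"
  shows "mult_map (k \<odot>\<^bsub>tensor B C\<^esub> X) = k \<odot>\<^bsub>forms_inv n (parabolic I)\<^esub> mult_map X"
proof -
  obtain x where x: "X = tensor_class B C x" using assms by (auto simp: carrier_tensor)
  have "mult_map (k \<odot>\<^bsub>tensor B C\<^esub> X) = (\<lambda>vs. PConst k * mult_pairs x vs)"
    unfolding mult_map_def tensor_ops x
  proof (rule the_elem_constant)
    show "(\<Union>a\<in>tensor_class B C x. tensor_class B C (Poly_Mapping.map ((*) k) a)) \<noteq> {}"
      using class_self by blast
  qed (auto dest!: class_mem simp: mult_pairs_smult fun_eq_iff)
  then show ?thesis by (simp add: x forms_inv_def forms_alg_def)
qed

end

theorem proposition3p4: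
  fixes p r q n :: nat and I :: "nat list"
  assumes "prime p" and "r \<ge> 1" and "q = p ^ r" and "CARD('a::{finite,field}) = q"
    and "q \<noteq> 2"
    and "composition I n"
  shows "bigraded_algebra_iso mult_map
    (tensor (Omega n) (sym_inv n (parabolic I :: 'a mat set)))
    (tensor_bidegree (Omega n) (Omega_bidegree n)
       (sym_inv n (parabolic I)) (sym_inv_bidegree n (parabolic I)))
    (forms_inv n (parabolic I))
    (forms_inv_bidegree n (parabolic I))"
proof -
  interpret graded_comparison p r n I "Omega n :: ('a, 'a form) module" "sym_inv n (parabolic I)"
    using assms by unfold_locales (auto simp: composition_def)
  show ?thesis
    unfolding bigraded_algebra_iso_def
    using mult_map_ring_iso mult_map_smult mult_map_bigraded by blast
qed

end
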